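(* Let $S$ be a locally compact Hausdorff space with countable base and $d$ a metric on $S$ inducing its topology. A subset $D\subset\mathbb{D}_{\mathrm{loc}}(S)$ is relatively compact for the local Skorokhod topology if and only if for all $t\ge0$ and all compact $K\subset S$, $$\sup_{x\in D}\omega'_{t,K,x}(\delta)\to0\quad\text{as }\delta\to0.$$
   Context: $\Delta\notin S$ is a point and $S^\Delta=S\cup\{\Delta\}$ is the one-point compactification of $S$ if $S$ is not compact, and the topological sum $S\sqcup\{\Delta\}$ ($\Delta$ isolated) if $S$ is compact. $C\Subset A$ means that $C\subset A$ is contained in a compact subset of $A$. $\mathbb{D}_{\mathrm{exp}}(S)$ is the set of maps $x:[0,T_{\max})\to S$, $0\le T_{\max}\le\infty$, that are right-continuous on $[0,T_{\max})$ and have left limits $x_{t-}\in S$ at each $t\in(0,T_{\max})$; write $\xi(x):=T_{\max}$ and set $x_t:=\Delta$ for $t\ge\xi(x)$. $\mathbb{D}_{\mathrm{loc}}(S)$ is the set of $x\in\mathbb{D}_{\mathrm{exp}}(S)$ such that if $\xi(x)\in(0,\infty)$ and $\{x_s\}_{s<\xi(x)}\Subset S$ then $x_{\xi(x)-}$ exists (in $S$). Local Skorokhod topology: the unique Polish topology on $\mathbb{D}_{\mathrm{loc}}(S)$ for which $x^k\to x$ if and only if there are $\lambda^k\in\Lambda$ such that: if $\xi(x)<\infty$ and $\{x_s\}_{s<\xi(x)}\Subset S$, then $\lambda^k_{\xi(x)}\le\xi(x^k)$ for $k$ large, $\sup_{s<\xi(x)}d(x_s,x^k_{\lambda^k_s})\to0$,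 $x^k_{\lambda^k_{\xi(x)}}\to\Delta$ and $\|\log\dot\lambda^k\|_{\xi(x)}\to0$; otherwise, for all $t<\xi(x)$, $\lambda^k_t<\xi(x^k)$ for $k$ large, $\sup_{s\le t}d(x_s,x^k_{\lambda^k_s})\to0$ and $\|\log\dot\lambda^k\|_t\to0$. Here $\Lambda$ is the set of increasing bijections $\lambda$ of $\mathbb{R}_+$ with $\lambda,\lambda^{-1}$ locally Lipschitz and $\|\log\dot\lambda\|_t:=\operatorname{ess\,sup}_{0\le s\le t}|\log\dot\lambda_s|$. For $x\in\mathbb{D}_{\mathrm{exp}}(S)$, $t\ge0$, $K\subset S$ compact and $\delta>0$, $\omega'_{t,K,x}(\delta)$ is the infimum of $$\sup_{\substack{0\le i<N\\ t_i\le s_1,s_2<t_{i+1}}}d(x_{s_1},x_{s_2})$$ over all $N\in\mathbb{N}=\{0,1,2,\dots\}$ and $0=t_0<\dots<t_N\le\xi(x)$ (real numbers) with $(t_N,x_{t_N})\notin[0,t]\times K$ and $t_{i+1}-t_i>\delta$ for all $0\le i<N$ ($\sup\emptyset=0$, $\inf\emptyset=+\infty$). *)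

theory Defs
  imports "HOL-Analysis.Analysis" "HOL-Probability.Essential_Supremum"
begin

text \<open>
  The metric space \<open>(S, d)\<close> is a subset \<open>S\<close> of a type of class \<open>metric_space\<close>, with \<open>d\<close> the
  restriction of \<open>dist\<close> to \<open>S\<close>. This allows every metric space, including the empty one.

  A map \<open>x : [0, T) \<rightarrow> S\<close> is a partial function \<open>real \<Rightarrow> 'a option\<close> with domain \<open>[0, T)\<close>, where
  \<open>T \<in> [0, \<infinity>]\<close> is an \<open>ennreal\<close>. The value \<open>None\<close> plays the role of the cemetery point \<open>\<Delta>\<close>, so
  that \<open>x t = \<Delta>\<close> for \<open>t \<ge> T\<close>. The space \<open>S \<union> {\<Delta>}\<close> is
  \<open>Alexandroff_compactification (top_of_set S)\<close>, in which \<open>None\<close> is isolated if \<open>S\<close> is compact.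

  Suprema of distances are taken in \<open>ennreal\<close>, so that the supremum of the empty set is \<open>0\<close> and
  the infimum of the empty set is \<open>\<infinity>\<close>.
\<close>

definition D_exp :: "'a::metric_space set \<Rightarrow> (real \<Rightarrow> 'a option) set"
  where "D_exp S = {x.
    (\<exists>T::ennreal. dom x = {t. 0 \<le> t \<and> ennreal t < T}) \<and>
    ran x \<subseteq> S \<and>
    (\<forall>t\<in>dom x. ((\<lambda>s. the (x s)) \<longlongrightarrow> the (x t)) (at_right t)) \<and>
    (\<forall>t\<in>dom x. t > 0 \<longrightarrow> (\<exists>l\<in>S. ((\<lambda>s. the (x s)) \<longlongrightarrow> l) (at_left t)))}"

definition lifetime :: "(real \<Rightarrow> 'a option) \<Rightarrow> ennreal"
  where "lifetime x = (SUP t\<in>dom x. ennreal t)"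

lemma lifetime_eq:
  assumes "dom x = {t. 0 \<le> t \<and> ennreal t < T}"
  shows "lifetime x = T"
  unfolding lifetime_def assms
proof (rule antisym)
  show "(SUP t\<in>{t. 0 \<le> t \<and> ennreal t < T}. ennreal t) \<le> T"
    by (auto intro!: SUP_least)
  show "T \<le> (SUP t\<in>{t. 0 \<le> t \<and> ennreal t < T}. ennreal t)"
  proof (rule dense_le)
    fix y assume y: "y < T"
    then have "y < top" using less_le_trans top_greatest by blast
    then have "y = ennreal (enn2real y)" by simp
    with y show "y \<le> (SUP t\<in>{t. 0 \<le> t \<and> ennreal t < T}. ennreal t)"
      by (intro SUP_upper2[of "enn2real y"]) auto
  qed
qed

definition relcompact_in :: "'a::metric_space set \<Rightarrow> 'a set \<Rightarrow> bool"
  where "relcompact_in C S \<longleftrightarrow> (\<exists>K. compact K \<and> K \<subseteq> S \<and> C \<subseteq> K)"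

definition D_loc :: "'a::metric_space set \<Rightarrow> (real \<Rightarrow> 'a option) set"
  where "D_loc S = {x \<in> D_exp S.
    0 < lifetime x \<and> lifetime x < \<infinity> \<and> relcompact_in (ran x) S \<longrightarrow>
    (\<exists>l\<in>S. ((\<lambda>s. the (x s)) \<longlongrightarrow> l) (at_left (enn2real (lifetime x))))}"

definition locally_Lipschitz_on :: "real set \<Rightarrow> (real \<Rightarrow> real) \<Rightarrow> bool"
  where "locally_Lipschitz_on A f \<longleftrightarrow>
    (\<forall>s\<in>A. \<exists>e>0. \<exists>L. L-lipschitz_on (cball s e \<inter> A) f)"

text \<open>The values of a time change outside \<open>[0, \<infinity>)\<close> are irrelevant.\<close>

definition time_changes :: "(real \<Rightarrow> real) set"
  where "time_changes = {l.
    bij_betw l {0..} {0..} \<and> strict_mono_on {0..} l \<and>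
    locally_Lipschitz_on {0..} l \<and> locally_Lipschitz_on {0..} (the_inv_into {0..} l)}"

definition log_deriv_norm :: "real \<Rightarrow> (real \<Rightarrow> real) \<Rightarrow> ennreal"
  where "log_deriv_norm t l = esssup (lebesgue_on {0..t}) (\<lambda>s. ennreal \<bar>ln (deriv l s)\<bar>)"

definition local_Skorokhod_conv ::
    "'a::metric_space set \<Rightarrow> (nat \<Rightarrow> real \<Rightarrow> 'a option) \<Rightarrow> (real \<Rightarrow> 'a option) \<Rightarrow> bool"
  where "local_Skorokhod_conv S xs x \<longleftrightarrow>
    (\<exists>l. (\<forall>k. l k \<in> time_changes) \<and>
      (if lifetime x < \<infinity> \<and> relcompact_in (ran x) S then
         let \<xi> = enn2real (lifetime x) in
           (\<forall>\<^sub>F k in sequentially. ennreal (l k \<xi>) \<le> lifetime (xs k)) \<and>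
           (\<lambda>k. SUP s\<in>{0..<\<xi>}. ennreal (dist (the (x s)) (the (xs k (l k s))))) \<longlonglongrightarrow> 0 \<and>
           limitin (Alexandroff_compactification (top_of_set S))
             (\<lambda>k. xs k (l k \<xi>)) None sequentially \<and>
           (\<lambda>k. log_deriv_norm \<xi> (l k)) \<longlonglongrightarrow> 0
       else
         (\<forall>t\<ge>0. ennreal t < lifetime x \<longrightarrow>
           (\<forall>\<^sub>F k in sequentially. ennreal (l k t) < lifetime (xs k)) \<and>
           (\<lambda>k. SUP s\<in>{0..t}. ennreal (dist (the (x s)) (the (xs k (l k s))))) \<longlonglongrightarrow> 0 \<and>
           (\<lambda>k. log_deriv_norm t (l k)) \<longlonglongrightarrow> 0)))"

definition Polish_topology :: "'b topology \<Rightarrow> bool"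
  where "Polish_topology T \<longleftrightarrow> completely_metrizable_space T \<and> separable_space T"

text \<open>
  \<open>is_local_Skorokhod_topology S T\<close> says that \<open>T\<close> is the Polish topology on \<open>D_loc S\<close> whose
  convergent sequences are the ones above. At most one \<open>T\<close> has this property (see below).
\<close>

definition is_local_Skorokhod_topology ::
    "'a::metric_space set \<Rightarrow> (real \<Rightarrow> 'a option) topology \<Rightarrow> bool"
  where "is_local_Skorokhod_topology S T \<longleftrightarrow>
    topspace T = D_loc S \<and> Polish_topology T \<and>
    (\<forall>xs x. (\<forall>k. xs k \<in> D_loc S) \<and> x \<in> D_loc S \<longrightarrow>
       (limitin T xs x sequentially \<longleftrightarrow> local_Skorokhod_conv S xs x))"

lemma is_local_Skorokhod_topology_unique:
  assumes "is_local_Skorokhod_topology S T1" "is_local_Skorokhod_topology S T2"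
  shows "T1 = T2"
proof -
  have closed: "closedin U2 C"
    if U: "is_local_Skorokhod_topology S U1" "is_local_Skorokhod_topology S U2"
      and C: "closedin U1 C" for U1 U2 C
  proof -
    from U(2) have "completely_metrizable_space U2"
      by (simp add: is_local_Skorokhod_topology_def Polish_topology_def)
    then obtain M d where M: "Metric_space M d" and U2: "U2 = Metric_space.mtopology M d"
      by (auto simp: completely_metrizable_space_def)
    interpret Metric_space M d by fact
    have tops: "topspace U1 = D_loc S" "M = D_loc S"
      using U U2 by (auto simp: is_local_Skorokhod_topology_def)
    have CM: "C \<subseteq> M" using closedin_subset[OF C] tops by simp
    have "l \<in> C" if s: "range \<sigma> \<subseteq> C" "limitin mtopology \<sigma> l sequentially" for \<sigma> l
    proof -
      have "l \<in> M" using s(2) by (auto simp: limitin_def)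
      moreover have "\<forall>k. \<sigma> k \<in> M" using s(1) CM by auto
      ultimately have "limitin U1 \<sigma> l sequentially"
        using U s(2) tops U2 unfolding is_local_Skorokhod_topology_def by blast
      then show "l \<in> C"
        by (rule limitin_closedin[OF _ C]) (use s(1) in \<open>auto intro!: always_eventually\<close>)
    qed
    then show "closedin U2 C"
      unfolding U2 metric_closedin_iff_sequentially_closed using CM by blast
  qed
  show ?thesis
    unfolding topology_eq closedin_def
    using closed[OF assms(1,2)] closed[OF assms(2,1)] assms
    by (metis is_local_Skorokhod_topology_def openin_closedin_eq)
qed

text \<open>
  The subdivision \<open>0 = t\<^sub>0 < \<dots> < t\<^sub>N\<close> is given by \<open>N\<close> and a sequence \<open>\<tau>\<close>, of which only
  \<open>\<tau> 0, \<dots>, \<tau> N\<close> matter.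
\<close>

definition subdivisions ::
    "real \<Rightarrow> 'a set \<Rightarrow> (real \<Rightarrow> 'a option) \<Rightarrow> real \<Rightarrow> (nat \<times> (nat \<Rightarrow> real)) set"
  where "subdivisions t K x \<delta> = {(N, \<tau>).
    \<tau> 0 = 0 \<and> (\<forall>i<N. \<tau> i < \<tau> (Suc i)) \<and> ennreal (\<tau> N) \<le> lifetime x \<and>
    (\<tau> N, x (\<tau> N)) \<notin> {0..t} \<times> Some ` K \<and>
    (\<forall>i<N. \<tau> (Suc i) - \<tau> i > \<delta>)}"

definition modulus :: "real \<Rightarrow> 'a::metric_space set \<Rightarrow> (real \<Rightarrow> 'a option) \<Rightarrow> real \<Rightarrow> ennreal"
  where "modulus t K x \<delta> =
    (INF (N, \<tau>)\<in>subdivisions t K x \<delta>.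
       SUP (i, s1, s2)\<in>{(i, s1, s2). i < N \<and> s1 \<in> {\<tau> i..<\<tau> (Suc i)} \<and> s2 \<in> {\<tau> i..<\<tau> (Suc i)}}.
         ennreal (dist (the (x s1)) (the (x s2))))"

end

theory Submission
  imports Defs "HOL-Library.Diagonal_Subsequence"
begin

text \<open>
  Since the topology is metrizable, relative compactness is a condition on sequences.

  If \<open>x\<^sup>k \<rightarrow> x\<close> via time changes \<open>\<lambda>\<^sup>k\<close>, a subdivision for the right-continuous path \<open>x\<close> with left
  limits is carried by \<open>\<lambda>\<^sup>k\<close> to one for \<open>x\<^sup>k\<close>. Its gaps shrink at most by a factor close to 1,
  because a bound on \<open>\<bar>ln \<lambda>'\<bar>\<close> that holds almost everywhere bounds the slopes of \<open>\<lambda>\<close>. This uses the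
  almost everywhere differentiability of \<open>\<lambda>\<close>, a consequence of the Vitali covering theorem.

  Conversely, exhaust \<open>S\<close> by compact sets \<open>K\<^sub>n\<close> and let \<open>\<epsilon>\<^sub>n \<rightarrow> 0\<close> be such that the
  \<open>\<epsilon>\<^sub>n\<close>-neighbourhood of \<open>K\<^sub>n\<close> lies in \<open>K\<^sub>n\<^sub>+\<^sub>1\<close>. The modulus condition gives, for every \<open>n\<close>, subdivisions of
  all paths up to the exit from \<open>[0, n] \<times> K\<^sub>n\<close>, with oscillation at most \<open>\<epsilon>\<^sub>n\<close> and boundedly many
  points. Along a diagonal subsequence the points, and the values of the paths there, converge for
  every \<open>n\<close>. The limits of the values at level \<open>n\<close> form a step function, and these step functions
  converge to the limit path as \<open>n \<rightarrow> \<infinity>\<close>. The time change for \<open>x\<^sup>k\<close> interpolates linearly between the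
  points at a level \<open>n(k)\<close> that tends to infinity slowly.
\<close>

section \<open>Slopes of a time change\<close>

text \<open>Convergence controls a time change only through the essential supremum of the
  logarithmic derivative, whereas the modulus needs increments. They are recovered from one covering
  estimate: if every point of a set has arbitrarily short chords of slope at most \<open>p\<close>,
  then the outer measure of its image is at most \<open>p\<close> times its own. Since inverses are
  time changes too, this estimate yields both differentiability almost everywhere and the slope
  bounds in both directions.

  In the converse, \<open>d\<close> is an arbitrary compatible metric: closed balls need not be
  compact and Cauchy sequences need not converge, so every limit is taken inside some compact
  \<open>K n\<close>. Partition values lie in \<open>K n\<close>, hence the path between them lies
  in \<open>K (Suc n)\<close>; this makes the ends of the partitions increase with the level. The
  delicate case is a limit path with finite lifetime and relatively compact range. There the
  limiting ends become constant from some level on, which supplies one time whose images under the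
  time changes are exit times from ever larger compact sets.\<close>

lemma time_changes_mono:
  assumes "l \<in> time_changes" "0 \<le> s" "s < t"
  shows "l s < l t"
  using assms by (auto simp: time_changes_def strict_mono_on_def)

lemma time_changes_mono_le:
  assumes "l \<in> time_changes" "0 \<le> s" "s \<le> t"
  shows "l s \<le> l t"
  using time_changes_mono[of l s t] assms by fastforce

lemma time_changes_nonneg:
  assumes "l \<in> time_changes" "0 \<le> s"
  shows "0 \<le> l s"
  using assms bij_betwE by (fastforce simp: time_changes_def)

lemma time_changes_inv_nonneg:
  assumes "l \<in> time_changes" "0 \<le> s"
  shows "0 \<le> the_inv_into {0..} l s"
proof -
  have "bij_betw (the_inv_into {0..} l) {0..} {0..}"
    using assms bij_betw_the_inv_into by (auto simp: time_changes_def)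
  from bij_betw_apply[OF this, of s] assms show ?thesis by simp
qed

lemma time_changes_inv_left:
  assumes "l \<in> time_changes" "0 \<le> s"
  shows "the_inv_into {0..} l (l s) = s"
  using assms by (auto simp: time_changes_def bij_betw_def the_inv_into_f_f)

lemma time_changes_inv_right:
  assumes "l \<in> time_changes" "0 \<le> s"
  shows "l (the_inv_into {0..} l s) = s"
  using assms f_the_inv_into_f_bij_betw[of l "{0..}" "{0..}" s] by (simp add: time_changes_def)

lemma time_changes_0:
  assumes "l \<in> time_changes"
  shows "l 0 = 0"
proof -
  let ?g = "the_inv_into {0..} l"
  have "l 0 \<le> l (?g 0)"
    by (rule time_changes_mono_le[OF assms]) (auto simp: time_changes_inv_nonneg[OF assms])
  moreover have "l (?g 0) = 0" by (rule time_changes_inv_right[OF assms]) simp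
  moreover have "0 \<le> l 0" by (rule time_changes_nonneg[OF assms]) simp
  ultimately show ?thesis by linarith
qed

lemma time_changes_less_iff:
  assumes "l \<in> time_changes" "0 \<le> s" "0 \<le> t"
  shows "l s < l t \<longleftrightarrow> s < t"
proof (cases "s < t")
  case True
  then show ?thesis using time_changes_mono[OF assms(1,2)] by simp
next
  case False
  then show ?thesis using time_changes_mono_le[OF assms(1,3), of s] by simp
qed

lemma time_changes_inv:
  assumes "l \<in> time_changes"
  shows "the_inv_into {0..} l \<in> time_changes"
proof -
  let ?g = "the_inv_into {0..} l"
  have bij: "bij_betw l {0..} {0..}" using assms by (simp add: time_changes_def)
  then have gbij: "bij_betw ?g {0..} {0..}" by (rule bij_betw_the_inv_into)
  \<comment> \<open>The inverse of the inverse agrees with \<open>l\<close> only on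
    \<open>{0..}\<close>; this is enough because the Lipschitz condition is relative to that
    set.\<close>
  have gl: "the_inv_into {0..} ?g s = l s" if "0 \<le> s" for s
    using that bij gbij assms time_changes_inv_left[OF assms that] time_changes_nonneg[OF assms that]
    by (intro the_inv_into_f_eq) (auto simp: bij_betw_def)
  have "strict_mono_on {0..} ?g"
  proof (rule strict_mono_onI)
    fix r s :: real assume rs: "r \<in> {0..}" "s \<in> {0..}" "r < s"
    then show "?g r < ?g s"
      using time_changes_less_iff[OF assms, of "?g r" "?g s"] time_changes_inv_nonneg[OF assms]
        time_changes_inv_right[OF assms] by auto
  qed
  moreover have "locally_Lipschitz_on {0..} (the_inv_into {0..} ?g)"
    unfolding locally_Lipschitz_on_def
  proof
    fix s :: real assume "s \<in> {0..}"
    then obtain e L where "e > 0" "L-lipschitz_on (cball s e \<inter> {0..}) l"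
      using assms unfolding time_changes_def locally_Lipschitz_on_def by blast
    then have "L-lipschitz_on (cball s e \<inter> {0..}) (the_inv_into {0..} ?g)"
      using gl by (subst lipschitz_on_cong[OF _ refl]) auto
    then show "\<exists>e>0. \<exists>L. L-lipschitz_on (cball s e \<inter> {0..}) (the_inv_into {0..} ?g)"
      using \<open>e > 0\<close> by blast
  qed
  ultimately show ?thesis
    using gbij assms by (auto simp: time_changes_def)
qed

lemma time_changes_local_bound:
  assumes "l \<in> time_changes" "0 \<le> s"
  obtains e L where "e > 0" "L > 0" "\<And>y z. 0 \<le> y \<Longrightarrow> \<bar>y - s\<bar> \<le> e \<Longrightarrow> 0 \<le> z \<Longrightarrow> \<bar>z - s\<bar> \<le> e \<Longrightarrow> \<bar>l y - l z\<bar> \<le> L * \<bar>y - z\<bar>"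
proof -
  obtain e L where e: "e > 0" and L: "L-lipschitz_on (cball s e \<inter> {0..}) l"
  proof -
    have "locally_Lipschitz_on {0..} l" using assms by (simp add: time_changes_def)
    then show ?thesis using assms(2) that unfolding locally_Lipschitz_on_def by (meson atLeast_iff)
  qed
  \<comment> \<open>Enlarging the constant to \<open>L + 1\<close> makes it strictly positive, so
    that later proofs can divide by it.\<close>
  have "\<bar>l y - l z\<bar> \<le> (L + 1) * \<bar>y - z\<bar>" if "0 \<le> y" "\<bar>y - s\<bar> \<le> e" "0 \<le> z" "\<bar>z - s\<bar> \<le> e" for y z
  proof -
    have "\<bar>l y - l z\<bar> \<le> L * \<bar>y - z\<bar>"
      using lipschitz_onD[OF L, of y z] that by (auto simp: dist_real_def abs_minus_commute)
    then show ?thesis by (simp add: algebra_simps)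
  qed
  moreover have "L + 1 > 0" using lipschitz_on_nonneg[OF L] by simp
  ultimately show ?thesis using e that by blast
qed

section \<open>Outer measure of images under a time change\<close>

text \<open>Locally Lipschitz maps preserve null sets. This allows the exceptional sets of covering
  and differentiation arguments to be discarded after applying \<open>l\<close> as well.\<close>

lemma negligible_image_time_changes:
  assumes l: "l \<in> time_changes" and "negligible Z" "Z \<subseteq> {0..}"
  shows "negligible (l ` Z)"
proof (rule negligible_locally_Lipschitz_image[OF _ \<open>negligible Z\<close>])
  show "DIM(real) \<le> DIM(real)" by simp
next
  fix x assume "x \<in> Z"
  then have x: "0 \<le> x" using assms by auto
  obtain e L where eL: "e > 0" "L > 0"
    "\<And>y z. 0 \<le> y \<Longrightarrow> \<bar>y - x\<bar> \<le> e \<Longrightarrow> 0 \<le> z \<Longrightarrow> \<bar>z - x\<bar> \<le> e \<Longrightarrow> \<bar>l y - l z\<bar> \<le> L * \<bar>y - z\<bar>"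
    by (rule time_changes_local_bound[OF l x]) blast
  show "\<exists>T B. open T \<and> x \<in> T \<and> (\<forall>y\<in>Z \<inter> T. norm (l y - l x) \<le> B * norm (y - x))"
  proof (intro exI conjI ballI)
    show "open (ball x e)" "x \<in> ball x e" using eL by auto
    fix y assume "y \<in> Z \<inter> ball x e"
    then show "norm (l y - l x) \<le> L * norm (y - x)"
      using assms(3) eL(1) x eL(3)[of y x] by (force simp: dist_real_def abs_minus_commute)
  qed
qed

text \<open>The short chords of slope at most \<open>p\<close> form a Vitali cover of
  \<open>E\<close>. A countable disjoint subfamily covers \<open>E\<close> up to a null set; by
  monotonicity \<open>l\<close> maps its intervals to disjoint intervals, each at most
  \<open>p\<close> times as long. The hypothesis only says that a lower derivate is at most
  \<open>p\<close>, and \<open>E\<close> is an arbitrary set, hence the outer measure.\<close>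

lemma outer_measure_of_image_slope_le:
  assumes l: "l \<in> time_changes" and E: "E \<subseteq> {0<..}" and "0 \<le> p"
    and slope: "\<And>x d. x \<in> E \<Longrightarrow> d > 0 \<Longrightarrow>
      \<exists>y\<ge>0. y \<noteq> x \<and> \<bar>y - x\<bar> < d \<and> (l y - l x) / (y - x) \<le> p"
  shows "outer_measure_of lebesgue (l ` E) \<le> ennreal p * outer_measure_of lebesgue E"
proof -
  have key: "outer_measure_of lebesgue (l ` E) \<le> ennreal p * emeasure lebesgue U"
    if "open U" "E \<subseteq> U" for U
  proof -
    \<comment> \<open>Intersecting with the positive half-line keeps all chosen intervals inside the
      region where \<open>l\<close> is controlled.\<close>
    define V where "V = U \<inter> {0<..}"
    have V: "open V" "E \<subseteq> V" using that E by (auto simp: V_def)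
    \<comment> \<open>Intervals are indexed by their end points, and \<open>m\<close> and
      \<open>r\<close> turn them into balls. The point to be covered will be an end point of its
      interval, which the covering theorem permits.\<close>
    define I where "I = {(c, d). c < d \<and> {c..d} \<subseteq> V \<and> l d - l c \<le> p * (d - c)}"
    define m where "m = (\<lambda>(c, d). (c + d) / 2 :: real)"
    define r where "r = (\<lambda>(c, d). (d - c) / 2 :: real)"
    have cb: "cball (m i) (r i) = {fst i..snd i}" for i
      by (auto simp: m_def r_def cball_eq_atLeastAtMost field_simps split: prod.splits)
    obtain C where C: "countable C" "C \<subseteq> I"
      "pairwise (\<lambda>i j. disjnt (cball (m i) (r i)) (cball (m j) (r j))) C"
      "negligible (E - (\<Union>i \<in> C. cball (m i) (r i)))"
    proof (rule Vitali_covering_theorem_cballs[of I r E m])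
      show "0 < r i" if "i \<in> I" for i using that by (auto simp: I_def r_def)
    next
      fix x d :: real assume x: "x \<in> E" and d: "0 < d"
      obtain e where e: "e > 0" "ball x e \<subseteq> V" using V x by (metis open_contains_ball subsetD)
      obtain y where y: "y \<ge> 0" "y \<noteq> x" "\<bar>y - x\<bar> < min d e" "(l y - l x) / (y - x) \<le> p"
        using slope[OF x, of "min d e"] d e by auto
      let ?i = "(min x y, max x y)"
      have "{min x y..max x y} \<subseteq> ball x e"
        using y by (auto simp: dist_real_def)
      moreover have "l (max x y) - l (min x y) \<le> p * (max x y - min x y)"
        using y by (cases "x < y") (auto simp: max_def min_def field_simps split: if_splits)
      ultimately have "?i \<in> I" using y e by (auto simp: I_def)
      moreover have "x \<in> cball (m ?i) (r ?i)" unfolding cb by auto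
      moreover have "r ?i < d" using y d by (auto simp: r_def)
      ultimately show "\<exists>i. i \<in> I \<and> x \<in> cball (m i) (r i) \<and> r i < d" by blast
    qed
    let ?Z = "E - (\<Union>i \<in> C. {fst i..snd i})"
    have "negligible ?Z" using C(4) by (simp add: cb)
    have nZ: "negligible (l ` ?Z)"
      using E by (intro negligible_image_time_changes[OF l \<open>negligible ?Z\<close>]) auto
    have pos: "0 < fst i" "fst i < snd i" "{fst i..snd i} \<subseteq> V" "l (snd i) - l (fst i) \<le> p * (snd i - fst i)"
      if "i \<in> C" for i
      using that C(2) by (fastforce simp: I_def V_def)+
    have lle: "l (fst i) \<le> l (snd i)" if "i \<in> C" for i
      using pos[OF that] by (intro time_changes_mono_le[OF l]) auto
    have sub: "l ` E \<subseteq> l ` ?Z \<union> (\<Union>i\<in>C. {l (fst i)..l (snd i)})"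
    proof
      fix z assume "z \<in> l ` E"
      then obtain x where x: "x \<in> E" "z = l x" by auto
      show "z \<in> l ` ?Z \<union> (\<Union>i\<in>C. {l (fst i)..l (snd i)})"
      proof (cases "x \<in> ?Z")
        case True then show ?thesis using x by auto
      next
        case False
        then obtain i where i: "i \<in> C" "x \<in> {fst i..snd i}" using x by auto
        then have "z \<in> {l (fst i)..l (snd i)}"
          using pos[OF i(1)] x by (auto intro!: time_changes_mono_le[OF l])
        with i show ?thesis by blast
      qed
    qed
    have dj0: "i = j" if "i \<in> C" "j \<in> C" "s \<in> {fst i..snd i}" "s \<in> {fst j..snd j}" for i j s
      using C(3) that unfolding pairwise_def cb disjnt_def by blast
    have dj: "disjoint_family_on (\<lambda>i. {fst i..snd i}) C"
      unfolding disjoint_family_on_def using dj0 by blast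
    have djl: "disjoint_family_on (\<lambda>i. {l (fst i)..l (snd i)}) C"
      unfolding disjoint_family_on_def
    proof (intro ballI impI, rule ccontr)
      fix i j assume ij: "i \<in> C" "j \<in> C" "i \<noteq> j" "{l (fst i)..l (snd i)} \<inter> {l (fst j)..l (snd j)} \<noteq> {}"
      then obtain z where z: "z \<in> {l (fst i)..l (snd i)}" "z \<in> {l (fst j)..l (snd j)}" by blast
      let ?s = "the_inv_into {0..} l z"
      have "0 \<le> z" using z time_changes_nonneg[OF l, of "fst i"] pos[OF ij(1)] by auto
      then have s: "0 \<le> ?s" "l ?s = z"
        using time_changes_inv_nonneg[OF l] time_changes_inv_right[OF l] by auto
      have "?s \<in> {fst h..snd h}" if "h \<in> C" "z \<in> {l (fst h)..l (snd h)}" for h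
        using that pos[OF that(1)] s time_changes_less_iff[OF l, of ?s "fst h"]
          time_changes_less_iff[OF l, of "snd h" ?s]
        by fastforce
      then show False using dj0 ij z by blast
    qed
    have "outer_measure_of lebesgue (l ` E)
        \<le> outer_measure_of lebesgue (l ` ?Z \<union> (\<Union>i\<in>C. {l (fst i)..l (snd i)}))"
      by (rule outer_measure_of_mono[OF sub])
    also have "\<dots> = emeasure lebesgue (l ` ?Z \<union> (\<Union>i\<in>C. {l (fst i)..l (snd i)}))"
      using nZ C(1) by (intro outer_measure_of_eq sets.Un sets.countable_UN') (auto intro: negligible_imp_sets)
    also have "\<dots> = emeasure lebesgue (\<Union>i\<in>C. {l (fst i)..l (snd i)})"
      using nZ C(1) by (subst Un_commute, intro emeasure_Un_null_set sets.countable_UN') (auto simp: negligible_iff_null_sets)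
    also have "\<dots> = (\<integral>\<^sup>+i. emeasure lebesgue {l (fst i)..l (snd i)} \<partial>count_space C)"
      using C(1) djl by (intro emeasure_UN_countable) auto
    also have "\<dots> \<le> (\<integral>\<^sup>+i. ennreal p * emeasure lebesgue {fst i..snd i} \<partial>count_space C)"
    proof (rule nn_integral_mono)
      fix i assume "i \<in> space (count_space C)"
      then have i: "i \<in> C" by simp
      show "emeasure lebesgue {l (fst i)..l (snd i)} \<le> ennreal p * emeasure lebesgue {fst i..snd i}"
        using pos[OF i] lle[OF i] \<open>0 \<le> p\<close> by (simp add: ennreal_mult[symmetric] ennreal_leI)
    qed
    also have "\<dots> = ennreal p * (\<integral>\<^sup>+i. emeasure lebesgue {fst i..snd i} \<partial>count_space C)"
      by (simp add: nn_integral_cmult)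
    also have "(\<integral>\<^sup>+i. emeasure lebesgue {fst i..snd i} \<partial>count_space C) = emeasure lebesgue (\<Union>i\<in>C. {fst i..snd i})"
      using C(1) dj by (intro emeasure_UN_countable[symmetric]) auto
    also have "\<dots> \<le> emeasure lebesgue U"
      using that pos(3) by (intro emeasure_mono) (force simp: V_def)+
    finally show ?thesis by (simp add: mult_left_mono)
  qed
  \<comment> \<open>Outer regularity is applied to a measurable hull, as \<open>E\<close> itself
    need not be measurable.\<close>
  obtain B where B: "B \<in> sets lebesgue" "E \<subseteq> B" "outer_measure_of lebesgue E = emeasure lebesgue B"
    using outer_measure_of_attain[of E lebesgue] by auto
  show ?thesis
  proof (rule ennreal_le_epsilon)
    fix e :: real assume "0 < e"
    \<comment> \<open>The denominator \<open>p + 1\<close> is nonzero even for \<open>p = 0\<close>,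
      and \<open>p * (e / (p + 1)) \<le> e\<close>.\<close>
    obtain U where U: "open U" "B \<subseteq> U" "(U - B) \<in> lmeasurable" "emeasure lebesgue (U - B) < ennreal (e / (p + 1))"
      using sets_lebesgue_outer_open[OF B(1), of "e / (p + 1)"] \<open>0 < e\<close> \<open>0 \<le> p\<close> by auto
    have "emeasure lebesgue U = emeasure lebesgue B + emeasure lebesgue (U - B)"
    proof -
      have "U = B \<union> (U - B)" using U by auto
      then show ?thesis using U(3) B(1) by (metis Diff_disjoint fmeasurableD plus_emeasure)
    qed
    also have "\<dots> \<le> outer_measure_of lebesgue E + ennreal (e / (p + 1))"
      using U B by (auto intro!: add_left_mono)
    finally have "ennreal p * emeasure lebesgue U \<le> ennreal p * (outer_measure_of lebesgue E + ennreal (e / (p + 1)))"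
      by (rule mult_left_mono) simp
    also have "\<dots> = ennreal p * outer_measure_of lebesgue E + ennreal (p * (e / (p + 1)))"
      using \<open>0 < e\<close> \<open>0 \<le> p\<close> unfolding distrib_left
      by (intro arg_cong2[where f="(+)"] refl ennreal_mult[symmetric]) auto
    also have "ennreal (p * (e / (p + 1))) \<le> ennreal e"
      using \<open>0 < e\<close> \<open>0 \<le> p\<close> by (intro ennreal_leI) (simp add: field_simps)
    finally have "ennreal p * emeasure lebesgue U \<le> ennreal p * outer_measure_of lebesgue E + ennreal e"
      by (simp add: add_left_mono)
    moreover have "E \<subseteq> U" using B U by auto
    ultimately show "outer_measure_of lebesgue (l ` E) \<le> ennreal p * outer_measure_of lebesgue E + ennreal e"
      using key[OF U(1)] by (meson order_trans)
  qed
qed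

lemma negligible_outer_measure_of:
  fixes E :: "real set"
  assumes "outer_measure_of lebesgue E = 0"
  shows "negligible E"
proof -
  obtain B where "B \<in> sets lebesgue" "E \<subseteq> B" "outer_measure_of lebesgue E = emeasure lebesgue B"
    using outer_measure_of_attain[of E lebesgue] by auto
  then have "negligible B" using assms by (simp add: negligible_iff_null_sets null_setsI)
  then show ?thesis using \<open>E \<subseteq> B\<close> negligible_subset by blast
qed

lemma outer_measure_of_le_Un_negligible:
  fixes A :: "real set"
  assumes "A \<subseteq> B \<union> Z" "negligible Z"
  shows "outer_measure_of lebesgue A \<le> outer_measure_of lebesgue B"
proof -
  obtain C where C: "C \<in> sets lebesgue" "B \<subseteq> C" "outer_measure_of lebesgue B = emeasure lebesgue C"
    using outer_measure_of_attain[of B lebesgue] by auto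
  have "outer_measure_of lebesgue A \<le> outer_measure_of lebesgue (C \<union> Z)"
    using assms C by (intro outer_measure_of_mono) auto
  also have "\<dots> = emeasure lebesgue (C \<union> Z)"
    using C negligible_imp_sets[OF assms(2)] by (intro outer_measure_of_eq sets.Un) auto
  also have "\<dots> = emeasure lebesgue C"
    using assms C by (intro emeasure_Un_null_set) (auto simp: negligible_iff_null_sets)
  finally show ?thesis using C by simp
qed

text \<open>Chord slopes of the inverse are reciprocals of chord slopes of \<open>l\<close>. Lower
  slope bounds for \<open>l\<close> thus become upper bounds for the inverse, so that the covering
  estimate serves both directions. The local Lipschitz constant ensures that short chords have short
  images.\<close>

lemma time_changes_inv_slope:
  assumes l: "l \<in> time_changes" and x: "0 \<le> x" and q: "0 < q" and d: "d > 0"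
    and slope: "\<And>d. d > 0 \<Longrightarrow> \<exists>y\<ge>0. y \<noteq> x \<and> \<bar>y - x\<bar> < d \<and> q \<le> (l y - l x) / (y - x)"
  defines "g \<equiv> the_inv_into {0..} l"
  shows "\<exists>z\<ge>0. z \<noteq> l x \<and> \<bar>z - l x\<bar> < d \<and> (g z - g (l x)) / (z - l x) \<le> 1 / q"
proof -
  obtain e L where eL: "e > 0" "L > 0"
    "\<And>y z. 0 \<le> y \<Longrightarrow> \<bar>y - x\<bar> \<le> e \<Longrightarrow> 0 \<le> z \<Longrightarrow> \<bar>z - x\<bar> \<le> e \<Longrightarrow> \<bar>l y - l z\<bar> \<le> L * \<bar>y - z\<bar>"
    by (rule time_changes_local_bound[OF l x]) blast
  obtain y where y: "y \<ge> 0" "y \<noteq> x" "\<bar>y - x\<bar> < min e (d / L)" "q \<le> (l y - l x) / (y - x)"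
    using slope[of "min e (d / L)"] eL d by auto
  have "\<bar>l y - l x\<bar> \<le> L * \<bar>y - x\<bar>" using eL(3)[of y x] y x eL(1) by simp
  also have "\<dots> < d" using y(3) eL(2) by (simp add: field_simps)
  finally have "\<bar>l y - l x\<bar> < d" .
  moreover have "l y \<noteq> l x"
    using y x time_changes_less_iff[OF l, of x y] time_changes_less_iff[OF l, of y x] by force
  moreover have "(g (l y) - g (l x)) / (l y - l x) \<le> 1 / q"
  proof -
    have "(g (l y) - g (l x)) / (l y - l x) = 1 / ((l y - l x) / (y - x))"
      using y x time_changes_inv_left[OF l] by (simp add: g_def)
    also have "\<dots> \<le> 1 / q" using y(4) q by (intro divide_left_mono mult_pos_pos) auto
    finally show ?thesis .
  qed
  ultimately show ?thesis using time_changes_nonneg[OF l y(1)] by blast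
qed

text \<open>The covering estimate for \<open>l\<close> and for its inverse shows that the outer
  measure of \<open>E\<close> is at most \<open>p / q\<close> times itself. With
  \<open>p / q < 1\<close> and finite measure this forces zero.\<close>

lemma negligible_slope_gap:
  assumes l: "l \<in> time_changes" and pq: "0 \<le> p" "p < q" and E: "E \<subseteq> {0<..<b}"
    and low: "\<And>x d. x \<in> E \<Longrightarrow> d > 0 \<Longrightarrow> \<exists>y\<ge>0. y \<noteq> x \<and> \<bar>y - x\<bar> < d \<and> (l y - l x) / (y - x) \<le> p"
    and high: "\<And>x d. x \<in> E \<Longrightarrow> d > 0 \<Longrightarrow> \<exists>y\<ge>0. y \<noteq> x \<and> \<bar>y - x\<bar> < d \<and> q \<le> (l y - l x) / (y - x)"
  shows "negligible E"
proof -
  let ?g = "the_inv_into {0..} l"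
  let ?\<mu> = "outer_measure_of lebesgue"
  have g: "?g \<in> time_changes" by (rule time_changes_inv[OF l])
  have gl: "?g ` l ` E = E"
  proof -
    have "?g (l x) = x" if "x \<in> E" for x
      using that E time_changes_inv_left[OF l, of x] by auto
    then show ?thesis by (force simp: image_image)
  qed
  have "?\<mu> (l ` E) \<le> ennreal p * ?\<mu> E"
    using E low pq by (intro outer_measure_of_image_slope_le[OF l]) auto
  have "?\<mu> (?g ` l ` E) \<le> ennreal (1 / q) * ?\<mu> (l ` E)"
  proof (rule outer_measure_of_image_slope_le[OF g])
    have "0 < l x" if "x \<in> E" for x
      using that E time_changes_mono[OF l, of 0 x] time_changes_0[OF l] by auto
    then show "l ` E \<subseteq> {0<..}" by auto
    show "0 \<le> 1 / q" using pq by simp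
    fix z d :: real assume "z \<in> l ` E" "d > 0"
    then obtain x where x: "x \<in> E" "z = l x" by auto
    show "\<exists>y\<ge>0. y \<noteq> z \<and> \<bar>y - z\<bar> < d \<and> (?g y - ?g z) / (y - z) \<le> 1 / q"
      unfolding x(2) using E x pq \<open>d > 0\<close> high[OF x(1)] by (intro time_changes_inv_slope[OF l]) auto
  qed
  also have "\<dots> \<le> ennreal (1 / q) * (ennreal p * ?\<mu> E)"
    using \<open>?\<mu> (l ` E) \<le> _\<close> by (rule mult_left_mono) simp
  also have "\<dots> = ennreal (p / q) * ?\<mu> E"
    using pq by (simp add: mult.assoc[symmetric] ennreal_mult[symmetric])
  finally have le: "?\<mu> E \<le> ennreal (p / q) * ?\<mu> E" by (simp add: gl)
  \<comment> \<open>Boundedness of \<open>E\<close> makes its outer measure finite, so the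
    inequality can be rearranged in the reals.\<close>
  have "?\<mu> E \<le> ?\<mu> {0<..<b}" using E by (rule outer_measure_of_mono)
  also have "\<dots> < top" by (cases "0 \<le> b") auto
  finally obtain m where m: "?\<mu> E = ennreal m" "0 \<le> m" by (metis ennreal_cases less_irrefl)
  then have "m \<le> p / q * m" using le pq by (simp add: ennreal_mult[symmetric])
  then have "m * (1 - p / q) \<le> 0" by (simp add: algebra_simps)
  moreover have "0 < 1 - p / q" using pq by simp
  ultimately have "m = 0" using m(2) mult_pos_pos[of m "1 - p / q"] by linarith
  then show ?thesis using m by (intro negligible_outer_measure_of) simp
qed

text \<open>Where \<open>l\<close> is not differentiable, \<open>deriv l\<close> is an unspecified constant, and \<open>ln 0 = 0\<close>. So
  \<open>log_deriv_norm\<close> bounds the slopes of \<open>l\<close> only because these points form a null set and the derivative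
  is positive elsewhere.\<close>

lemma time_changes_AE_differentiable:
  assumes l: "l \<in> time_changes"
  shows "negligible {x \<in> {0<..<b}. \<not> l differentiable (at x)}"
proof -
  define low where "low p = {x. \<forall>d>0. \<exists>y\<ge>0. y \<noteq> x \<and> \<bar>y - x\<bar> < d \<and> (l y - l x) / (y - x) \<le> p}" for p
  define high where "high q = {x. \<forall>d>0. \<exists>y\<ge>0. y \<noteq> x \<and> \<bar>y - x\<bar> < d \<and> q \<le> (l y - l x) / (y - x)}" for q
  \<comment> \<open>If the lower and upper derivates differ, rationals fit between them; only
    countably many pairs occur.\<close>
  define I where "I = {(p, q). p \<in> \<rat> \<and> q \<in> \<rat> \<and> 0 \<le> p \<and> p < (q::real)}"
  have "countable I"
    by (rule countable_subset[of _ "\<rat> \<times> \<rat>"]) (auto simp: I_def countable_rat)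
  then have "negligible (\<Union>(p, q)\<in>I. {0<..<b} \<inter> low p \<inter> high q)"
  proof (rule negligible_countable_Union[OF countable_image, unfolded image_image, simplified])
    fix A assume "A \<in> (\<lambda>(p, q). {0<..<b} \<inter> low p \<inter> high q) ` I"
    then obtain p q where A: "A = {0<..<b} \<inter> low p \<inter> high q" "0 \<le> p" "p < q"
      by (auto simp: I_def)
    show "negligible A"
      using A by (intro negligible_slope_gap[OF l A(2,3), of A b]) (auto simp: low_def high_def)
  qed
  then show ?thesis
  proof (rule negligible_subset)
    show "{x \<in> {0<..<b}. \<not> l differentiable (at x)} \<subseteq> (\<Union>(p, q)\<in>I. {0<..<b} \<inter> low p \<inter> high q)"
    proof (rule ccontr)
      assume "\<not> ?thesis"
      then obtain x where x: "x \<in> {0<..<b}" "\<not> l differentiable (at x)"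
        and nin: "\<And>p q. (p, q) \<in> I \<Longrightarrow> x \<notin> low p \<inter> high q" by blast
      then have x0: "0 \<le> x" by auto
      \<comment> \<open>Difference quotients are taken as extended reals, where lower and upper
        limits always exist.\<close>
      define h where "h y = ereal ((l y - l x) / (y - x))" for y
      obtain e L where eL: "e > 0" "L > 0"
        "\<And>y z. 0 \<le> y \<Longrightarrow> \<bar>y - x\<bar> \<le> e \<Longrightarrow> 0 \<le> z \<Longrightarrow> \<bar>z - x\<bar> \<le> e \<Longrightarrow> \<bar>l y - l z\<bar> \<le> L * \<bar>y - z\<bar>"
        by (rule time_changes_local_bound[OF l x0]) blast
      have near: "\<forall>\<^sub>F y in at x. y \<noteq> x \<and> 0 \<le> y \<and> \<bar>y - x\<bar> < d" if "d > 0" for d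
        unfolding eventually_at using that x
        by (intro exI[of _ "min d x"]) (auto simp: dist_real_def)
      have bounds: "\<forall>\<^sub>F y in at x. 0 \<le> h y \<and> h y \<le> ereal L"
        using near[OF eL(1)]
      proof eventually_elim
        case (elim y)
        have "\<bar>l y - l x\<bar> \<le> L * \<bar>y - x\<bar>" using eL(3)[of y x] elim x0 eL(1) by simp
        then have "\<bar>(l y - l x) / (y - x)\<bar> \<le> L" using elim by (simp add: abs_divide field_simps)
        moreover have "0 \<le> (l y - l x) / (y - x)"
          using elim x0 time_changes_mono[OF l, of x y] time_changes_mono[OF l, of y x]
          by (cases "x < y") (auto simp: field_simps)
        ultimately have "0 \<le> (l y - l x) / (y - x)" "(l y - l x) / (y - x) \<le> L" by linarith+
        then show ?case by (simp add: h_def)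
      qed
      have nb: "at x \<noteq> bot" by simp
      have Li: "0 \<le> Liminf (at x) h" using bounds by (intro Liminf_bounded) (auto elim: eventually_mono)
      have Ls: "Limsup (at x) h \<le> ereal L" using bounds by (intro Limsup_bounded) (auto elim: eventually_mono)
      have "Liminf (at x) h = Limsup (at x) h"
      proof (rule ccontr)
        assume "\<not> ?thesis"
        then have "Liminf (at x) h < Limsup (at x) h" using Liminf_le_Limsup[OF nb, of h] by simp
        \<comment> \<open>The outer pair \<open>u < v\<close> leaves room for rationals
          \<open>u < p < q < v\<close>: quotients eventually above \<open>p\<close> would push the
          lower limit up to \<open>u\<close>, and quotients eventually below \<open>q\<close> would
          push the upper limit down to \<open>v\<close>.\<close>
        then obtain u v where uv: "Liminf (at x) h < ereal u" "u < v" "ereal v < Limsup (at x) h"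
          by (metis ereal_dense2 less_ereal.simps(1))
        have "0 < u" using Li uv(1) by (metis ereal_less(2) le_less_trans)
        obtain p where p: "p \<in> \<rat>" "u < p" "p < v" using Rats_dense_in_real[OF uv(2)] by blast
        obtain q where q: "q \<in> \<rat>" "p < q" "q < v" using Rats_dense_in_real[OF p(3)] by blast
        have "x \<in> low p"
          unfolding low_def
        proof (intro CollectI allI impI, rule ccontr)
          fix d :: real assume d: "d > 0" "\<not> (\<exists>y\<ge>0. y \<noteq> x \<and> \<bar>y - x\<bar> < d \<and> (l y - l x) / (y - x) \<le> p)"
          have "\<forall>\<^sub>F y in at x. ereal u \<le> h y"
            using near[OF d(1)]
          proof eventually_elim
            case (elim y)
            then have "p < (l y - l x) / (y - x)" using d(2) by (meson not_le)
            then show ?case using p(2) by (simp add: h_def)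
          qed
          then show False using Liminf_bounded[of "ereal u" h "at x"] uv(1) by simp
        qed
        moreover have "x \<in> high q"
          unfolding high_def
        proof (intro CollectI allI impI, rule ccontr)
          fix d :: real assume d: "d > 0" "\<not> (\<exists>y\<ge>0. y \<noteq> x \<and> \<bar>y - x\<bar> < d \<and> q \<le> (l y - l x) / (y - x))"
          have "\<forall>\<^sub>F y in at x. h y \<le> ereal v"
            using near[OF d(1)]
          proof eventually_elim
            case (elim y)
            then have "(l y - l x) / (y - x) < q" using d(2) by (meson not_le)
            then show ?case using q(3) by (simp add: h_def)
          qed
          then show False using Limsup_bounded[of h "ereal v" "at x"] uv(3) by simp
        qed
        ultimately show False using nin[of p q] p q \<open>0 < u\<close> by (auto simp: I_def)
      qed
      \<comment> \<open>The local Lipschitz bound rules out an infinite derivative.\<close>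
      moreover obtain D where D: "Limsup (at x) h = ereal D"
        using Li Ls calculation by (cases "Limsup (at x) h") auto
      ultimately have "(h \<longlongrightarrow> ereal D) (at x)"
        using tendsto_iff_Liminf_eq_Limsup[OF nb] by metis
      then have "((\<lambda>y. (l y - l x) / (y - x)) \<longlongrightarrow> D) (at x)"
        unfolding h_def by (simp only: lim_ereal)
      then have "(l has_field_derivative D) (at x)" by (simp add: has_field_derivative_iff)
      then show False using x(2) real_differentiable_def by blast
    qed
  qed
qed

text \<open>Almost every point of the interval has a derivative between
  \<open>exp (- \<eta>)\<close> and \<open>exp \<eta>\<close>. The covering estimate, applied to
  \<open>l\<close> and to its inverse, turns this pointwise information into bounds on increments;
  null sets are negligible on both sides.\<close>

theorem time_changes_slope_bounds:
  assumes l: "l \<in> time_changes" and eta: "0 \<le> \<eta>" "log_deriv_norm t l \<le> ennreal \<eta>"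
    and ab: "0 \<le> a" "a \<le> b" "b \<le> t"
  shows "b - a \<le> exp \<eta> * (l b - l a)" "l b - l a \<le> exp \<eta> * (b - a)"
proof -
  let ?g = "the_inv_into {0..} l"
  let ?\<mu> = "outer_measure_of lebesgue"
  have g: "?g \<in> time_changes" by (rule time_changes_inv[OF l])
  have "AE x in lebesgue_on {0..t}. ennreal \<bar>ln (deriv l x)\<bar> \<le> ennreal \<eta>"
    using esssup_AE[of "\<lambda>s. ennreal \<bar>ln (deriv l s)\<bar>" "lebesgue_on {0..t}"] eta
    unfolding log_deriv_norm_def by (elim eventually_mono) (rule order_trans)
  then have "AE x in lebesgue. x \<in> {0..t} \<longrightarrow> \<bar>ln (deriv l x)\<bar> \<le> \<eta>"
    using eta(1) by (subst (asm) AE_restrict_space_iff) auto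
  then obtain N1 where N1: "N1 \<in> null_sets lebesgue" "{x. \<not> (x \<in> {0..t} \<longrightarrow> \<bar>ln (deriv l x)\<bar> \<le> \<eta>)} \<subseteq> N1"
    by (elim AE_E3) (rule that, auto)
  define N2 where "N2 = {x \<in> {0<..<b}. \<not> l differentiable (at x)}"
  \<comment> \<open>The points where \<open>l\<close> is differentiable and the essential bound
    holds.\<close>
  define R where "R = {a<..<b} - N1 - N2"
  have nZ: "negligible ({a..b} - R)"
  proof (rule negligible_subset)
    show "negligible (N1 \<union> N2 \<union> {a, b})"
      using N1(1) time_changes_AE_differentiable[OF l] by (auto simp: N2_def negligible_iff_null_sets)
    show "{a..b} - R \<subseteq> N1 \<union> N2 \<union> {a, b}" by (auto simp: R_def)
  qed
  have R: "R \<subseteq> {0<..}" using ab by (auto simp: R_def)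
  have gR: "?g ` l ` R = R"
  proof -
    have "?g (l x) = x" if "x \<in> R" for x
      using that R time_changes_inv_left[OF l, of x] by auto
    then show ?thesis by (force simp: image_image)
  qed
  have lR: "l ` R \<subseteq> {l a..l b}"
    using ab by (auto simp: R_def intro!: time_changes_mono_le[OF l])
  have lim: "\<exists>D. exp (- \<eta>) \<le> D \<and> D \<le> exp \<eta> \<and> ((\<lambda>y. (l y - l x) / (y - x)) \<longlongrightarrow> D) (at x)" if "x \<in> R" for x
  proof -
    have x: "0 < x" "x \<in> {0..t}" "0 \<le> l x" using that ab time_changes_nonneg[OF l] by (auto simp: R_def)
    have "l differentiable (at x)" using that x ab by (auto simp: R_def N2_def)
    then have D: "(l has_field_derivative deriv l x) (at x)"
      by (simp add: DERIV_deriv_iff_real_differentiable)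
    then have lm: "((\<lambda>y. (l y - l x) / (y - x)) \<longlongrightarrow> deriv l x) (at x)"
      by (simp add: has_field_derivative_iff)
    \<comment> \<open>The Lipschitz constant of the inverse near \<open>l x\<close> bounds the
      slopes of \<open>l\<close> at \<open>x\<close> from below by \<open>1 / L\<close>. Hence the
      derivative is positive; the bound on \<open>ln\<close> alone would not exclude 0, as
      \<open>ln 0 = 0\<close>.\<close>
    obtain e L where eL: "e > 0" "L > 0"
      "\<And>y z. 0 \<le> y \<Longrightarrow> \<bar>y - l x\<bar> \<le> e \<Longrightarrow> 0 \<le> z \<Longrightarrow> \<bar>z - l x\<bar> \<le> e \<Longrightarrow> \<bar>?g y - ?g z\<bar> \<le> L * \<bar>y - z\<bar>"
      by (rule time_changes_local_bound[OF g x(3)]) blast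
    have "isCont l x" using D by (rule DERIV_isCont)
    then have "\<forall>\<^sub>F y in at x. dist (l y) (l x) < e"
      using eL(1) by (simp add: isCont_def tendstoD)
    moreover have "\<forall>\<^sub>F y in at x. y \<noteq> x \<and> 0 \<le> y"
      unfolding eventually_at using x by (intro exI[of _ x]) (auto simp: dist_real_def)
    ultimately have "\<forall>\<^sub>F y in at x. 1 / L \<le> (l y - l x) / (y - x)"
    proof eventually_elim
      case (elim y)
      have le: "\<bar>y - x\<bar> \<le> L * \<bar>l y - l x\<bar>"
        using eL(3)[of "l y" "l x"] elim x eL(1) time_changes_nonneg[OF l, of y]
          time_changes_inv_left[OF l, of y] time_changes_inv_left[OF l, of x]
        by (auto simp: dist_real_def)
      show ?case
      proof (cases "x < y")
        case True
        then show ?thesis using le time_changes_mono[OF l, of x y] x eL(2) by (simp add: field_simps)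
      next
        case False
        then have "y < x" using elim by simp
        then show ?thesis using le time_changes_mono[OF l, of y x] elim eL(2) by (simp add: field_simps)
      qed
    qed
    then have "1 / L \<le> deriv l x" by (intro tendsto_lowerbound[OF lm]) auto
    moreover have "0 < 1 / L" using eL(2) by simp
    ultimately have pos: "0 < deriv l x" by linarith
    have "\<bar>ln (deriv l x)\<bar> \<le> \<eta>" using N1(2) x(2) that by (auto simp: R_def)
    then have "ln (deriv l x) \<le> \<eta>" "- \<eta> \<le> ln (deriv l x)" by linarith+
    then have "deriv l x \<le> exp \<eta>" "exp (- \<eta>) \<le> deriv l x"
      using pos by (metis exp_le_cancel_iff exp_ln)+
    then show ?thesis using lm by blast
  qed
  have near: "\<forall>\<^sub>F y in at x. y \<noteq> x \<and> 0 \<le> y \<and> \<bar>y - x\<bar> < d" if "d > 0" "x \<in> R" for d x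
    unfolding eventually_at using that R
    by (intro exI[of _ "min d x"]) (auto simp: dist_real_def)
  have nb: "at (x::real) \<noteq> bot" for x by simp
  have m: "?\<mu> {c..d} = ennreal (d - c)" if "c \<le> d" for c d :: real
    using that by simp
  have lab: "l a \<le> l b" by (rule time_changes_mono_le[OF l ab(1,2)])
  \<comment> \<open>The chords only converge to a slope of at most \<open>exp \<eta>\<close>, so the
    estimate needs a strictly larger \<open>p\<close>, which tends to \<open>exp \<eta>\<close> at
    the end.\<close>
  have up: "l b - l a \<le> p * (b - a)" if p: "p > exp \<eta>" for p
  proof -
    have p0: "0 < p" using p by (meson exp_gt_zero less_trans)
    have "{l a..l b} \<subseteq> l ` R \<union> l ` ({a..b} - R)"
    proof
      fix z assume z: "z \<in> {l a..l b}"
      have z0: "0 \<le> z" using z time_changes_nonneg[OF l ab(1)] by auto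
      have "?g z \<in> {a..b}"
        using z z0 ab time_changes_less_iff[OF l, of "?g z" a] time_changes_less_iff[OF l, of b "?g z"]
          time_changes_inv_nonneg[OF l z0] time_changes_inv_right[OF l z0] by force
      then show "z \<in> l ` R \<union> l ` ({a..b} - R)"
        using time_changes_inv_right[OF l z0] by (metis Diff_iff UnCI image_eqI)
    qed
    then have "?\<mu> {l a..l b} \<le> ?\<mu> (l ` R)"
      by (rule outer_measure_of_le_Un_negligible[OF _ negligible_image_time_changes[OF l nZ]])
        (use ab in auto)
    also have "\<dots> \<le> ennreal p * ?\<mu> R"
    proof (rule outer_measure_of_image_slope_le[OF l R])
      show "0 \<le> p" using p0 by simp
      fix x d :: real assume xd: "x \<in> R" "d > 0"
      obtain D where D: "D \<le> exp \<eta>" "((\<lambda>y. (l y - l x) / (y - x)) \<longlongrightarrow> D) (at x)" using lim[OF xd(1)] by blast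
      then have "\<forall>\<^sub>F y in at x. (l y - l x) / (y - x) < p" using p by (intro order_tendstoD(2)[OF D(2)]) auto
      from eventually_happens[OF eventually_conj[OF this near[OF xd(2,1)]]]
      show "\<exists>y\<ge>0. y \<noteq> x \<and> \<bar>y - x\<bar> < d \<and> (l y - l x) / (y - x) \<le> p" by fastforce
    qed
    also have "?\<mu> R \<le> ?\<mu> {a..b}" by (rule outer_measure_of_mono) (auto simp: R_def)
    finally have "?\<mu> {l a..l b} \<le> ennreal p * ?\<mu> {a..b}" by (simp add: mult_left_mono)
    then show ?thesis using lab ab p0 by (simp add: m ennreal_mult[symmetric])
  qed
  have down: "b - a \<le> p * (l b - l a)" if p: "p > exp \<eta>" for p
  proof -
    have p0: "0 < p" using p by (meson exp_gt_zero less_trans)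
    have "1 / p < exp (- \<eta>)" using p p0 by (simp add: exp_minus field_simps)
    have "?\<mu> {a..b} \<le> ?\<mu> R"
      using nZ by (intro outer_measure_of_le_Un_negligible[of _ _ "{a..b} - R"]) auto
    also have "\<dots> = ?\<mu> (?g ` l ` R)" by (simp add: gR)
    also have "\<dots> \<le> ennreal p * ?\<mu> (l ` R)"
    proof (rule outer_measure_of_image_slope_le[OF g])
      have "0 < l x" if "x \<in> R" for x
        using that R time_changes_mono[OF l, of 0 x] time_changes_0[OF l] by auto
      then show "l ` R \<subseteq> {0<..}" by auto
      show "0 \<le> p" using p0 by simp
      fix z d :: real assume "z \<in> l ` R" and d: "d > 0"
      then obtain x where x: "x \<in> R" "z = l x" by auto
      obtain D where D: "exp (- \<eta>) \<le> D" "((\<lambda>y. (l y - l x) / (y - x)) \<longlongrightarrow> D) (at x)" using lim[OF x(1)] by blast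
      then have ev: "\<forall>\<^sub>F y in at x. 1 / p < (l y - l x) / (y - x)"
        using \<open>1 / p < exp (- \<eta>)\<close> by (intro order_tendstoD(1)[OF D(2)]) auto
      have "\<exists>y\<ge>0. y \<noteq> x \<and> \<bar>y - x\<bar> < d \<and> 1 / p \<le> (l y - l x) / (y - x)" if "d > 0" for d
        using eventually_happens[OF eventually_conj[OF ev near[OF that x(1)]]] by fastforce
      from time_changes_inv_slope[OF l _ _ d this] R x p0
      show "\<exists>y\<ge>0. y \<noteq> z \<and> \<bar>y - z\<bar> < d \<and> (?g y - ?g z) / (y - z) \<le> p" by auto
    qed
    also have "?\<mu> (l ` R) \<le> ?\<mu> {l a..l b}" by (rule outer_measure_of_mono[OF lR])
    finally have "?\<mu> {a..b} \<le> ennreal p * ?\<mu> {l a..l b}" by (simp add: mult_left_mono)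
    then show ?thesis using lab ab p0 by (simp add: m ennreal_mult[symmetric])
  qed
  have lim_p: "((\<lambda>p. p * c) \<longlongrightarrow> exp \<eta> * c) (at_right (exp \<eta>))" for c
    by (intro tendsto_intros)
  show "b - a \<le> exp \<eta> * (l b - l a)"
    by (rule tendsto_lowerbound[OF lim_p]) (auto intro!: eventually_at_right_less[THEN eventually_mono] down)
  show "l b - l a \<le> exp \<eta> * (b - a)"
    by (rule tendsto_lowerbound[OF lim_p]) (auto intro!: eventually_at_right_less[THEN eventually_mono] up)
qed

section \<open>Piecewise affine time changes\<close>

lemma less_upto_steps:
  fixes \<tau> :: "nat \<Rightarrow> 'a::order"
  assumes "\<And>i. i < N \<Longrightarrow> \<tau> i < \<tau> (Suc i)" "i < j" "j \<le> N"
  shows "\<tau> i < \<tau> j"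
  using assms(2,3)
proof (induction j)
  case (Suc j)
  then have "\<tau> j < \<tau> (Suc j)" using assms(1) by simp
  moreover have "\<tau> i \<le> \<tau> j" using Suc by (cases "i = j") auto
  ultimately show ?case by (rule le_less_trans[rotated])
qed simp

lemma le_upto_steps:
  fixes \<tau> :: "nat \<Rightarrow> 'a::order"
  assumes "\<And>i. i < N \<Longrightarrow> \<tau> i < \<tau> (Suc i)" "i \<le> j" "j \<le> N"
  shows "\<tau> i \<le> \<tau> j"
  using less_upto_steps[of N \<tau> i j] assms by (cases "i = j") auto

text \<open>Induction over the nodes: the graph beyond the last node is replaced by a line through
  the next one. The set \<open>F\<close> collects the kinks; being affine near every other point is
  what later determines the derivative there.\<close>

lemma ex_piecewise_affine:
  fixes \<tau> p :: "nat \<Rightarrow> real"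
  assumes "c \<le> 1" "1 \<le> C" "\<tau> 0 = p 0"
    and "\<And>i. i < N \<Longrightarrow> \<tau> i < \<tau> (Suc i)"
    and "\<And>i. i < N \<Longrightarrow> c * (\<tau> (Suc i) - \<tau> i) \<le> p (Suc i) - p i"
    and "\<And>i. i < N \<Longrightarrow> p (Suc i) - p i \<le> C * (\<tau> (Suc i) - \<tau> i)"
  shows "\<exists>l F. finite F \<and> (\<forall>s t. s \<le> t \<longrightarrow> c * (t - s) \<le> l t - l s \<and> l t - l s \<le> C * (t - s)) \<and>
    (\<forall>i\<le>N. l (\<tau> i) = p i) \<and> (\<forall>s. s \<notin> F \<longrightarrow> (\<exists>m b. \<forall>\<^sub>F u in nhds s. l u = m * u + b))"
  using assms(4-)
proof (induction N)
  case 0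
  \<comment> \<open>Without nodes to join, the identity is used; its slope 1 is allowed because
    \<open>c \<le> 1 \<le> C\<close>.\<close>
  have "c * (t - s) \<le> t - s \<and> t - s \<le> C * (t - s)" if "s \<le> t" for s t :: real
    using that assms(1,2) mult_right_mono[of c 1 "t - s"] mult_right_mono[of 1 C "t - s"] by simp
  moreover have "\<exists>m b. \<forall>\<^sub>F u in nhds s. u = m * u + (b::real)" for s :: real
    by (intro exI[of _ 1] exI[of _ 0]) simp
  ultimately show ?case
    using assms(3) by (intro exI[of _ "\<lambda>s. s"] exI[of _ "{}"]) auto
next
  case (Suc N)
  then obtain l F where l: "finite F"
    "\<And>s t. s \<le> t \<Longrightarrow> c * (t - s) \<le> l t - l s \<and> l t - l s \<le> C * (t - s)"
    "\<And>i. i \<le> N \<Longrightarrow> l (\<tau> i) = p i" "\<And>s. s \<notin> F \<Longrightarrow> \<exists>m b. \<forall>\<^sub>F u in nhds s. l u = m * u + b"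
    by fastforce
  define T r where "T = \<tau> N" and "r = (p (Suc N) - p N) / (\<tau> (Suc N) - \<tau> N)"
  define l' where "l' s = (if s \<le> T then l s else l T + r * (s - T))" for s
  have T: "T < \<tau> (Suc N)" using Suc.prems(1) by (simp add: T_def)
  have r: "c \<le> r" "r \<le> C"
    using Suc.prems(1-3)[of N] by (auto simp: r_def field_simps)
  have mono: "\<tau> i \<le> \<tau> N" if "i \<le> N" for i
    using that le_upto_steps[of "Suc N" \<tau> i N] Suc.prems(1) by simp
  have "c * (t - s) \<le> l' t - l' s \<and> l' t - l' s \<le> C * (t - s)" if st: "s \<le> t" for s t
  proof -
    have aff: "c * x \<le> r * x \<and> r * x \<le> C * x" if "0 \<le> x" for x
      using r that by (auto intro: mult_right_mono)
    consider "t \<le> T" | "s \<le> T" "T < t" | "T < s" by linarith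
    then show ?thesis
    proof cases
      case 1
      then show ?thesis using l(2)[OF st] st by (simp add: l'_def)
    next
      case 2
      then show ?thesis using l(2)[of s T] aff[of "t - T"] by (simp add: l'_def algebra_simps)
    next
      case 3
      then show ?thesis using aff[of "t - s"] st by (simp add: l'_def algebra_simps)
    qed
  qed
  moreover have "l' (\<tau> i) = p i" if "i \<le> Suc N" for i
  proof (cases "i = Suc N")
    case True
    then show ?thesis using T l(3)[of N] by (simp add: l'_def r_def T_def)
  next
    case False
    then have "i \<le> N" using that by simp
    then show ?thesis using mono[of i] l(3)[of i] by (simp add: l'_def T_def)
  qed
  moreover have "\<exists>m b. \<forall>\<^sub>F u in nhds s. l' u = m * u + b" if "s \<notin> insert T F" for s
  proof (cases "s < T")
    case True
    from that have "s \<notin> F" by simp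
    from l(4)[OF this] obtain m b where "\<forall>\<^sub>F u in nhds s. l u = m * u + b" by blast
    moreover have "\<forall>\<^sub>F u in nhds s. u < T" using True by (rule order_tendstoD[OF filterlim_ident])
    ultimately have "\<forall>\<^sub>F u in nhds s. l' u = m * u + b" by eventually_elim (simp add: l'_def)
    then show ?thesis by blast
  next
    case False
    then have "T < s" using that by auto
    then have "\<forall>\<^sub>F u in nhds s. T < u" by (rule order_tendstoD[OF filterlim_ident])
    then have "\<forall>\<^sub>F u in nhds s. l' u = r * u + (l T - r * T)"
      by eventually_elim (simp add: l'_def algebra_simps)
    then show ?thesis by blast
  qed
  ultimately show ?case
    using l(1) by (intro exI[of _ l'] exI[of _ "insert T F"]) blast
qed

lemma bilipschitz_time_changes:
  fixes l :: "real \<Rightarrow> real"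
  assumes "0 < c" and "l 0 = 0"
    and l: "\<And>s t. s \<le> t \<Longrightarrow> c * (t - s) \<le> l t - l s \<and> l t - l s \<le> C * (t - s)"
  shows "l \<in> time_changes"
proof -
  have C: "0 \<le> C" using l[of 0 1] \<open>0 < c\<close> by simp
  have mono: "l s < l t" if "s < t" for s t
    using l[of s t] that \<open>0 < c\<close> by (smt (verit) mult_pos_pos)
  have abs1: "\<bar>l t - l s\<bar> \<le> C * \<bar>t - s\<bar>" for s t
    using l[of s t] l[of t s] mono[of s t] mono[of t s] by (cases "s < t") (auto simp: abs_if)
  have abs2: "c * \<bar>t - s\<bar> \<le> \<bar>l t - l s\<bar>" for s t
    using l[of s t] l[of t s] by (cases "s \<le> t") (auto simp: abs_if)
  have lip: "C-lipschitz_on X l" for X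
    using abs1 C by (intro lipschitz_onI) (simp_all add: dist_real_def)
  have inj: "inj_on l {0..}"
    using mono by (metis inj_onI less_irrefl linorder_neqE)
  have img: "l ` {0..} = {0..}"
  proof (intro equalityI subsetI)
    fix y assume "y \<in> l ` {0..}"
    then show "y \<in> {0..}" using mono[of 0] \<open>l 0 = 0\<close> by (force simp: order_le_less)
  next
    fix y :: real assume "y \<in> {0..}"
    then have "0 \<le> y" by simp
    \<comment> \<open>The lower slope bound places \<open>l (y / c)\<close> above \<open>y\<close>,
      so the intermediate value theorem gives surjectivity.\<close>
    have "y \<le> l (y / c)" using l[of 0 "y / c"] \<open>0 \<le> y\<close> assms by simp
    then obtain x where "0 \<le> x" "l x = y"
      using IVT'[of l 0 y "y / c"] lipschitz_on_continuous_on[OF lip] \<open>0 \<le> y\<close> assms by auto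
    then show "y \<in> l ` {0..}" by force
  qed
  let ?g = "the_inv_into {0..} l"
  have g: "l (?g y) = y" if "0 \<le> y" for y
    using f_the_inv_into_f[OF inj, of y] img that by simp
  have glip: "(1/c)-lipschitz_on (X \<inter> {0..}) ?g" for X
  proof (rule lipschitz_onI)
    show "0 \<le> 1 / c" using \<open>0 < c\<close> by simp
    fix x y assume "x \<in> X \<inter> {0..}" "y \<in> X \<inter> {0..}"
    then show "dist (?g x) (?g y) \<le> 1 / c * dist x y"
      using abs2[of "?g x" "?g y"] g \<open>0 < c\<close> by (simp add: dist_real_def field_simps)
  qed
  have "locally_Lipschitz_on {0..} l" "locally_Lipschitz_on {0..} ?g"
    unfolding locally_Lipschitz_on_def using lip glip zero_less_one by blast+
  moreover have "strict_mono_on {0..} l" using mono by (rule strict_mono_onI)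
  ultimately show ?thesis
    using inj img unfolding time_changes_def bij_betw_def by blast
qed

text \<open>Off the finite set \<open>F\<close> the derivative is locally constant. It is therefore
  continuous there, which gives the measurability that bounding an essential supremum from above
  requires, and its value is a chord slope.\<close>

lemma log_deriv_norm_piecewise_affine:
  fixes l :: "real \<Rightarrow> real"
  assumes "finite F"
    and aff: "\<And>s. s \<notin> F \<Longrightarrow> \<exists>m b. \<forall>\<^sub>F u in nhds s. l u = m * u + b"
    and l: "\<And>s t. s \<le> t \<Longrightarrow> exp (- \<eta>) * (t - s) \<le> l t - l s \<and> l t - l s \<le> exp \<eta> * (t - s)"
  shows "log_deriv_norm t l \<le> ennreal \<eta>"
proof -
  have loc: "\<exists>m. exp (- \<eta>) \<le> m \<and> m \<le> exp \<eta> \<and> (\<forall>\<^sub>F u in nhds s. deriv l u = m)" if "s \<notin> F" for s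
  proof -
    from aff[OF that] obtain m b where ev: "\<forall>\<^sub>F u in nhds s. l u = m * u + b" by blast
    have d: "deriv l u = m" if "\<forall>\<^sub>F v in nhds u. l v = m * v + b" for u
    proof -
      have "deriv l u = deriv (\<lambda>v. m * v + b) u" by (rule deriv_cong_ev[OF that refl])
      also have "\<dots> = m" by (rule DERIV_imp_deriv) (auto intro!: derivative_eq_intros)
      finally show ?thesis .
    qed
    have "\<forall>\<^sub>F u in nhds s. \<forall>\<^sub>F v in nhds u. l v = m * v + b" using ev by (simp add: eventually_eventually)
    then have ev': "\<forall>\<^sub>F u in nhds s. deriv l u = m" by eventually_elim (rule d)
    obtain e where e: "e > 0" "\<And>u. dist u s < e \<Longrightarrow> l u = m * u + b"
      using ev by (auto simp: eventually_nhds_metric)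
    \<comment> \<open>The local slope \<open>m\<close> is read off from one short chord, to which
      the global slope bounds apply.\<close>
    have "l (s + e/2) - l s = m * (e / 2)" using e(2)[of "s + e/2"] e(2)[of s] e(1)
      by (simp add: dist_real_def algebra_simps)
    then have "exp (- \<eta>) \<le> m" "m \<le> exp \<eta>" using l[of s "s + e/2"] e(1) by auto
    then show ?thesis using ev' by blast
  qed
  have bnd: "\<bar>ln (deriv l s)\<bar> \<le> \<eta>" if "s \<notin> F" for s
  proof -
    from loc[OF that] obtain m where m: "exp (- \<eta>) \<le> m" "m \<le> exp \<eta>" "deriv l s = m"
      using eventually_nhds_x_imp_x by blast
    have "0 < m" using m(1) by (meson exp_gt_zero less_le_trans)
    then have "- \<eta> \<le> ln m" "ln m \<le> \<eta>" using m ln_le_cancel_iff[of m "exp \<eta>"] by (simp_all add: ln_ge_iff)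
    then show ?thesis using m(3) by simp
  qed
  let ?f = "\<lambda>s. ennreal \<bar>ln (deriv l s)\<bar>"
  have "continuous_on (- F) ?f"
  proof (rule continuous_at_imp_continuous_on, rule ballI)
    fix s assume "s \<in> - F"
    then have "s \<notin> F" by simp
    from loc[OF this] obtain m where "\<forall>\<^sub>F u in nhds s. deriv l u = m" by blast
    then have "\<forall>\<^sub>F u in nhds s. ?f u = ennreal \<bar>ln m\<bar>" by eventually_elim simp
    then have "isCont ?f s \<longleftrightarrow> isCont (\<lambda>_. ennreal \<bar>ln m\<bar>) s" by (rule isCont_cong)
    then show "isCont ?f s" by simp
  qed
  then have "?f \<in> borel_measurable borel"
    using \<open>finite F\<close> by (intro borel_measurable_continuous_countable_exceptions countable_finite)
  then have "?f \<in> borel_measurable (lebesgue_on {0..t})"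
    by (intro measurable_restrict_space1 measurable_completion) simp
  moreover have "AE s in lebesgue_on {0..t}. ?f s \<le> ennreal \<eta>"
  proof -
    have "F \<in> null_sets lebesgue"
      using \<open>finite F\<close> negligible_finite negligible_iff_null_sets by blast
    then have "AE s in lebesgue. s \<notin> F" by (rule AE_not_in)
    then have "AE s in lebesgue. s \<in> {0..t} \<longrightarrow> ?f s \<le> ennreal \<eta>"
      by eventually_elim (auto intro!: ennreal_leI bnd)
    then show ?thesis by (subst AE_restrict_space_iff) auto
  qed
  ultimately show ?thesis unfolding log_deriv_norm_def by (rule esssup_I)
qed

lemma ex_time_change_interpolating:
  fixes \<tau> p :: "nat \<Rightarrow> real"
  assumes "0 \<le> \<eta>" "\<tau> 0 = 0" "p 0 = 0"
    and "\<And>i. i < N \<Longrightarrow> \<tau> i < \<tau> (Suc i)"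
    and "\<And>i. i < N \<Longrightarrow> exp (- \<eta>) * (\<tau> (Suc i) - \<tau> i) \<le> p (Suc i) - p i"
    and "\<And>i. i < N \<Longrightarrow> p (Suc i) - p i \<le> exp \<eta> * (\<tau> (Suc i) - \<tau> i)"
  obtains l where "l \<in> time_changes" "\<And>i. i \<le> N \<Longrightarrow> l (\<tau> i) = p i"
    "\<And>t. log_deriv_norm t l \<le> ennreal \<eta>"
proof -
  obtain l F where l: "finite F"
    "\<And>s t. s \<le> t \<Longrightarrow> exp (- \<eta>) * (t - s) \<le> l t - l s \<and> l t - l s \<le> exp \<eta> * (t - s)"
    "\<And>i. i \<le> N \<Longrightarrow> l (\<tau> i) = p i" "\<And>s. s \<notin> F \<Longrightarrow> \<exists>m b. \<forall>\<^sub>F u in nhds s. l u = m * u + b"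
    using ex_piecewise_affine[of "exp (- \<eta>)" "exp \<eta>" \<tau> p N] assms by auto
  have "l 0 = 0" using l(3)[of 0] assms by simp
  then have "l \<in> time_changes" using l(2) by (intro bilipschitz_time_changes[of "exp (- \<eta>)"]) auto
  then show ?thesis using that l(3) log_deriv_norm_piecewise_affine[OF l(1,4,2)] by blast
qed

section \<open>The modulus along a convergent sequence\<close>

lemma D_exp_dom:
  assumes "x \<in> D_exp S"
  shows "dom x = {t. 0 \<le> t \<and> ennreal t < lifetime x}"
  using assms lifetime_eq unfolding D_exp_def by blast

lemma D_exp_value:
  assumes "x \<in> D_exp S" "0 \<le> t" "ennreal t < lifetime x"
  shows "x t = Some (the (x t))" "the (x t) \<in> S"
proof -
  have "t \<in> dom x" using D_exp_dom[OF assms(1)] assms by simp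
  then show "x t = Some (the (x t))" by auto
  moreover have "ran x \<subseteq> S" using assms(1) by (simp add: D_exp_def)
  ultimately show "the (x t) \<in> S" by (metis ranI subsetD)
qed

lemma D_exp_right:
  assumes "x \<in> D_exp S" "0 \<le> t" "ennreal t < lifetime x"
  shows "((\<lambda>s. the (x s)) \<longlongrightarrow> the (x t)) (at_right t)"
  using assms D_exp_dom[OF assms(1)] unfolding D_exp_def by blast

lemma D_exp_left:
  assumes "x \<in> D_exp S" "0 < t" "ennreal t < lifetime x"
  shows "\<exists>l\<in>S. ((\<lambda>s. the (x s)) \<longlongrightarrow> l) (at_left t)"
proof -
  have "t \<in> dom x" using D_exp_dom[OF assms(1)] assms by simp
  then show ?thesis using assms unfolding D_exp_def by blast
qed

definition oscillation_le :: "(real \<Rightarrow> 'a::metric_space) \<Rightarrow> real \<Rightarrow> real \<Rightarrow> real \<Rightarrow> bool"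
  where "oscillation_le f \<epsilon> a b \<longleftrightarrow> (\<forall>s1\<in>{a..<b}. \<forall>s2\<in>{a..<b}. dist (f s1) (f s2) \<le> \<epsilon>)"

text \<open>By compactness it suffices to subdivide near each point \<open>x\<close>: the left limit
  controls an interval ending at \<open>x\<close>, right continuity one starting at
  \<open>x\<close>, and half-open pieces can be concatenated at \<open>x\<close>. At
  \<open>b\<close> only a left limit is required, so \<open>b\<close> may be the end of the
  lifetime.\<close>

lemma cadlag_subdivision:
  fixes f :: "real \<Rightarrow> 'a::metric_space"
  assumes "0 \<le> b" "0 < \<epsilon>"
    and right: "\<And>t. 0 \<le> t \<Longrightarrow> t < b \<Longrightarrow> (f \<longlongrightarrow> f t) (at_right t)"
    and left: "\<And>t. 0 < t \<Longrightarrow> t \<le> b \<Longrightarrow> \<exists>l. (f \<longlongrightarrow> l) (at_left t)"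
  obtains N and \<tau> :: "nat \<Rightarrow> real" where "\<tau> 0 = 0" "\<tau> N = b" "\<And>i. i < N \<Longrightarrow> \<tau> i < \<tau> (Suc i)"
    "\<And>i. i < N \<Longrightarrow> oscillation_le f \<epsilon> (\<tau> i) (\<tau> (Suc i))"
proof -
  define Q where "Q u v \<longleftrightarrow> (\<exists>N (\<tau> :: nat \<Rightarrow> real). \<tau> 0 = u \<and> \<tau> N = v \<and>
    (\<forall>i<N. \<tau> i < \<tau> (Suc i) \<and> oscillation_le f \<epsilon> (\<tau> i) (\<tau> (Suc i))))" for u v
  have Q_trans: "Q u w" if "Q u v" "Q v w" for u v w
  proof -
    from that(1) obtain N and \<tau> :: "nat \<Rightarrow> real" where 1: "\<tau> 0 = u" "\<tau> N = v"
      "\<forall>i<N. \<tau> i < \<tau> (Suc i) \<and> oscillation_le f \<epsilon> (\<tau> i) (\<tau> (Suc i))"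
      unfolding Q_def by blast
    from that(2) obtain M and \<sigma> :: "nat \<Rightarrow> real" where 2: "\<sigma> 0 = v" "\<sigma> M = w"
      "\<forall>i<M. \<sigma> i < \<sigma> (Suc i) \<and> oscillation_le f \<epsilon> (\<sigma> i) (\<sigma> (Suc i))"
      unfolding Q_def by blast
    define \<rho> where "\<rho> i = (if i \<le> N then \<tau> i else \<sigma> (i - N))" for i
    have "\<rho> i < \<rho> (Suc i) \<and> oscillation_le f \<epsilon> (\<rho> i) (\<rho> (Suc i))" if i: "i < N + M" for i
    proof -
      consider "i < N" | "i = N" "0 < M" | "N < i"
        using i by (cases i N rule: linorder_cases) auto
      then show ?thesis
      proof cases
        case c1: 1
        then show ?thesis using 1(3) by (simp add: \<rho>_def)
      next
        case c2: 2
        then show ?thesis using 2(3)[rule_format, of 0] 1(2) 2(1) by (simp add: \<rho>_def)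
      next
        case 3
        then show ?thesis using 2(3)[rule_format, of "i - N"] that by (simp add: \<rho>_def Suc_diff_le)
      qed
    qed
    moreover have "\<rho> 0 = u" "\<rho> (N + M) = w" using 1 2 by (auto simp: \<rho>_def)
    ultimately show ?thesis unfolding Q_def by blast
  qed
  have Q1: "Q u v" if "u \<le> v" "oscillation_le f \<epsilon> u v" for u v
  proof (cases "u = v")
    case True
    then show ?thesis unfolding Q_def by (intro exI[of _ 0] exI[of _ "\<lambda>_. u"]) simp
  next
    case False
    then show ?thesis unfolding Q_def using that
      by (intro exI[of _ 1] exI[of _ "\<lambda>i. if i = 0 then u else v"]) simp
  qed
  have osc: "oscillation_le f \<epsilon> u v" if "\<And>s. s \<in> {u..<v} \<Longrightarrow> dist (f s) l < \<epsilon> / 2" for u v l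
    unfolding oscillation_le_def using that by (meson dist_triangle_half_l less_imp_le)
  \<comment> \<open>Bolzano's lemma considers intervals around \<open>x\<close> that may leave
    \<open>[0, b]\<close>. Making the bounds premises of the predicate means that only one side has
    to be treated at 0 and at \<open>b\<close>.\<close>
  have "0 \<le> (0::real) \<and> b \<le> b \<longrightarrow> Q 0 b"
  proof (rule Bolzano[of 0 b "\<lambda>u v. 0 \<le> u \<and> v \<le> b \<longrightarrow> Q u v"])
    show "0 \<le> b" by fact
    show "0 \<le> u \<and> w \<le> b \<longrightarrow> Q u w"
      if "0 \<le> u \<and> v \<le> b \<longrightarrow> Q u v" "0 \<le> v \<and> w \<le> b \<longrightarrow> Q v w" "u \<le> v" "v \<le> w" for u v w
      using that Q_trans by auto
    fix x assume x: "0 \<le> x" "x \<le> b"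
    have "\<exists>d>0. \<forall>u v. x = v \<and> u \<le> v \<and> v - u < d \<longrightarrow> 0 \<le> u \<longrightarrow> Q u v"
    proof (cases "x = 0")
      case True
      then show ?thesis using Q1 by (auto simp: oscillation_le_def intro!: exI[of _ 1])
    next
      case False
      then obtain l where "(f \<longlongrightarrow> l) (at_left x)" using left[of x] x by auto
      then have "\<forall>\<^sub>F s in at_left x. dist (f s) l < \<epsilon> / 2" using \<open>0 < \<epsilon>\<close> by (intro tendstoD) auto
      then obtain c where c: "c < x" "\<And>s. c < s \<Longrightarrow> s < x \<Longrightarrow> dist (f s) l < \<epsilon> / 2"
        by (auto simp: eventually_at_left_field)
      then show ?thesis
        by (intro exI[of _ "x - c"]) (auto intro!: Q1 osc[of _ _ l])
    qed
    then obtain d1 where d1: "d1 > 0" "\<And>u. u \<le> x \<Longrightarrow> x - u < d1 \<Longrightarrow> 0 \<le> u \<Longrightarrow> Q u x" by blast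
    have "\<exists>d>0. \<forall>u v. x = u \<and> u \<le> v \<and> v - u < d \<longrightarrow> v \<le> b \<longrightarrow> Q u v"
    proof (cases "x = b")
      case True
      then show ?thesis using Q1 by (auto simp: oscillation_le_def intro!: exI[of _ 1])
    next
      case False
      then have "(f \<longlongrightarrow> f x) (at_right x)" using right[of x] x by auto
      then have "\<forall>\<^sub>F s in at_right x. dist (f s) (f x) < \<epsilon> / 2" using \<open>0 < \<epsilon>\<close> by (intro tendstoD) auto
      then obtain c where c: "x < c" "\<And>s. x < s \<Longrightarrow> s < c \<Longrightarrow> dist (f s) (f x) < \<epsilon> / 2"
        by (auto simp: eventually_at_right_field)
      have "dist (f s) (f x) < \<epsilon> / 2" if "x \<le> s" "s < c" for s
        using c(2)[of s] that \<open>0 < \<epsilon>\<close> by (cases "s = x") auto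
      then show ?thesis
        using c(1) by (intro exI[of _ "c - x"]) (auto intro!: Q1 osc[of _ _ "f x"])
    qed
    then obtain d2 where d2: "d2 > 0" "\<And>v. x \<le> v \<Longrightarrow> v - x < d2 \<Longrightarrow> v \<le> b \<Longrightarrow> Q x v" by blast
    show "\<exists>d>0. \<forall>u v. u \<le> x \<and> x \<le> v \<and> v - u < d \<longrightarrow> 0 \<le> u \<and> v \<le> b \<longrightarrow> Q u v"
    proof (intro exI conjI allI impI)
      show "0 < min d1 d2" using d1 d2 by simp
      fix u v assume "u \<le> x \<and> x \<le> v \<and> v - u < min d1 d2" "0 \<le> u \<and> v \<le> b"
      then show "Q u v" by (intro Q_trans[OF d1(2) d2(2)]) auto
    qed
  qed
  then show ?thesis using that unfolding Q_def by blast
qed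

lemma modulus_le:
  assumes "(N, \<tau>) \<in> subdivisions t K x \<delta>"
    and "\<And>i. i < N \<Longrightarrow> oscillation_le (\<lambda>s. the (x s)) \<epsilon> (\<tau> i) (\<tau> (Suc i))"
  shows "modulus t K x \<delta> \<le> ennreal \<epsilon>"
  unfolding modulus_def using assms
  by (intro INF_lower2[OF assms(1)])
    (auto simp: oscillation_le_def intro!: SUP_least ennreal_leI)

text \<open>The image under \<open>l\<close> of a subdivision for \<open>x\<close> is one for
  \<open>y\<close>. Slopes of at least 1/2 halve the gaps at worst, whence the requirement
  \<open>2 * \<delta>\<close>. One \<epsilon> comes from the oscillation of \<open>x\<close> and two
  from replacing \<open>y\<close> by \<open>x\<close> at the two points.\<close>

lemma modulus_le_time_change:
  assumes l: "l \<in> time_changes" "\<And>s t. 0 \<le> s \<Longrightarrow> s < t \<Longrightarrow> t \<le> \<tau> N \<Longrightarrow> t - s \<le> 2 * (l t - l s)"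
    and \<tau>: "\<tau> 0 = 0" "\<And>i. i < N \<Longrightarrow> \<tau> i < \<tau> (Suc i)" "\<And>i. i < N \<Longrightarrow> \<tau> (Suc i) - \<tau> i > 2 * \<delta>"
    and osc: "\<And>i. i < N \<Longrightarrow> oscillation_le (\<lambda>s. the (x s)) \<epsilon> (\<tau> i) (\<tau> (Suc i))"
    and near: "\<And>s. 0 \<le> s \<Longrightarrow> s < \<tau> N \<Longrightarrow> dist (the (x s)) (the (y (l s))) \<le> \<epsilon>"
    and y: "ennreal (l (\<tau> N)) \<le> lifetime y" "(l (\<tau> N), y (l (\<tau> N))) \<notin> {0..t} \<times> Some ` K"
  shows "modulus t K y \<delta> \<le> ennreal (3 * \<epsilon>)"
proof (rule modulus_le)
  have \<tau>_mono: "0 \<le> \<tau> i \<and> \<tau> i \<le> \<tau> N" if "i \<le> N" for i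
    using that \<tau>(1) le_upto_steps[of N \<tau> 0 i] le_upto_steps[of N \<tau> i N] \<tau>(2) by auto
  show "(N, l \<circ> \<tau>) \<in> subdivisions t K y \<delta>"
    unfolding subdivisions_def
  proof (clarsimp simp: y \<tau>(1) time_changes_0[OF l(1)], intro conjI allI impI)
    show "l (\<tau> N) \<le> t \<Longrightarrow> y (l (\<tau> N)) \<notin> Some ` K" if "0 \<le> l (\<tau> N)" using y(2) that by auto
    fix i assume i: "i < N"
    show "l (\<tau> i) < l (\<tau> (Suc i))"
      using \<tau>(2)[OF i] \<tau>_mono[of i] i by (intro time_changes_mono[OF l(1)]) auto
    have "\<tau> (Suc i) - \<tau> i \<le> 2 * (l (\<tau> (Suc i)) - l (\<tau> i))"
      using \<tau>(2)[OF i] \<tau>_mono[of i] \<tau>_mono[of "Suc i"] i by (intro l(2)) auto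
    then show "\<delta> < l (\<tau> (Suc i)) - l (\<tau> i)" using \<tau>(3)[OF i] by simp
  qed
  fix i assume i: "i < N"
  let ?g = "the_inv_into {0..} l"
  have pre: "?g s \<in> {\<tau> i..<\<tau> (Suc i)} \<and> 0 \<le> ?g s \<and> ?g s < \<tau> N \<and> l (?g s) = s"
    if s: "s \<in> {l (\<tau> i)..<l (\<tau> (Suc i))}" for s
  proof -
    have "0 \<le> s" using s time_changes_nonneg[OF l(1), of "\<tau> i"] \<tau>_mono[of i] i by auto
    then have g: "0 \<le> ?g s" "l (?g s) = s"
      using time_changes_inv_nonneg[OF l(1)] time_changes_inv_right[OF l(1)] by auto
    then show ?thesis
      using s \<tau>_mono[of i] \<tau>_mono[of "Suc i"] i time_changes_less_iff[OF l(1), of "?g s" "\<tau> i"]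
        time_changes_less_iff[OF l(1), of "?g s" "\<tau> (Suc i)"] by auto
  qed
  show "oscillation_le (\<lambda>s. the (y s)) (3 * \<epsilon>) ((l \<circ> \<tau>) i) ((l \<circ> \<tau>) (Suc i))"
    unfolding oscillation_le_def o_apply
  proof (intro ballI)
    fix s1 s2 assume "s1 \<in> {l (\<tau> i)..<l (\<tau> (Suc i))}" "s2 \<in> {l (\<tau> i)..<l (\<tau> (Suc i))}"
    note p = pre[OF this(1)] pre[OF this(2)]
    have "dist (the (y s1)) (the (y s2)) \<le> dist (the (y s1)) (the (x (?g s1)))
        + dist (the (x (?g s1))) (the (x (?g s2))) + dist (the (x (?g s2))) (the (y s2))"
      using dist_triangle[of "the (y s1)" "the (y s2)" "the (x (?g s1))"]
        dist_triangle[of "the (x (?g s1))" "the (y s2)" "the (x (?g s2))"] by linarith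
    also have "\<dots> \<le> \<epsilon> + \<epsilon> + \<epsilon>"
      using p near[of "?g s1"] near[of "?g s2"] osc[OF i]
      by (intro add_mono) (auto simp: oscillation_le_def dist_commute)
    finally show "dist (the (y s1)) (the (y s2)) \<le> 3 * \<epsilon>" by simp
  qed
qed

text \<open>The complement of a compact subset of \<open>S\<close>, together with
  \<open>None\<close>, is an open neighbourhood of \<open>None\<close>.\<close>

lemma compactin_Alexandroff_None:
  fixes S :: "'a::metric_space set"
  assumes "limitin (Alexandroff_compactification (top_of_set S)) f None F" "compact K" "K \<subseteq> S"
  shows "\<forall>\<^sub>F k in F. f k \<notin> Some ` K"
proof -
  let ?U = "insert None (Some ` (topspace (top_of_set S) - K))"
  have "closedin (top_of_set S) K" using closed_subset[OF assms(3) compact_imp_closed[OF assms(2)]] .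
  then have "openin (Alexandroff_compactification (top_of_set S)) ?U"
    using assms unfolding openin_Alexandroff_compactification by (auto simp: compactin_subtopology)
  then have "\<forall>\<^sub>F k in F. f k \<in> ?U" using assms(1) unfolding limitin_def by blast
  then show ?thesis by eventually_elim auto
qed

text \<open>Path and gap vary together along the sequence, because the theorem is used to refute a
  sequence of counterexamples whose gaps tend to 0.\<close>

theorem local_Skorokhod_conv_modulus:
  fixes S :: "'a::metric_space set"
  assumes conv: "local_Skorokhod_conv S xs x" and x: "x \<in> D_loc S"
    and xs: "\<And>k. xs k \<in> D_loc S"
    and K: "compact K" "K \<subseteq> S" and "0 \<le> t" and \<delta>: "\<delta> \<longlonglongrightarrow> 0" and "0 < \<epsilon>"
  shows "\<forall>\<^sub>F k in sequentially. modulus t K (xs k) (\<delta> k) \<le> ennreal \<epsilon>"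
proof -
  have xe: "x \<in> D_exp S" using x by (simp add: D_loc_def)
  \<comment> \<open>Both cases of the convergence are reduced to a common end time \<open>b\<close>:
    the lifetime itself in the first case, and in the second a time before the end of life at which
    the limit path has left \<open>[0, t]\<close> or \<open>K\<close>.\<close>
  obtain l b where l: "\<And>k. l k \<in> time_changes" and "0 \<le> b"
    and life: "\<And>s. 0 \<le> s \<Longrightarrow> s < b \<Longrightarrow> ennreal s < lifetime x"
    and left: "\<And>s. 0 < s \<Longrightarrow> s \<le> b \<Longrightarrow> \<exists>z. ((\<lambda>s. the (x s)) \<longlongrightarrow> z) (at_left s)"
    and lifes: "\<forall>\<^sub>F k in sequentially. ennreal (l k b) \<le> lifetime (xs k)"
    and exit: "\<forall>\<^sub>F k in sequentially. (l k b, xs k (l k b)) \<notin> {0..t} \<times> Some ` K"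
    and dist0: "(\<lambda>k. SUP s\<in>{0..<b}. ennreal (dist (the (x s)) (the (xs k (l k s))))) \<longlonglongrightarrow> 0"
    and norm0: "(\<lambda>k. log_deriv_norm b (l k)) \<longlonglongrightarrow> 0"
  proof (cases "lifetime x < \<infinity> \<and> relcompact_in (ran x) S")
    case True
    define b where "b = enn2real (lifetime x)"
    have b: "ennreal b = lifetime x" using True by (simp add: b_def)
    from conv obtain l where "\<And>k. l k \<in> time_changes"
      "\<forall>\<^sub>F k in sequentially. ennreal (l k b) \<le> lifetime (xs k)"
      "(\<lambda>k. SUP s\<in>{0..<b}. ennreal (dist (the (x s)) (the (xs k (l k s))))) \<longlonglongrightarrow> 0"
      and lim: "limitin (Alexandroff_compactification (top_of_set S)) (\<lambda>k. xs k (l k b)) None sequentially"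
      and "(\<lambda>k. log_deriv_norm b (l k)) \<longlonglongrightarrow> 0"
      unfolding local_Skorokhod_conv_def if_P[OF True] Let_def b_def by blast
    moreover have "0 \<le> b" by (simp add: b_def)
    moreover have life: "ennreal s < lifetime x" if "0 \<le> s" "s < b" for s
      using that by (simp add: b[symmetric] ennreal_lessI)
    moreover have "\<exists>z. ((\<lambda>s. the (x s)) \<longlongrightarrow> z) (at_left s)" if s: "0 < s" "s \<le> b" for s
    proof (cases "s = b")
      case True
      have "0 < lifetime x" using s b by (metis ennreal_less_zero_iff less_le_trans)
      then show ?thesis using x \<open>lifetime x < \<infinity> \<and> _\<close> True by (auto simp: D_loc_def b_def)
    next
      case False
      then show ?thesis using D_exp_left[OF xe s(1)] life[of s] s by auto
    qed
    moreover have "\<forall>\<^sub>F k in sequentially. (l k b, xs k (l k b)) \<notin> {0..t} \<times> Some ` K"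
      using compactin_Alexandroff_None[OF lim K] by eventually_elim auto
    ultimately show ?thesis using that by blast
  next
    case False
    from conv obtain l where l: "\<And>k. l k \<in> time_changes"
      and lt: "\<And>t. 0 \<le> t \<Longrightarrow> ennreal t < lifetime x \<Longrightarrow>
           (\<forall>\<^sub>F k in sequentially. ennreal (l k t) < lifetime (xs k)) \<and>
           (\<lambda>k. SUP s\<in>{0..t}. ennreal (dist (the (x s)) (the (xs k (l k s))))) \<longlonglongrightarrow> 0 \<and>
           (\<lambda>k. log_deriv_norm t (l k)) \<longlonglongrightarrow> 0"
      unfolding local_Skorokhod_conv_def if_not_P[OF False] by blast
    \<comment> \<open>If the lifetime exceeds \<open>t\<close>, any time in between works. Otherwise
      it is finite, so the range cannot be contained in the compact set \<open>K\<close>, and a time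
      with a value outside \<open>K\<close> is taken.\<close>
    obtain b where b: "0 \<le> b" "ennreal b < lifetime x" "t < b \<or> the (x b) \<notin> K"
    proof (cases "ennreal t < lifetime x")
      case True
      then obtain b where b: "t < b" "ennreal b < lifetime x"
      proof -
        obtain u where u: "ennreal t < u" "u < lifetime x" using True dense by blast
        then have "u < top" using less_le_trans top_greatest by blast
        then have "ennreal (enn2real u) = u" by simp
        then show ?thesis using u that[of "enn2real u"] \<open>0 \<le> t\<close> by (metis ennreal_less_iff)
      qed
      then show ?thesis using that[of b] \<open>0 \<le> t\<close> by simp
    next
      case nt: False
      then have "lifetime x < \<infinity>" using ennreal_less_top[of t] by (metis infinity_ennreal_def le_less_trans not_le)
      then have "\<not> ran x \<subseteq> K" using False K by (auto simp: relcompact_in_def)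
      then obtain s y where s: "x s = Some y" "y \<notin> K" by (auto simp: ran_def)
      then have "s \<in> dom x" by auto
      then show ?thesis using that[of s] s D_exp_dom[OF xe] by auto
    qed
    note lb = lt[OF b(1,2)]
    have life: "ennreal s < lifetime x" if "0 \<le> s" "s \<le> b" for s
      using that b by (meson ennreal_leI le_less_trans)
    have "\<exists>z. ((\<lambda>s. the (x s)) \<longlongrightarrow> z) (at_left s)" if s: "0 < s" "s \<le> b" for s
      using D_exp_left[OF xe s(1)] life[of s] s by auto
    moreover have "\<forall>\<^sub>F k in sequentially. ennreal (l k b) \<le> lifetime (xs k)"
      using lb by (auto elim: eventually_mono)
    moreover have "\<forall>\<^sub>F k in sequentially. (l k b, xs k (l k b)) \<notin> {0..t} \<times> Some ` K"
    proof (cases "t < b")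
      case True
      \<comment> \<open>A small \<eta> with \<open>exp \<eta> * t < b\<close> makes the slope bound
        push \<open>l k b\<close> strictly beyond \<open>t\<close>.\<close>
      have "((\<lambda>\<eta>. exp \<eta> * t) \<longlongrightarrow> exp 0 * t) (at_right 0)" by (intro tendsto_intros)
      then have "\<forall>\<^sub>F \<eta> in at_right 0. exp \<eta> * t < b" using True by (intro order_tendstoD(2)) auto
      from eventually_happens[OF eventually_conj[OF this eventually_at_right_less]]
      obtain \<eta> where \<eta>: "exp \<eta> * t < b" "0 < \<eta>" by auto
      have "\<forall>\<^sub>F k in sequentially. log_deriv_norm b (l k) < ennreal \<eta>"
        using lb \<eta>(2) by (intro order_tendstoD(2)) auto
      then show ?thesis
      proof eventually_elim
        case (elim k)
        have "b - 0 \<le> exp \<eta> * (l k b - l k 0)"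
          using \<eta>(2) elim b(1) by (intro time_changes_slope_bounds(1)[OF l, of _ b]) auto
        then have "b \<le> exp \<eta> * l k b" by (simp add: time_changes_0[OF l])
        moreover have "exp \<eta> * l k b \<le> exp \<eta> * t" if "l k b \<le> t" using that by simp
        ultimately have "\<not> l k b \<le> t" using \<eta>(1) by linarith
        then show ?case by simp
      qed
    next
      case False
      then have xb: "the (x b) \<notin> K" using b by simp
      \<comment> \<open>The limit value at \<open>b\<close> has a positive distance to
        \<open>K\<close>, so uniformly close values also avoid \<open>K\<close>.\<close>
      have "open (- K)" using K compact_imp_closed by auto
      then obtain r where r: "r > 0" "ball (the (x b)) r \<subseteq> - K"
        using xb by (meson ComplI openE)
      have "\<forall>\<^sub>F k in sequentially. (SUP s\<in>{0..b}. ennreal (dist (the (x s)) (the (xs k (l k s))))) < ennreal r"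
        using lb r(1) by (intro order_tendstoD(2)) auto
      then show ?thesis
      proof eventually_elim
        case (elim k)
        then have "ennreal (dist (the (x b)) (the (xs k (l k b)))) < ennreal r"
          using b(1) by (elim le_less_trans[rotated]) (auto intro!: SUP_upper2[of b])
        then have "the (xs k (l k b)) \<in> ball (the (x b)) r" using r(1) by (simp add: ennreal_less_iff)
        then show ?case using r(2) by auto
      qed
    qed
    moreover have "(\<lambda>k. SUP s\<in>{0..<b}. ennreal (dist (the (x s)) (the (xs k (l k s))))) \<longlonglongrightarrow> 0"
    proof (rule tendsto_sandwich[OF _ _ tendsto_const])
      show "(\<lambda>k. SUP s\<in>{0..b}. ennreal (dist (the (x s)) (the (xs k (l k s))))) \<longlonglongrightarrow> 0" using lb by blast
    qed (auto intro!: always_eventually SUP_subset_mono)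
    ultimately show ?thesis using that[of l b] l b(1) life lb by force
  qed
  obtain N \<tau> where \<tau>: "\<tau> 0 = 0" "\<tau> N = b" "\<And>i. i < N \<Longrightarrow> \<tau> i < \<tau> (Suc i)"
    "\<And>i. i < N \<Longrightarrow> oscillation_le (\<lambda>s. the (x s)) (\<epsilon> / 3) (\<tau> i) (\<tau> (Suc i))"
  proof (rule cadlag_subdivision[of b "\<epsilon> / 3" "\<lambda>s. the (x s)"])
    show "((\<lambda>s. the (x s)) \<longlongrightarrow> the (x s)) (at_right s)" if "0 \<le> s" "s < b" for s
      using D_exp_right[OF xe that(1) life[OF that]] .
  qed (use \<open>0 \<le> b\<close> \<open>0 < \<epsilon>\<close> left in auto)
  have "\<forall>\<^sub>F k in sequentially. \<forall>i\<in>{..<N}. 2 * \<delta> k < \<tau> (Suc i) - \<tau> i"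
  proof (intro eventually_ball_finite ballI finite_lessThan)
    fix i assume "i \<in> {..<N}"
    then have "0 < \<tau> (Suc i) - \<tau> i" using \<tau>(3) by simp
    moreover have "(\<lambda>k. 2 * \<delta> k) \<longlonglongrightarrow> 2 * 0" by (intro tendsto_intros \<delta>)
    ultimately show "\<forall>\<^sub>F k in sequentially. 2 * \<delta> k < \<tau> (Suc i) - \<tau> i"
      using order_tendstoD(2)[of "\<lambda>k. 2 * \<delta> k" 0] by simp
  qed
  \<comment> \<open>The threshold \<open>ln 2\<close> bounds the slopes from below by 1/2, matching
    the gap requirement \<open>2 * \<delta> k\<close>.\<close>
  moreover have "\<forall>\<^sub>F k in sequentially. log_deriv_norm b (l k) < ennreal (ln 2)"
    using norm0 by (rule order_tendstoD(2)) simp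
  moreover have "\<forall>\<^sub>F k in sequentially.
      (SUP s\<in>{0..<b}. ennreal (dist (the (x s)) (the (xs k (l k s))))) < ennreal (\<epsilon> / 3)"
    using dist0 by (rule order_tendstoD(2)) (use \<open>0 < \<epsilon>\<close> in simp)
  ultimately show ?thesis
    using lifes exit
  proof eventually_elim
    case (elim k)
    have "modulus t K (xs k) (\<delta> k) \<le> ennreal (3 * (\<epsilon> / 3))"
    proof (rule modulus_le_time_change[OF l, where x = x and \<tau> = \<tau> and N = N])
      show "u - s \<le> 2 * (l k u - l k s)" if "0 \<le> s" "s < u" "u \<le> \<tau> N" for s u
        using time_changes_slope_bounds(1)[OF l, of "ln 2" b k s u] that elim(2) \<tau>(2) by simp
      show "dist (the (x s)) (the (xs k (l k s))) \<le> \<epsilon> / 3" if "0 \<le> s" "s < \<tau> N" for s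
      proof -
        have "ennreal (dist (the (x s)) (the (xs k (l k s)))) < ennreal (\<epsilon> / 3)"
          using elim(3) that \<tau>(2) by (elim le_less_trans[rotated]) (auto intro!: SUP_upper2[of s])
        then show ?thesis by (simp add: ennreal_less_iff)
      qed
    qed (use elim \<tau> in auto)
    then show ?case by simp
  qed
qed

section \<open>Partitions up to the exit from a compact set\<close>

text \<open>A Lebesgue number argument: cover \<open>C\<close> by finitely many balls of half the
  radius on which local compactness gives a compact neighbourhood. Any point within the least
  half-radius of \<open>C\<close> is then still in one of the full balls.\<close>

lemma compact_neighbourhood_in:
  fixes S C :: "'a::metric_space set"
  assumes "locally_compact_space (top_of_set S)" "compact C" "C \<subseteq> S"
  shows "\<exists>C' e. compact C' \<and> C' \<subseteq> S \<and> 0 < e \<and> (\<forall>x\<in>C. \<forall>y\<in>S. dist x y \<le> e \<longrightarrow> y \<in> C')"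
proof -
  have "\<exists>e K. 0 < e \<and> compact K \<and> K \<subseteq> S \<and> S \<inter> ball x e \<subseteq> K" if "x \<in> C" for x
  proof -
    have "x \<in> topspace (top_of_set S)" using that assms(3) by auto
    then obtain U K where UK: "openin (top_of_set S) U" "compactin (top_of_set S) K" "x \<in> U" "U \<subseteq> K"
      using assms(1) unfolding locally_compact_space_def by blast
    then obtain V where V: "open V" "U = S \<inter> V" by (auto simp: openin_open)
    then obtain e where "0 < e" "ball x e \<subseteq> V" using UK(3) openE by blast
    then show ?thesis using UK V by (intro exI[of _ e] exI[of _ K]) (auto simp: compactin_subtopology)
  qed
  then obtain e K where eK: "\<And>x. x \<in> C \<Longrightarrow> 0 < e x \<and> compact (K x) \<and> K x \<subseteq> S \<and> S \<inter> ball x (e x) \<subseteq> K x"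
    by metis
  have "C \<subseteq> (\<Union>x\<in>C. ball x (e x / 2))" using eK by force
  then obtain F where F: "F \<subseteq> C" "finite F" "C \<subseteq> (\<Union>x\<in>F. ball x (e x / 2))"
    using compactE_image[OF assms(2), of C "\<lambda>x. ball x (e x / 2)"] by auto
  \<comment> \<open>The inserted 1 keeps the minimum meaningful when \<open>C\<close>, and with it
    the cover, is empty.\<close>
  define r where "r = Min (insert 1 ((\<lambda>x. e x / 2) ` F))"
  have "0 < r" unfolding r_def using F eK by (subst Min_gr_iff) auto
  moreover have "y \<in> (\<Union>x\<in>F. K x)" if xy: "x \<in> C" "y \<in> S" "dist x y \<le> r" for x y
  proof -
    obtain z where z: "z \<in> F" "dist z x < e z / 2" using F(3) xy(1) by auto
    have "r \<le> e z / 2" unfolding r_def using F(2) z(1) by (intro Min_le) auto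
    then have "dist z y < e z" using xy(3) z(2) dist_triangle[of z y x] by linarith
    then show ?thesis using eK[of z] z(1) F(1) xy(2) by (intro UN_I[of z]) (auto simp: subset_eq)
  qed
  moreover have "compact (\<Union>x\<in>F. K x)" "(\<Union>x\<in>F. K x) \<subseteq> S"
    using F eK by (auto intro!: compact_UN)
  ultimately show ?thesis by blast
qed

lemma sigma_compact_cover:
  fixes S :: "'a::metric_space set"
  assumes "locally_compact_space (top_of_set S)" "second_countable (top_of_set S)"
  obtains C :: "nat \<Rightarrow> 'a set" where "\<And>n. compact (C n)" "\<And>n. C n \<subseteq> S" "S \<subseteq> (\<Union>n. C n)"
proof -
  define \<U> where "\<U> = {U. openin (top_of_set S) U \<and> (\<exists>K. compact K \<and> K \<subseteq> S \<and> U \<subseteq> K)}"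
  have "Lindelof_space (top_of_set S)" using assms(2) by (rule second_countable_imp_Lindelof_space)
  moreover have "\<Union>\<U> = topspace (top_of_set S)"
  proof
    show "\<Union>\<U> \<subseteq> topspace (top_of_set S)" by (auto simp: \<U>_def dest: openin_imp_subset)
    show "topspace (top_of_set S) \<subseteq> \<Union>\<U>"
    proof
      fix x assume "x \<in> topspace (top_of_set S)"
      then obtain U K where "openin (top_of_set S) U" "compactin (top_of_set S) K" "x \<in> U" "U \<subseteq> K"
        using assms(1) unfolding locally_compact_space_def by blast
      then show "x \<in> \<Union>\<U>" unfolding \<U>_def compactin_subtopology by auto
    qed
  qed
  moreover have "\<And>U. U \<in> \<U> \<Longrightarrow> openin (top_of_set S) U" by (simp add: \<U>_def)
  ultimately obtain \<V> where V: "countable \<V>" "\<V> \<subseteq> \<U>" "\<Union>\<V> = S"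
    using Lindelof_spaceD[of "top_of_set S" \<U>] by auto
  then have "\<forall>U\<in>\<V>. \<exists>K. compact K \<and> K \<subseteq> S \<and> U \<subseteq> K" by (auto simp: \<U>_def)
  then obtain k where k: "\<And>U. U \<in> \<V> \<Longrightarrow> compact (k U) \<and> k U \<subseteq> S \<and> U \<subseteq> k U" by metis
  show ?thesis
  proof (cases "\<V> = {}")
    case True
    then show ?thesis using V(3) that[of "\<lambda>_. {}"] by auto
  next
    case False
    have fn: "from_nat_into \<V> n \<in> \<V>" for n using False by (rule from_nat_into)
    show ?thesis
    proof (rule that[of "\<lambda>n. k (from_nat_into \<V> n)"])
      show "S \<subseteq> (\<Union>n. k (from_nat_into \<V> n))"
      proof
        fix x assume "x \<in> S"
        then obtain U where "U \<in> \<V>" "x \<in> U" using V(3) by blast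
        then show "x \<in> (\<Union>n. k (from_nat_into \<V> n))"
          using k[of U] from_nat_into_surj[OF V(1), of U] by blast
      qed
    qed (use k fn in blast)+
  qed
qed

text \<open>Each \<open>K (Suc n)\<close> contains a neighbourhood of \<open>K n\<close> of some
  uniform width, together with the next member of a countable compact cover. \<epsilon> is that
  width, capped by \<open>1 / real (Suc n)\<close> so that it tends to 0.\<close>

lemma exhaustion:
  fixes S :: "'a::metric_space set"
  assumes "locally_compact_space (top_of_set S)" "second_countable (top_of_set S)"
  obtains K :: "nat \<Rightarrow> 'a set" and \<epsilon> :: "nat \<Rightarrow> real"
    where "\<And>n. compact (K n)" "\<And>n. K n \<subseteq> S" "\<And>n. 0 < \<epsilon> n" "\<epsilon> \<longlonglongrightarrow> 0"
      "\<And>n x y. x \<in> K n \<Longrightarrow> y \<in> S \<Longrightarrow> dist x y \<le> \<epsilon> n \<Longrightarrow> y \<in> K (Suc n)"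
      "\<And>C. compact C \<Longrightarrow> C \<subseteq> S \<Longrightarrow> \<exists>n. C \<subseteq> K n"
proof -
  obtain C :: "nat \<Rightarrow> 'a set" where C: "\<And>n. compact (C n)" "\<And>n. C n \<subseteq> S" "S \<subseteq> (\<Union>n. C n)"
    using sigma_compact_cover[OF assms] by blast
  obtain nb e where nb: "\<And>A. compact A \<Longrightarrow> A \<subseteq> S \<Longrightarrow> compact (nb A) \<and> nb A \<subseteq> S \<and> 0 < (e A :: real) \<and>
      (\<forall>x\<in>A. \<forall>y\<in>S. dist x y \<le> e A \<longrightarrow> y \<in> nb A)"
    using compact_neighbourhood_in[OF assms(1)] by metis
  define K where "K = rec_nat (C 0) (\<lambda>n A. nb A \<union> C (Suc n))"
  have KS: "K (Suc n) = nb (K n) \<union> C (Suc n)" for n by (simp add: K_def)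
  have K: "compact (K n) \<and> K n \<subseteq> S" for n
  proof (induction n)
    case 0 show ?case using C by (simp add: K_def)
  next
    case (Suc n) then show ?case using nb C by (auto simp: KS)
  qed
  define \<epsilon> where "\<epsilon> n = min (e (K n)) (1 / real (Suc n))" for n
  have \<epsilon>: "0 < \<epsilon> n" for n using nb K by (simp add: \<epsilon>_def)
  have nbhd: "y \<in> K (Suc n)" if "x \<in> K n" "y \<in> S" "dist x y \<le> \<epsilon> n" for n x y
    using that nb[of "K n"] K[of n] by (auto simp: KS \<epsilon>_def)
  have "K n \<subseteq> K (Suc n)" for n
    using nbhd[of _ n] K[of n] less_imp_le[OF \<epsilon>] by (metis dist_self subset_eq)
  then have mono: "K n \<subseteq> K m" if "n \<le> m" for n m using that by (rule lift_Suc_mono_le)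
  have CK: "C n \<subseteq> K n" for n by (cases n) (auto simp: KS K_def)
  have "\<exists>n. A \<subseteq> K n" if A: "compact A" "A \<subseteq> S" for A
  proof -
    \<comment> \<open>The sets \<open>B n\<close> are open in the ambient space and cover
      \<open>A\<close>, and \<open>A\<close> meets \<open>B n\<close> only inside
      \<open>K (Suc n)\<close>. A finite subcover thus puts \<open>A\<close> into a single
      member.\<close>
    define B where "B n = (\<Union>x\<in>K n. ball x (\<epsilon> n))" for n
    have cov: "A \<subseteq> (\<Union>n. B n)"
    proof
      fix y assume "y \<in> A"
      then obtain n where "y \<in> K n" using A C(3) CK by blast
      then have "y \<in> B n" unfolding B_def by (rule UN_I) (simp add: \<epsilon>)
      then show "y \<in> (\<Union>n. B n)" by blast
    qed
    have "open (B n)" for n by (auto simp: B_def)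
    from compactE_image[OF A(1) this cov] obtain I where I: "finite I" "A \<subseteq> (\<Union>n\<in>I. B n)" .
    have "A \<subseteq> K (Suc (Max I))"
    proof
      fix y assume y: "y \<in> A"
      then obtain n x where nx: "n \<in> I" "x \<in> K n" "dist x y < \<epsilon> n" using I(2) by (auto simp: B_def)
      then have "y \<in> K (Suc n)" using y A(2) by (intro nbhd[of x]) auto
      moreover have "Suc n \<le> Suc (Max I)" using I(1) nx(1) by simp
      ultimately show "y \<in> K (Suc (Max I))" using mono by blast
    qed
    then show ?thesis by blast
  qed
  moreover have "\<epsilon> \<longlonglongrightarrow> 0"
  proof (rule tendsto_sandwich[OF _ _ tendsto_const LIMSEQ_inverse_real_of_nat])
    show "\<forall>\<^sub>F n in sequentially. 0 \<le> \<epsilon> n" using less_imp_le[OF \<epsilon>] by simp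
    show "\<forall>\<^sub>F n in sequentially. \<epsilon> n \<le> inverse (real (Suc n))"
      by (simp add: \<epsilon>_def inverse_eq_divide)
  qed
  ultimately show ?thesis using K \<epsilon> nbhd by (intro that[of K \<epsilon>]) auto
qed

text \<open>The subdivision is cut at its first exit from \<open>[0, t] \<times> K\<close> and at time \<open>t + 1\<close>; this
  bounds both its points and their number uniformly in \<open>x\<close>.\<close>

definition exit_partition ::
    "real \<Rightarrow> 'a::metric_space set \<Rightarrow> real \<Rightarrow> real \<Rightarrow> (real \<Rightarrow> 'a option) \<Rightarrow> nat \<Rightarrow> (nat \<Rightarrow> real) \<Rightarrow> bool"
  where "exit_partition t K \<epsilon> \<delta> x N p \<longleftrightarrow>
    p 0 = 0 \<and> (\<forall>i<N. p i + \<delta> < p (Suc i)) \<and> ennreal (p N) \<le> lifetime x \<and> p N \<le> t + 1 \<and>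
    (t < p N \<or> x (p N) \<notin> Some ` K) \<and> (\<forall>i<N. x (p i) \<in> Some ` K) \<and>
    (\<forall>i<N. \<forall>s\<in>{p i..<p (Suc i)}. dist (the (x (p i))) (the (x s)) \<le> \<epsilon>)"

text \<open>A strict bound on the infimum yields an actual subdivision with that oscillation.
  Cutting it preserves the gaps: the point before the first exit is at most \<open>t\<close>, so
  even a cut at \<open>t + 1\<close> leaves a gap of at least 1, which exceeds \<delta>.\<close>

lemma ex_exit_partition:
  assumes "modulus t K x \<delta> < ennreal \<epsilon>" "0 < \<delta>" "\<delta> < 1" "0 \<le> t"
  shows "\<exists>N p. exit_partition t K \<epsilon> \<delta> x N p"
proof -
  from assms(1) obtain N \<tau> where sub: "(N, \<tau>) \<in> subdivisions t K x \<delta>"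
    and sup: "(SUP (i, s1, s2)\<in>{(i, s1, s2). i < N \<and> s1 \<in> {\<tau> i..<\<tau> (Suc i)} \<and> s2 \<in> {\<tau> i..<\<tau> (Suc i)}}.
         ennreal (dist (the (x s1)) (the (x s2)))) < ennreal \<epsilon>"
    unfolding modulus_def INF_less_iff by auto
  from sub have \<tau>: "\<tau> 0 = 0" "\<And>i. i < N \<Longrightarrow> \<tau> i < \<tau> (Suc i)" "ennreal (\<tau> N) \<le> lifetime x"
    "(\<tau> N, x (\<tau> N)) \<notin> {0..t} \<times> Some ` K" "\<And>i. i < N \<Longrightarrow> \<tau> i + \<delta> < \<tau> (Suc i)"
    by (auto simp: subdivisions_def algebra_simps)
  have osc: "dist (the (x (\<tau> i))) (the (x s)) \<le> \<epsilon>" if "i < N" "s \<in> {\<tau> i..<\<tau> (Suc i)}" for i s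
  proof -
    have "ennreal (dist (the (x (\<tau> i))) (the (x s))) < ennreal \<epsilon>"
      using that \<tau>(2)[OF that(1)]
      by (intro le_less_trans[OF _ sup] SUP_upper2[of "(i, \<tau> i, s)"]) auto
    then show ?thesis by (simp add: ennreal_less_iff)
  qed
  define P where "P i \<longleftrightarrow> t < \<tau> i \<or> x (\<tau> i) \<notin> Some ` K" for i
  have "0 \<le> \<tau> N" using le_upto_steps[of N \<tau> 0 N] \<tau>(1,2) by simp
  then have "P N" using \<tau>(4) by (auto simp: P_def)
  define M where "M = (LEAST i. P i)"
  have M: "P M" "M \<le> N" "\<And>i. i < M \<Longrightarrow> \<not> P i"
    unfolding M_def using \<open>P N\<close> by (auto intro: LeastI Least_le dest: not_less_Least)
  \<comment> \<open>Only the last point can change. If it is moved down to \<open>t + 1\<close>, it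
    still counts as an exit, since it lies beyond \<open>t\<close>.\<close>
  define p where "p i = (if i < M then \<tau> i else min (\<tau> M) (t + 1))" for i
  have p_le: "p i \<le> \<tau> i" if "i \<le> M" for i using that by (cases "i = M") (auto simp: p_def)
  have "\<tau> M \<le> \<tau> N" using le_upto_steps[of N \<tau> M N] \<tau>(2) M(2) by simp
  have "exit_partition t K \<epsilon> \<delta> x M p"
    unfolding exit_partition_def
  proof (intro conjI allI impI ballI)
    show "p 0 = 0" using \<tau>(1) \<open>0 \<le> t\<close> by (auto simp: p_def)
    show "p i + \<delta> < p (Suc i)" if "i < M" for i
      using \<tau>(5)[of i] that M(2) M(3)[OF that] \<open>\<delta> < 1\<close>
      by (cases "Suc i = M") (auto simp: p_def P_def)
    have "ennreal (p M) \<le> ennreal (\<tau> N)" using \<open>\<tau> M \<le> \<tau> N\<close> by (intro ennreal_leI) (simp add: p_def)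
    then show "ennreal (p M) \<le> lifetime x" using \<tau>(3) by (rule order_trans)
    show "p M \<le> t + 1" by (simp add: p_def)
    show "t < p M \<or> x (p M) \<notin> Some ` K" using M(1) by (auto simp: p_def P_def min_def)
    show "x (p i) \<in> Some ` K" if "i < M" for i using M(3)[OF that] that by (simp add: p_def P_def)
    fix i s assume "i < M" "s \<in> {p i..<p (Suc i)}"
    then show "dist (the (x (p i))) (the (x s)) \<le> \<epsilon>"
      using osc[of i s] p_le[of "Suc i"] M(2) by (auto simp: p_def split: if_splits)
  qed
  then show ?thesis by blast
qed

lemma ex_step_right:
  fixes \<tau> :: "nat \<Rightarrow> 'a::linorder"
  assumes "\<tau> 0 \<le> s" "s < \<tau> N"
  shows "\<exists>i<N. \<tau> i \<le> s \<and> s < \<tau> (Suc i)"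
  using assms(2)
proof (induction N)
  case 0 then show ?case using assms(1) by simp
next
  case (Suc N) then show ?case by (cases "s < \<tau> N") (auto simp: less_Suc_eq)
qed

lemma ex_step_left:
  fixes \<tau> :: "nat \<Rightarrow> 'a::linorder"
  assumes "\<tau> 0 < s" "s \<le> \<tau> N"
  shows "\<exists>i<N. \<tau> i < s \<and> s \<le> \<tau> (Suc i)"
  using assms(2)
proof (induction N)
  case 0 then show ?case using assms(1) by simp
next
  case (Suc N) then show ?case by (cases "s \<le> \<tau> N") (auto simp: less_Suc_eq)
qed

lemma exit_partition_le:
  assumes "exit_partition t K \<epsilon> \<delta> x N p" "0 < \<delta>" "i \<le> j" "j \<le> N"
  shows "p i \<le> p j"
proof (rule le_upto_steps[OF _ assms(3,4)])
  show "p i < p (Suc i)" if "i < N" for i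
    using assms(1,2) that by (force simp: exit_partition_def)
qed

lemma exit_partition_length:
  assumes "exit_partition t K \<epsilon> \<delta> x N p" "0 < \<delta>"
  shows "real N * \<delta> \<le> t + 1"
proof -
  have "real i * \<delta> \<le> p i" if "i \<le> N" for i
    using that
  proof (induction i)
    case 0 then show ?case using assms by (simp add: exit_partition_def)
  next
    case (Suc i)
    then have "p i + \<delta> < p (Suc i)" using assms(1) by (simp add: exit_partition_def)
    then show ?case using Suc by (simp add: algebra_simps)
  qed
  from this[of N] show ?thesis using assms(1) by (simp add: exit_partition_def)
qed

section \<open>The limit path\<close>

text \<open>Take for \<open>\<nu> k\<close> the greatest \<open>n\<close> such that \<open>P\<close>
  holds at \<open>k\<close> for all levels up to \<open>n\<close>. The cap \<open>n \<le> k\<close>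
  ensures that this maximum exists, also when \<open>P\<close> holds at every level.\<close>

lemma ex_diverging_diagonal:
  assumes "\<And>n::nat. \<forall>\<^sub>F k in sequentially. P n k"
  obtains \<nu> :: "nat \<Rightarrow> nat" where "filterlim \<nu> at_top sequentially"
    "\<forall>\<^sub>F k in sequentially. P (\<nu> k) k"
proof -
  define Q where "Q k n \<longleftrightarrow> n \<le> k \<and> (\<forall>m\<le>n. P m k)" for n k
  define \<nu> where "\<nu> k = (GREATEST n. Q k n)" for k
  have ev: "\<forall>\<^sub>F k in sequentially. Q k n" for n
  proof -
    have "\<forall>\<^sub>F k in sequentially. \<forall>m\<in>{..n}. P m k"
      using assms by (intro eventually_ball_finite) auto
    moreover have "\<forall>\<^sub>F k in sequentially. n \<le> k" by (rule eventually_ge_at_top)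
    ultimately show ?thesis by eventually_elim (auto simp: Q_def)
  qed
  have bound: "Q k n \<Longrightarrow> n \<le> k" for k n by (simp add: Q_def)
  have "filterlim \<nu> at_top sequentially"
    unfolding filterlim_at_top
  proof
    fix n
    show "\<forall>\<^sub>F k in sequentially. n \<le> \<nu> k"
      using ev[of n]
    proof eventually_elim
      case (elim k)
      then show ?case unfolding \<nu>_def by (rule Greatest_le_nat) (rule bound)
    qed
  qed
  moreover have "\<forall>\<^sub>F k in sequentially. P (\<nu> k) k"
    using ev[of 0]
  proof eventually_elim
    case (elim k)
    then have "Q k (\<nu> k)" unfolding \<nu>_def by (rule GreatestI_nat) (rule bound)
    then show ?case by (simp add: Q_def)
  qed
  ultimately show ?thesis using that by blast
qed

text \<open>The oscillation condition is a Cauchy criterion at \<open>s\<close>. Compactness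
  supplies a cluster point along a sequence increasing to \<open>s\<close>, and the criterion
  promotes it to a limit; completeness of the space is thereby avoided.\<close>

lemma compact_left_limit:
  fixes f :: "real \<Rightarrow> 'a::metric_space"
  assumes "compact C"
    and C: "\<forall>\<^sub>F u in at_left s. f u \<in> C"
    and osc: "\<And>e. 0 < e \<Longrightarrow> \<exists>z. \<forall>\<^sub>F u in at_left s. dist (f u) z < e"
  shows "\<exists>l\<in>C. (f \<longlongrightarrow> l) (at_left s)"
proof -
  define u where "u n = s - inverse (real (Suc n))" for n
  have "u \<longlonglongrightarrow> s - 0" unfolding u_def by (intro tendsto_intros LIMSEQ_inverse_real_of_nat)
  then have u: "filterlim u (at_left s) sequentially"
    by (intro tendsto_imp_filterlim_at_left) (simp_all add: u_def)
  from filterlim_iff[THEN iffD1, OF u, rule_format, OF C]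
  obtain n0 where n0: "\<And>n. n \<ge> n0 \<Longrightarrow> f (u n) \<in> C" by (auto simp: eventually_sequentially)
  have "\<forall>n. (f \<circ> (\<lambda>n. u (n + n0))) n \<in> C" using n0 by simp
  then obtain l r where l: "l \<in> C" "strict_mono r" "((f \<circ> (\<lambda>n. u (n + n0))) \<circ> r) \<longlonglongrightarrow> l"
    by (rule seq_compactE[OF compact_imp_seq_compact[OF assms(1)]])
  have "filterlim (\<lambda>n. r n + n0) sequentially sequentially"
    by (rule filterlim_at_top_mono[OF filterlim_subseq[OF l(2)]]) simp
  then have ur: "filterlim (\<lambda>n. u (r n + n0)) (at_left s) sequentially"
    by (rule filterlim_compose[OF u])
  have "(f \<longlongrightarrow> l) (at_left s)"
  proof (rule tendstoI)
    fix e :: real assume "0 < e"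
    then obtain z where z: "\<forall>\<^sub>F u in at_left s. dist (f u) z < e / 3" using osc[of "e / 3"] by auto
    have "\<forall>\<^sub>F n in sequentially. dist (f (u (r n + n0))) z < e / 3"
      using filterlim_iff[THEN iffD1, OF ur, rule_format, OF z] .
    moreover have "\<forall>\<^sub>F n in sequentially. dist (f (u (r n + n0))) l < e / 3"
      using tendstoD[OF l(3), of "e / 3"] \<open>0 < e\<close> by simp
    ultimately have "\<forall>\<^sub>F n in sequentially. dist z l < 2 * e / 3"
    proof eventually_elim
      case (elim n)
      then show ?case using dist_triangle3[of z l "f (u (r n + n0))"] by linarith
    qed
    then have "dist z l < 2 * e / 3" by simp
    show "\<forall>\<^sub>F u in at_left s. dist (f u) l < e"
      using z
    proof eventually_elim
      case (elim u)
      then show ?case using \<open>dist z l < _\<close> dist_triangle[of "f u" l z] by linarith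
    qed
  qed
  then show ?thesis using l(1) by blast
qed

text \<open>The situation after all extractions: \<open>xs\<close> is already the subsequence, and
  the number \<open>N n\<close> of steps no longer depends on \<open>k\<close>, once
  \<open>k\<close> is large for the level. Values are assumed to converge only for
  \<open>i < N n\<close>, since at the last point the path may be dead or far outside
  \<open>K n\<close>.\<close>

locale partition_limit =
  fixes S :: "'a::metric_space set" and K :: "nat \<Rightarrow> 'a set" and \<epsilon> \<delta> :: "nat \<Rightarrow> real"
    and xs :: "nat \<Rightarrow> real \<Rightarrow> 'a option" and N :: "nat \<Rightarrow> nat"
    and p :: "nat \<Rightarrow> nat \<Rightarrow> nat \<Rightarrow> real" and \<tau> :: "nat \<Rightarrow> nat \<Rightarrow> real" and a :: "nat \<Rightarrow> nat \<Rightarrow> 'a"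
  assumes compact_K: "compact (K n)" and K_sub: "K n \<subseteq> S"
    and K_nbhd: "x \<in> K n \<Longrightarrow> y \<in> S \<Longrightarrow> dist x y \<le> \<epsilon> n \<Longrightarrow> y \<in> K (Suc n)"
    and K_exhaust: "compact C \<Longrightarrow> C \<subseteq> S \<Longrightarrow> \<exists>n. C \<subseteq> K n"
    and \<epsilon>_pos: "0 < \<epsilon> n" and \<epsilon>_lim: "\<epsilon> \<longlonglongrightarrow> 0" and \<delta>_pos: "0 < \<delta> n"
    and xs_D: "xs k \<in> D_exp S"
    and partition: "\<forall>\<^sub>F k in sequentially. exit_partition (real n) (K n) (\<epsilon> n) (\<delta> n) (xs k) (N n) (p n k)"
    and p_lim: "i \<le> N n \<Longrightarrow> (\<lambda>k. p n k i) \<longlonglongrightarrow> \<tau> n i"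
    and a_lim: "i < N n \<Longrightarrow> (\<lambda>k. the (xs k (p n k i))) \<longlonglongrightarrow> a n i"
begin

abbreviation good :: "nat \<Rightarrow> nat \<Rightarrow> bool"
  where "good n k \<equiv> exit_partition (real n) (K n) (\<epsilon> n) (\<delta> n) (xs k) (N n) (p n k)"

text \<open>The limit of the times at which the level \<open>n\<close> partitions end, by exit from
  \<open>K n\<close> or by passing time \<open>n\<close>.\<close>

definition \<sigma> :: "nat \<Rightarrow> real" where "\<sigma> n = \<tau> n (N n)"

lemma K_Suc: "K n \<subseteq> K (Suc n)"
  using K_nbhd[of _ n] K_sub[of n] less_imp_le[OF \<epsilon>_pos[of n]] by auto

lemma K_mono: "n \<le> m \<Longrightarrow> K n \<subseteq> K m"
  using K_Suc by (rule lift_Suc_mono_le)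

lemma \<tau>_0: "\<tau> n 0 = 0"
proof -
  have "\<forall>\<^sub>F k in sequentially. p n k 0 = 0"
    using partition[of n] by eventually_elim (simp add: exit_partition_def)
  then have "(\<lambda>k. p n k 0) \<longlonglongrightarrow> 0" by (rule tendsto_eventually)
  then show ?thesis using p_lim[of 0 n] LIMSEQ_unique by blast
qed

text \<open>The uniform lower bound on the gaps survives the limit, so neighbouring partition points
  do not merge.\<close>

lemma \<tau>_gap:
  assumes "i < N n"
  shows "\<tau> n i + \<delta> n \<le> \<tau> n (Suc i)"
proof (rule tendsto_le[OF _ p_lim tendsto_add[OF p_lim tendsto_const]])
  show "\<forall>\<^sub>F k in sequentially. p n k i + \<delta> n \<le> p n k (Suc i)"
    using partition[of n] by eventually_elim (use assms in \<open>auto simp: exit_partition_def intro: less_imp_le\<close>)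
qed (use assms in auto)

lemma \<tau>_less: "i < N n \<Longrightarrow> \<tau> n i < \<tau> n (Suc i)"
  using \<tau>_gap[of i n] \<delta>_pos[of n] by linarith

lemma \<tau>_le_\<sigma>: "i \<le> N n \<Longrightarrow> \<tau> n i \<le> \<sigma> n"
  unfolding \<sigma>_def using le_upto_steps[of "N n" "\<tau> n" i "N n"] \<tau>_less by simp

lemma \<tau>_nonneg: "i \<le> N n \<Longrightarrow> 0 \<le> \<tau> n i"
  using le_upto_steps[of "N n" "\<tau> n" 0 i] \<tau>_less[of _ n] \<tau>_0[of n] by simp

lemma good_le: "good n k \<Longrightarrow> i \<le> j \<Longrightarrow> j \<le> N n \<Longrightarrow> p n k i \<le> p n k j"
  using exit_partition_le[OF _ \<delta>_pos] by blast

lemma good_0: "good n k \<Longrightarrow> p n k 0 = 0"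
  by (simp add: exit_partition_def)

lemma good_nonneg: "good n k \<Longrightarrow> i \<le> N n \<Longrightarrow> 0 \<le> p n k i"
  using good_le[of n k 0 i] good_0[of n k] by simp

text \<open>The path is alive before the last partition point, and within a step it is
  \<epsilon>-close to a value in \<open>K n\<close>, which by the choice of the exhaustion keeps it
  in \<open>K (Suc n)\<close>.\<close>

lemma good_step:
  assumes "good n k" "i < N n" "p n k i \<le> s" "s < p n k (Suc i)"
  shows "xs k s = Some (the (xs k s))" "the (xs k s) \<in> S" "the (xs k s) \<in> K (Suc n)"
    "dist (the (xs k (p n k i))) (the (xs k s)) \<le> \<epsilon> n"
proof -
  have "0 \<le> s" using good_nonneg[OF assms(1), of i] assms by simp
  have "s < p n k (N n)" using good_le[OF assms(1), of "Suc i" "N n"] assms by simp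
  then have "ennreal s < ennreal (p n k (N n))" using \<open>0 \<le> s\<close> by (simp add: ennreal_lessI)
  moreover have "ennreal (p n k (N n)) \<le> lifetime (xs k)"
    using assms(1) by (simp add: exit_partition_def)
  ultimately have "ennreal s < lifetime (xs k)" by (rule less_le_trans)
  then show s: "xs k s = Some (the (xs k s))" "the (xs k s) \<in> S"
    using D_exp_value[OF xs_D \<open>0 \<le> s\<close>] by auto
  show d: "dist (the (xs k (p n k i))) (the (xs k s)) \<le> \<epsilon> n"
    using assms by (auto simp: exit_partition_def)
  have "the (xs k (p n k i)) \<in> K n" using assms(1,2) by (auto simp: exit_partition_def)
  then show "the (xs k s) \<in> K (Suc n)" using s(2) d by (rule K_nbhd)
qed

lemma good_range:
  assumes "good n k" "0 \<le> s" "s < p n k (N n)"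
  shows "xs k s = Some (the (xs k s))" "the (xs k s) \<in> S" "the (xs k s) \<in> K (Suc n)"
proof -
  obtain i where "i < N n" "p n k i \<le> s" "s < p n k (Suc i)"
    using ex_step_right[of "p n k" s "N n"] assms good_0 by auto
  then show "xs k s = Some (the (xs k s))" "the (xs k s) \<in> S" "the (xs k s) \<in> K (Suc n)"
    using good_step[OF assms(1)] by auto
qed

text \<open>The path stays in \<open>K (Suc n)\<close> before the exit at level \<open>n\<close>, so it exits later at level
  \<open>Suc n\<close>.\<close>

lemma good_exit_mono:
  assumes "good n k" "good (Suc n) k"
  shows "p n k (N n) \<le> p (Suc n) k (N (Suc n))"
proof (rule ccontr)
  let ?q = "p (Suc n) k (N (Suc n))"
  assume "\<not> ?thesis"
  then have q: "?q < p n k (N n)" "0 \<le> ?q" using good_nonneg[OF assms(2)] by auto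
  have "p n k (N n) \<le> real (Suc n)" using assms(1) by (simp add: exit_partition_def add.commute)
  then have "xs k ?q \<notin> Some ` K (Suc n)" using assms(2) q by (auto simp: exit_partition_def)
  then show False using good_range[OF assms(1) q(2,1)] by (metis imageI)
qed

lemma \<sigma>_lim: "(\<lambda>k. p n k (N n)) \<longlonglongrightarrow> \<sigma> n"
  unfolding \<sigma>_def by (rule p_lim) simp

lemma \<sigma>_Suc: "\<sigma> n \<le> \<sigma> (Suc n)"
proof (rule tendsto_le[OF _ \<sigma>_lim \<sigma>_lim])
  show "\<forall>\<^sub>F k in sequentially. p n k (N n) \<le> p (Suc n) k (N (Suc n))"
    using partition[of n] partition[of "Suc n"] by eventually_elim (rule good_exit_mono)
qed simp

lemma \<sigma>_mono: "n \<le> m \<Longrightarrow> \<sigma> n \<le> \<sigma> m"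
  using \<sigma>_Suc by (rule lift_Suc_mono_le)

lemma \<sigma>_nonneg: "0 \<le> \<sigma> n"
  unfolding \<sigma>_def by (rule \<tau>_nonneg) simp

definition in_step :: "nat \<Rightarrow> nat \<Rightarrow> real \<Rightarrow> bool"
  where "in_step n i s \<longleftrightarrow> i < N n \<and> \<tau> n i \<le> s \<and> s < \<tau> n (Suc i)"

lemma ex_in_step: "0 \<le> s \<Longrightarrow> s < \<sigma> n \<Longrightarrow> \<exists>i. in_step n i s"
  using ex_step_right[of "\<tau> n" s "N n"] \<tau>_0 unfolding in_step_def \<sigma>_def by auto

lemma in_step_less_\<sigma>: "in_step n i s \<Longrightarrow> s < \<sigma> n"
  using \<tau>_le_\<sigma>[of "Suc i" n] by (auto simp: in_step_def)

text \<open>Both steps contain a common point \<open>s' > s\<close> in their interiors; for large \<open>k\<close> it lies in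
  the corresponding steps of \<open>xs k\<close>.\<close>

lemma in_step_compare:
  assumes "in_step n i s" "in_step m j s"
  shows "dist (a n i) (a m j) \<le> \<epsilon> n + \<epsilon> m" "a m j \<in> K (Suc n)"
proof -
  obtain s' where s': "s < s'" "s' < min (\<tau> n (Suc i)) (\<tau> m (Suc j))"
    using dense[of s "min (\<tau> n (Suc i)) (\<tau> m (Suc j))"] assms by (auto simp: in_step_def)
  have ev: "\<forall>\<^sub>F k in sequentially. good n k \<and> p n k i < s' \<and> s' < p n k (Suc i)" if "in_step n i s" "s' < \<tau> n (Suc i)" for n i
  proof -
    have "\<forall>\<^sub>F k in sequentially. p n k i < s'"
      by (rule order_tendstoD(2)[OF p_lim]) (use that s'(1) in \<open>auto simp: in_step_def\<close>)
    moreover have "\<forall>\<^sub>F k in sequentially. s' < p n k (Suc i)"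
      by (rule order_tendstoD(1)[OF p_lim]) (use that in \<open>auto simp: in_step_def\<close>)
    ultimately show ?thesis using partition[of n] by eventually_elim simp
  qed
  have ev1: "\<forall>\<^sub>F k in sequentially. good n k \<and> p n k i < s' \<and> s' < p n k (Suc i)"
    and ev2: "\<forall>\<^sub>F k in sequentially. good m k \<and> p m k j < s' \<and> s' < p m k (Suc j)"
    using ev[OF assms(1)] ev[OF assms(2)] s'(2) by auto
  have in_N: "i < N n" "j < N m" using assms by (auto simp: in_step_def)
  have "\<forall>\<^sub>F k in sequentially. dist (the (xs k (p n k i))) (the (xs k (p m k j))) \<le> \<epsilon> n + \<epsilon> m \<and>
      the (xs k (p m k j)) \<in> K (Suc n)"
    using ev1 ev2
  proof eventually_elim
    case (elim k)
    have "dist (the (xs k (p n k i))) (the (xs k s')) \<le> \<epsilon> n"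
      using elim in_N by (intro good_step(4)) auto
    moreover have "dist (the (xs k (p m k j))) (the (xs k s')) \<le> \<epsilon> m"
      using elim in_N by (intro good_step(4)) auto
    ultimately have "dist (the (xs k (p n k i))) (the (xs k (p m k j))) \<le> \<epsilon> n + \<epsilon> m"
      using dist_triangle2[of "the (xs k (p n k i))" "the (xs k (p m k j))" "the (xs k s')"] by linarith
    \<comment> \<open>The level \<open>m\<close> step starts before \<open>s'\<close>, hence before
      the level \<open>n\<close> partition ends, so the path is still in \<open>K (Suc n)\<close> at
      that time.\<close>
    moreover have "p m k j < p n k (N n)"
      using elim good_le[of n k "Suc i" "N n"] in_N by auto
    then have "the (xs k (p m k j)) \<in> K (Suc n)"
      using elim good_nonneg[of m k j] in_N by (intro good_range(3)) auto
    ultimately show ?case by simp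
  qed
  then have lim1: "\<forall>\<^sub>F k in sequentially. dist (the (xs k (p n k i))) (the (xs k (p m k j))) \<le> \<epsilon> n + \<epsilon> m"
    and lim2: "\<forall>\<^sub>F k in sequentially. the (xs k (p m k j)) \<in> K (Suc n)"
    by (auto elim: eventually_mono)
  show "dist (a n i) (a m j) \<le> \<epsilon> n + \<epsilon> m"
    using tendsto_upperbound[OF tendsto_dist[OF a_lim[OF in_N(1)] a_lim[OF in_N(2)]] lim1] by simp
  show "a m j \<in> K (Suc n)"
    using Lim_in_closed_set[OF compact_imp_closed[OF compact_K] lim2 _ a_lim[OF in_N(2)]] by simp
qed

section \<open>The limit path and its regularity\<close>

text \<open>Describes the value at \<open>s\<close> of the uniform limit of the step functions by
  its distance to every level. For \<open>s\<close> below some \<open>\<sigma> n\<close> such a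
  value is unique, because two of them differ by at most \<open>2 * \<epsilon> n\<close> at all
  large levels.\<close>

definition is_value :: "real \<Rightarrow> 'a \<Rightarrow> bool"
  where "is_value s z \<longleftrightarrow> (\<forall>n i. in_step n i s \<longrightarrow> z \<in> K (Suc n) \<and> dist z (a n i) \<le> \<epsilon> n)"

text \<open>From level \<open>n0\<close> on the step values at \<open>s\<close> lie in the compact
  set \<open>K (Suc n0)\<close>. A cluster point inherits all comparisons between levels, with the
  error of the varying level tending to 0.\<close>

lemma ex_is_value:
  assumes "0 \<le> s" "s < \<sigma> n0"
  shows "\<exists>z. is_value s z"
proof -
  have "\<exists>i. in_step (n0 + m) i s" for m
    using assms \<sigma>_mono[of n0 "n0 + m"] by (intro ex_in_step) auto
  then obtain ix where ix: "\<And>m. in_step (n0 + m) (ix m) s" by metis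
  define b where "b m = a (n0 + m) (ix m)" for m
  obtain i0 where i0: "in_step n0 i0 s" using ex_in_step[OF assms] by blast
  have "\<forall>m. b m \<in> K (Suc n0)" unfolding b_def using in_step_compare(2)[OF i0 ix] by blast
  then obtain z r where z: "strict_mono r" "(b \<circ> r) \<longlonglongrightarrow> z"
    using compact_imp_seq_compact[OF compact_K[of "Suc n0"]] unfolding seq_compact_def by metis
  have \<epsilon>r: "(\<lambda>m. \<epsilon> (n0 + r m)) \<longlonglongrightarrow> 0"
  proof -
    have "(\<lambda>m. \<epsilon> (m + n0)) \<longlonglongrightarrow> 0" using \<epsilon>_lim by (rule LIMSEQ_ignore_initial_segment)
    from LIMSEQ_subseq_LIMSEQ[OF this z(1)] show ?thesis by (simp add: o_def add.commute)
  qed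
  have "z \<in> K (Suc n)" "dist z (a n i) \<le> \<epsilon> n" if ni: "in_step n i s" for n i
  proof -
    have "\<forall>\<^sub>F m in sequentially. (b \<circ> r) m \<in> K (Suc n)"
      unfolding b_def o_def using in_step_compare(2)[OF ni ix] by simp
    from Lim_in_closed_set[OF compact_imp_closed[OF compact_K] this _ z(2)] show "z \<in> K (Suc n)" by simp
    have "(\<lambda>m. \<epsilon> (n0 + r m) + \<epsilon> n) \<longlonglongrightarrow> 0 + \<epsilon> n" by (intro tendsto_add \<epsilon>r tendsto_const)
    moreover have "(\<lambda>m. dist ((b \<circ> r) m) (a n i)) \<longlonglongrightarrow> dist z (a n i)"
      by (intro tendsto_dist z(2) tendsto_const)
    ultimately have "dist z (a n i) \<le> 0 + \<epsilon> n"
      by (rule tendsto_le[OF sequentially_bot])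
        (use in_step_compare(1)[OF ix ni] in \<open>simp add: b_def\<close>)
    then show "dist z (a n i) \<le> \<epsilon> n" by simp
  qed
  then show ?thesis unfolding is_value_def by blast
qed

definition y :: "real \<Rightarrow> 'a"
  where "y s = (SOME z. is_value s z)"

definition x :: "real \<Rightarrow> 'a option"
  where "x s = (if 0 \<le> s \<and> (\<exists>n. s < \<sigma> n) then Some (y s) else None)"

lemma y_step:
  assumes "in_step n i s"
  shows "y s \<in> K (Suc n)" "dist (y s) (a n i) \<le> \<epsilon> n"
proof -
  have "0 \<le> s" using assms \<tau>_nonneg[of i n] by (auto simp: in_step_def)
  from ex_is_value[OF this in_step_less_\<sigma>[OF assms]] have "is_value s (y s)"
    unfolding y_def by (rule someI_ex)
  then show "y s \<in> K (Suc n)" "dist (y s) (a n i) \<le> \<epsilon> n" using assms by (auto simp: is_value_def)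
qed

lemma x_eq: "0 \<le> s \<Longrightarrow> s < \<sigma> n \<Longrightarrow> x s = Some (y s)"
  by (auto simp: x_def)

lemma y_in_S: "0 \<le> s \<Longrightarrow> s < \<sigma> n \<Longrightarrow> y s \<in> S"
  using ex_in_step y_step(1) K_sub by blast

lemma dom_x: "dom x = {s. 0 \<le> s \<and> ennreal s < (SUP n. ennreal (\<sigma> n))}"
  by (auto simp: x_def dom_def less_SUP_iff ennreal_less_iff split: if_splits)

lemma lifetime_x: "lifetime x = (SUP n. ennreal (\<sigma> n))"
  by (rule lifetime_eq[OF dom_x])

lemma less_lifetime_x: "0 \<le> s \<Longrightarrow> ennreal s < lifetime x \<longleftrightarrow> (\<exists>n. s < \<sigma> n)"
  by (auto simp: lifetime_x less_SUP_iff ennreal_less_iff)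

lemma ev_\<epsilon>_less: "0 < e \<Longrightarrow> \<forall>\<^sub>F n in sequentially. \<epsilon> n < e"
  using \<epsilon>_lim by (rule order_tendstoD(2))

lemma ev_less_\<sigma>: "s < \<sigma> n0 \<Longrightarrow> \<forall>\<^sub>F n in sequentially. s < \<sigma> n"
  using \<sigma>_mono[of n0] unfolding eventually_sequentially by (meson less_le_trans)

text \<open>Just before \<open>s\<close> the path stays in one step of each level, so its
  oscillation there is controlled by \<open>\<epsilon> n\<close>. The hypothesis allows
  \<open>s = \<sigma> n\<close>, which is needed at the end of the lifetime.\<close>

lemma x_left_limit:
  assumes "0 < s" "\<forall>\<^sub>F n in sequentially. s \<le> \<sigma> n"
  shows "\<exists>l\<in>S. ((\<lambda>s. the (x s)) \<longlongrightarrow> l) (at_left s)"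
proof -
  have left: "\<exists>z. \<forall>\<^sub>F u in at_left s. the (x u) \<in> K (Suc n) \<and> dist (the (x u)) z \<le> \<epsilon> n"
    if s: "s \<le> \<sigma> n" for n
  proof -
    \<comment> \<open>The step is chosen open on the left and closed on the right, so that it
      contains a left neighbourhood of \<open>s\<close> even when \<open>s\<close> is a partition
      point.\<close>
    obtain i where i: "i < N n" "\<tau> n i < s" "s \<le> \<tau> n (Suc i)"
      using ex_step_left[of "\<tau> n" s "N n"] assms(1) s \<tau>_0 by (auto simp: \<sigma>_def)
    have "\<forall>\<^sub>F u in at_left s. u \<in> {\<tau> n i<..<s}" by (rule eventually_at_left_real[OF i(2)])
    then have "\<forall>\<^sub>F u in at_left s. the (x u) \<in> K (Suc n) \<and> dist (the (x u)) (a n i) \<le> \<epsilon> n"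
    proof eventually_elim
      case (elim u)
      then have u: "in_step n i u" using i by (auto simp: in_step_def)
      moreover have "x u = Some (y u)"
        using elim i \<tau>_nonneg[of i n] by (intro x_eq[OF _ in_step_less_\<sigma>[OF u]]) auto
      ultimately show ?case using y_step by simp
    qed
    then show ?thesis by blast
  qed
  obtain n0 where n0: "s \<le> \<sigma> n0" using assms(2) by (auto simp: eventually_sequentially)
  have "\<exists>l\<in>K (Suc n0). ((\<lambda>s. the (x s)) \<longlongrightarrow> l) (at_left s)"
  proof (rule compact_left_limit[OF compact_K])
    show "\<forall>\<^sub>F u in at_left s. the (x u) \<in> K (Suc n0)"
      using left[OF n0] by (auto elim: eventually_mono)
    fix e :: real assume "0 < e"
    have "\<forall>\<^sub>F n in sequentially. s \<le> \<sigma> n \<and> \<epsilon> n < e"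
      using assms(2) ev_\<epsilon>_less[OF \<open>0 < e\<close>] by eventually_elim simp
    then obtain n where n: "s \<le> \<sigma> n" "\<epsilon> n < e" using eventually_happens[of _ sequentially] by auto
    from left[OF n(1)] obtain z where "\<forall>\<^sub>F u in at_left s. the (x u) \<in> K (Suc n) \<and> dist (the (x u)) z \<le> \<epsilon> n" ..
    then have "\<forall>\<^sub>F u in at_left s. dist (the (x u)) z < e" using n(2) by (auto elim: eventually_mono)
    then show "\<exists>z. \<forall>\<^sub>F u in at_left s. dist (the (x u)) z < e" ..
  qed
  then show ?thesis using K_sub by blast
qed

text \<open>Steps are closed on the left, so the step of each level containing \<open>s\<close> also
  contains a right neighbourhood of \<open>s\<close>; both values are within
  \<open>\<epsilon> n < e / 2\<close> of the same step value.\<close>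

lemma x_right_cont:
  assumes "0 \<le> s" "s < \<sigma> n0"
  shows "((\<lambda>s. the (x s)) \<longlongrightarrow> the (x s)) (at_right s)"
proof (rule tendstoI)
  fix e :: real assume "0 < e"
  have "\<forall>\<^sub>F n in sequentially. s < \<sigma> n \<and> \<epsilon> n < e / 2"
    using ev_less_\<sigma>[OF assms(2)] ev_\<epsilon>_less[of "e / 2"] \<open>0 < e\<close> by (auto intro: eventually_conj)
  then obtain n where n: "s < \<sigma> n" "\<epsilon> n < e / 2" using eventually_happens[of _ sequentially] by auto
  obtain i where i: "in_step n i s" using ex_in_step[OF assms(1) n(1)] by blast
  then have "s < \<tau> n (Suc i)" by (simp add: in_step_def)
  then have "\<forall>\<^sub>F u in at_right s. u \<in> {s<..<\<tau> n (Suc i)}" by (rule eventually_at_right_real)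
  then show "\<forall>\<^sub>F u in at_right s. dist (the (x u)) (the (x s)) < e"
  proof eventually_elim
    case (elim u)
    then have u: "in_step n i u" using i by (auto simp: in_step_def)
    have "the (x u) = y u" "the (x s) = y s"
      using x_eq[OF _ in_step_less_\<sigma>[OF u]] x_eq[OF assms] elim assms(1) by auto
    moreover have "dist (y u) (y s) < e"
      using y_step(2)[OF u] y_step(2)[OF i] n(2) dist_triangle2[of "y u" "y s" "a n i"] by linarith
    ultimately show ?case by simp
  qed
qed

lemma x_D_exp: "x \<in> D_exp S"
proof -
  have "\<exists>T. dom x = {t. 0 \<le> t \<and> ennreal t < T}" using dom_x by blast
  moreover have "ran x \<subseteq> S"
    using y_in_S by (auto simp: ran_def x_def split: if_splits)
  moreover have "((\<lambda>s. the (x s)) \<longlongrightarrow> the (x t)) (at_right t)" if t: "t \<in> dom x" for t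
  proof -
    obtain n where "0 \<le> t" "t < \<sigma> n" using t by (auto simp: x_def dom_def split: if_splits)
    then show ?thesis by (rule x_right_cont)
  qed
  moreover have "\<exists>l\<in>S. ((\<lambda>s. the (x s)) \<longlongrightarrow> l) (at_left t)" if t: "t \<in> dom x" "t > 0" for t
  proof -
    obtain n where "t < \<sigma> n" using t by (auto simp: x_def dom_def split: if_splits)
    from ev_less_\<sigma>[OF this] show ?thesis
      by (intro x_left_limit t(2)) (auto elim: eventually_mono)
  qed
  ultimately show ?thesis unfolding D_exp_def by blast
qed

text \<open>If the limit stays in \<open>K m\<close>, the points \<open>p n k (N n)\<close> where \<open>xs k\<close> leaves \<open>K n\<close> cannot
  converge to a time before the end of its life.\<close>

lemma \<sigma>_eventually_const:
  assumes "ran x \<subseteq> K m" "m < n" "\<sigma> n < real n" "n \<le> n'"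
  shows "\<sigma> n' = \<sigma> n"
proof (rule ccontr)
  assume "\<sigma> n' \<noteq> \<sigma> n"
  then have lt: "\<sigma> n < \<sigma> n'" using \<sigma>_mono[OF assms(4)] by simp
  \<comment> \<open>A level \<open>M\<close> that ends strictly later sees the path just after the
    exit at level \<open>n\<close>. The three approximations below cost \<open>\<epsilon> M\<close>
    each, hence the third of \<open>\<epsilon> m\<close>.\<close>
  have "\<forall>\<^sub>F M in sequentially. \<sigma> n < \<sigma> M \<and> \<epsilon> M < \<epsilon> m / 3"
    using ev_less_\<sigma>[OF lt] ev_\<epsilon>_less[of "\<epsilon> m / 3"] \<epsilon>_pos[of m] by (auto intro: eventually_conj)
  then obtain M where M: "\<sigma> n < \<sigma> M" "\<epsilon> M < \<epsilon> m / 3" using eventually_happens[of _ sequentially] by auto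
  have "\<forall>\<^sub>F k in sequentially. p n k (N n) < p M k (N M)"
    using order_tendstoD(1)[OF tendsto_diff[OF \<sigma>_lim[of M] \<sigma>_lim[of n]], of 0] M(1) by simp
  moreover have "\<forall>\<^sub>F k in sequentially. p n k (N n) < real n"
    using \<sigma>_lim assms(3) by (rule order_tendstoD(2))
  moreover have "\<forall>\<^sub>F k in sequentially. \<forall>j\<in>{..<N M}. dist (the (xs k (p M k j))) (a M j) < \<epsilon> M"
    using a_lim \<epsilon>_pos by (intro eventually_ball_finite ballI tendstoD) auto
  ultimately have "\<forall>\<^sub>F k in sequentially. False"
    using partition[of n] partition[of M]
  proof eventually_elim
    case (elim k)
    let ?q = "p n k (N n)"
    \<comment> \<open>The level \<open>n\<close> partition ends before time \<open>n\<close>, so its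
      end must be due to leaving \<open>K n\<close> and not to the time bound.\<close>
    have q: "0 \<le> ?q" "xs k ?q \<notin> Some ` K n"
      using good_nonneg[OF elim(4)] elim(2,4) by (auto simp: exit_partition_def)
    obtain j where j: "j < N M" "p M k j \<le> ?q" "?q < p M k (Suc j)"
      using ex_step_right[of "p M k" ?q "N M"] elim q good_0 by auto
    note g = good_step[OF elim(5) j]
    have jj: "in_step M j (\<tau> M j)" using j \<tau>_less[of j M] by (simp add: in_step_def)
    have "y (\<tau> M j) \<in> K m"
      using x_eq[OF _ in_step_less_\<sigma>[OF jj]] \<tau>_nonneg[of j M] j assms(1) by (auto intro: ranI)
    \<comment> \<open>The chain runs from the limit path to the step value, to the path at the start
      of that step, to the path at the exit. It brings the exit value within
      \<open>\<epsilon> m\<close> of \<open>K m\<close>, hence into \<open>K n\<close>, a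
      contradiction.\<close>
    moreover have "dist (y (\<tau> M j)) (the (xs k ?q)) \<le> \<epsilon> m"
    proof -
      have "dist (y (\<tau> M j)) (the (xs k ?q)) \<le> dist (y (\<tau> M j)) (a M j)
          + dist (a M j) (the (xs k (p M k j))) + dist (the (xs k (p M k j))) (the (xs k ?q))"
        using dist_triangle[of "y (\<tau> M j)" "the (xs k ?q)" "a M j"]
          dist_triangle[of "a M j" "the (xs k ?q)" "the (xs k (p M k j))"] by linarith
      moreover have "dist (the (xs k (p M k j))) (a M j) < \<epsilon> M" using elim(3) j(1) by simp
      ultimately show ?thesis using y_step(2)[OF jj] g(4) M(2) by (simp add: dist_commute)
    qed
    ultimately have "the (xs k ?q) \<in> K (Suc m)" using g(2) by (intro K_nbhd)
    then have "the (xs k ?q) \<in> K n" using K_mono[of "Suc m" n] assms(2) by auto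
    then show False using q(2) g(1) by (metis imageI)
  qed
  then show False by simp
qed

lemma relcompact_lifetime:
  assumes "lifetime x < \<infinity>" "relcompact_in (ran x) S"
  obtains n0 where "\<And>n. n0 \<le> n \<Longrightarrow> \<sigma> n = enn2real (lifetime x)"
proof -
  obtain C where C: "compact C" "C \<subseteq> S" "ran x \<subseteq> C" using assms(2) by (auto simp: relcompact_in_def)
  then obtain m where m: "ran x \<subseteq> K m" using K_exhaust[OF C(1,2)] by blast
  define \<xi> where "\<xi> = enn2real (lifetime x)"
  have \<xi>: "ennreal \<xi> = lifetime x" using assms(1) by (simp add: \<xi>_def)
  have \<sigma>_le: "\<sigma> n \<le> \<xi>" for n
  proof -
    have "ennreal (\<sigma> n) \<le> ennreal \<xi>" unfolding \<xi> lifetime_x by (rule SUP_upper) simp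
    then show ?thesis by (simp add: \<xi>_def ennreal_le_iff)
  qed
  \<comment> \<open>At levels beyond the lifetime the time bound cannot end a partition in the
    limit, so the constancy lemma applies.\<close>
  obtain n1 where "\<xi> < real n1" using reals_Archimedean2 by blast
  moreover define n where "n = max (Suc m) n1"
  ultimately have n: "m < n" "\<xi> < real n" by auto
  have const: "\<sigma> n' = \<sigma> n" if "n \<le> n'" for n'
    using \<sigma>_eventually_const[OF m n(1) _ that] \<sigma>_le[of n] n(2) by simp
  have "lifetime x = ennreal (\<sigma> n)"
    unfolding lifetime_x
  proof (rule antisym)
    show "(SUP n. ennreal (\<sigma> n)) \<le> ennreal (\<sigma> n)"
    proof (intro SUP_least ennreal_leI)
      show "\<sigma> i \<le> \<sigma> n" for i using const[of i] \<sigma>_mono[of i n] by (cases "i \<le> n") auto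
    qed
  qed (rule SUP_upper, simp)
  then have "enn2real (lifetime x) = \<sigma> n" using \<sigma>_nonneg[of n] by simp
  then show ?thesis using const by (intro that[of n]) metis
qed

text \<open>In the case that demands a left limit at the end of life, the lifetime equals
  \<open>\<sigma> n\<close> for all large \<open>n\<close>, so the left-limit lemma reaches
  it.\<close>

lemma x_D_loc: "x \<in> D_loc S"
  unfolding D_loc_def
proof (intro CollectI conjI impI x_D_exp, elim conjE)
  assume x: "0 < lifetime x" "lifetime x < \<infinity>" "relcompact_in (ran x) S"
  obtain n0 where n0: "\<And>n. n0 \<le> n \<Longrightarrow> \<sigma> n = enn2real (lifetime x)" using relcompact_lifetime[OF x(2,3)] by blast
  show "\<exists>l\<in>S. ((\<lambda>s. the (x s)) \<longlongrightarrow> l) (at_left (enn2real (lifetime x)))"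
  proof (rule x_left_limit)
    show "0 < enn2real (lifetime x)" using x by (simp add: enn2real_positive_iff)
    show "\<forall>\<^sub>F n in sequentially. enn2real (lifetime x) \<le> \<sigma> n"
      unfolding eventually_sequentially using n0 by (metis order_refl)
  qed
qed

end

section \<open>Relative compactness\<close>

context partition_limit
begin

text \<open>Interpolation sends limiting partition points to those of \<open>xs k\<close>, so
  corresponding steps are compared; the three errors are limit path to step value, step value to
  \<open>xs k\<close> at the partition point, and oscillation within the step. The bound by
  \<open>\<sigma> n + 1\<close> later shows that an end of the partition is not caused by the time
  bound.\<close>

lemma approximate_time_change:
  "\<forall>\<^sub>F k in sequentially. \<exists>l\<in>time_changes. good n k \<and> l (\<sigma> n) = p n k (N n) \<and>
     (\<forall>t. log_deriv_norm t l \<le> ennreal (inverse (real (Suc n)))) \<and>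
     (\<forall>s. 0 \<le> s \<and> s < \<sigma> n \<longrightarrow> dist (the (x s)) (the (xs k (l s))) \<le> 3 * \<epsilon> n) \<and>
     p n k (N n) < \<sigma> n + 1"
proof -
  define \<eta> where "\<eta> = inverse (real (Suc n))"
  have \<eta>: "0 < \<eta>" by (simp add: \<eta>_def)
  \<comment> \<open>The gaps of \<open>xs k\<close> converge to positive gaps, so their ratios to
    them tend to 1.\<close>
  have "\<forall>\<^sub>F k in sequentially. \<forall>i\<in>{..<N n}.
      exp (- \<eta>) * (\<tau> n (Suc i) - \<tau> n i) < p n k (Suc i) - p n k i \<and>
      p n k (Suc i) - p n k i < exp \<eta> * (\<tau> n (Suc i) - \<tau> n i)"
  proof (intro eventually_ball_finite ballI finite_lessThan eventually_conj)
    fix i assume "i \<in> {..<N n}"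
    then have i: "i < N n" by simp
    have lim: "(\<lambda>k. p n k (Suc i) - p n k i) \<longlonglongrightarrow> \<tau> n (Suc i) - \<tau> n i"
      using i by (intro tendsto_diff p_lim) auto
    have pos: "0 < \<tau> n (Suc i) - \<tau> n i" using \<tau>_less[OF i] by simp
    show "\<forall>\<^sub>F k in sequentially. exp (- \<eta>) * (\<tau> n (Suc i) - \<tau> n i) < p n k (Suc i) - p n k i"
      using pos \<eta> by (intro order_tendstoD(1)[OF lim]) simp
    show "\<forall>\<^sub>F k in sequentially. p n k (Suc i) - p n k i < exp \<eta> * (\<tau> n (Suc i) - \<tau> n i)"
      using pos \<eta> by (intro order_tendstoD(2)[OF lim]) simp
  qed
  moreover have "\<forall>\<^sub>F k in sequentially. \<forall>i\<in>{..<N n}. dist (the (xs k (p n k i))) (a n i) < \<epsilon> n"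
    using a_lim \<epsilon>_pos by (intro eventually_ball_finite ballI tendstoD) auto
  moreover have "\<forall>\<^sub>F k in sequentially. p n k (N n) < \<sigma> n + 1"
    by (rule order_tendstoD(2)[OF \<sigma>_lim]) simp
  ultimately show ?thesis
    using partition[of n]
  proof eventually_elim
    case (elim k)
    obtain l where l: "l \<in> time_changes" "\<And>i. i \<le> N n \<Longrightarrow> l (\<tau> n i) = p n k i"
      "\<And>t. log_deriv_norm t l \<le> ennreal \<eta>"
    proof (rule ex_time_change_interpolating[of \<eta> "\<tau> n" "p n k" "N n"])
      show "p n k 0 = 0" using elim(4) by (rule good_0)
    qed (use \<eta> \<tau>_0 \<tau>_less elim(1) in \<open>auto intro: less_imp_le\<close>)
    have "dist (the (x s)) (the (xs k (l s))) \<le> 3 * \<epsilon> n" if s: "0 \<le> s" "s < \<sigma> n" for s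
    proof -
      obtain i where i: "in_step n i s" using ex_in_step[OF s] by blast
      then have iN: "i < N n" by (simp add: in_step_def)
      have "p n k i \<le> l s"
        using time_changes_mono_le[OF l(1) \<tau>_nonneg[of i n], of s] l(2)[of i] i by (auto simp: in_step_def)
      moreover have "l s < p n k (Suc i)"
        using time_changes_mono[OF l(1) s(1), of "\<tau> n (Suc i)"] l(2)[of "Suc i"] i by (auto simp: in_step_def)
      ultimately have "dist (the (xs k (p n k i))) (the (xs k (l s))) \<le> \<epsilon> n"
        by (rule good_step(4)[OF elim(4) iN])
      moreover have "dist (the (xs k (p n k i))) (a n i) < \<epsilon> n" using elim(2) iN by simp
      moreover have "dist (the (x s)) (a n i) \<le> \<epsilon> n" using x_eq[OF s] y_step(2)[OF i] by simp
      ultimately show ?thesis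
        using dist_triangle[of "the (x s)" "the (xs k (l s))" "a n i"]
          dist_triangle3[of "a n i" "the (xs k (l s))" "the (xs k (p n k i))"] by linarith
    qed
    moreover have "l (\<sigma> n) = p n k (N n)" using l(2)[of "N n"] by (simp add: \<sigma>_def)
    ultimately show ?case using l(1,3) elim unfolding \<eta>_def by (intro bexI[of _ l]) auto
  qed
qed

text \<open>The level \<open>\<nu> k\<close> grows slowly enough for the approximation at that level
  to be available for \<open>xs k\<close>; its errors then vanish as the level tends to
  infinity.\<close>

theorem local_Skorokhod_conv_x: "local_Skorokhod_conv S xs x"
proof -
  define Q where "Q n k l \<longleftrightarrow> l \<in> time_changes \<and> good n k \<and> l (\<sigma> n) = p n k (N n) \<and>
     (\<forall>t. log_deriv_norm t l \<le> ennreal (inverse (real (Suc n)))) \<and>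
     (\<forall>s. 0 \<le> s \<and> s < \<sigma> n \<longrightarrow> dist (the (x s)) (the (xs k (l s))) \<le> 3 * \<epsilon> n) \<and>
     p n k (N n) < \<sigma> n + 1" for n k l
  have "\<forall>\<^sub>F k in sequentially. \<exists>l. Q n k l" for n
    using approximate_time_change[of n] by eventually_elim (auto simp: Q_def)
  then obtain \<nu> :: "nat \<Rightarrow> nat" where \<nu>: "filterlim \<nu> at_top sequentially"
    "\<forall>\<^sub>F k in sequentially. \<exists>l. Q (\<nu> k) k l"
    by (rule ex_diverging_diagonal[of "\<lambda>n k. \<exists>l. Q n k l"])
  \<comment> \<open>The identity fills in for the finitely many \<open>k\<close> without a suitable
    time change.\<close>
  define l where "l k = (if \<exists>l. Q (\<nu> k) k l then SOME l. Q (\<nu> k) k l else (\<lambda>s. s))" for k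
  have evQ: "\<forall>\<^sub>F k in sequentially. Q (\<nu> k) k (l k)"
    using \<nu>(2)
  proof eventually_elim
    case (elim k)
    then show ?case unfolding l_def if_P[OF elim] by (rule someI_ex)
  qed
  have "(\<lambda>s. s) \<in> time_changes" by (rule bilipschitz_time_changes[of 1 _ 1]) auto
  then have l: "l k \<in> time_changes" for k
  proof (cases "\<exists>l. Q (\<nu> k) k l")
    case True
    then have "Q (\<nu> k) k (l k)" unfolding l_def if_P[OF True] by (rule someI_ex)
    then show ?thesis by (simp add: Q_def)
  next
    case False
    then show ?thesis using \<open>(\<lambda>s. s) \<in> time_changes\<close> by (simp add: l_def)
  qed
  have norm0: "(\<lambda>k. log_deriv_norm t (l k)) \<longlonglongrightarrow> 0" for t
  proof (rule tendsto_sandwich[OF _ _ tendsto_const])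
    show "\<forall>\<^sub>F k in sequentially. log_deriv_norm t (l k) \<le> ennreal (inverse (real (Suc (\<nu> k))))"
      using evQ by eventually_elim (auto simp: Q_def)
    have "(\<lambda>n. ennreal (inverse (real (Suc n)))) \<longlonglongrightarrow> ennreal 0"
      by (intro tendsto_ennrealI LIMSEQ_inverse_real_of_nat)
    from filterlim_compose[OF this \<nu>(1)]
    show "(\<lambda>k. ennreal (inverse (real (Suc (\<nu> k))))) \<longlonglongrightarrow> 0" by simp
  qed simp
  \<comment> \<open>A general index set \<open>A\<close> covers both the half-open interval up to
    the lifetime and the closed intervals before it.\<close>
  have dist0: "(\<lambda>k. SUP s\<in>A. ennreal (dist (the (x s)) (the (xs k (l k s))))) \<longlonglongrightarrow> 0"
    if A: "A \<subseteq> {0..}" "\<forall>\<^sub>F n in sequentially. \<forall>s\<in>A. s < \<sigma> n" for A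
  proof (rule tendsto_sandwich[OF _ _ tendsto_const])
    have "\<forall>\<^sub>F k in sequentially. \<forall>s\<in>A. s < \<sigma> (\<nu> k)" by (rule eventually_compose_filterlim[OF A(2) \<nu>(1)])
    then show "\<forall>\<^sub>F k in sequentially. (SUP s\<in>A. ennreal (dist (the (x s)) (the (xs k (l k s))))) \<le> ennreal (3 * \<epsilon> (\<nu> k))"
      using evQ
    proof eventually_elim
      case (elim k)
      show ?case
        using elim A(1) by (intro SUP_least ennreal_leI) (auto simp: Q_def)
    qed
    have "(\<lambda>n. ennreal (3 * \<epsilon> n)) \<longlonglongrightarrow> ennreal (3 * 0)"
      by (intro tendsto_ennrealI tendsto_mult tendsto_const \<epsilon>_lim)
    from filterlim_compose[OF this \<nu>(1)]
    show "(\<lambda>k. ennreal (3 * \<epsilon> (\<nu> k))) \<longlonglongrightarrow> 0" by simp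
  qed simp
  show ?thesis
    unfolding local_Skorokhod_conv_def
  proof (intro exI[of _ l] conjI allI l)
    show "if lifetime x < \<infinity> \<and> relcompact_in (ran x) S then
         let \<xi> = enn2real (lifetime x) in
           (\<forall>\<^sub>F k in sequentially. ennreal (l k \<xi>) \<le> lifetime (xs k)) \<and>
           (\<lambda>k. SUP s\<in>{0..<\<xi>}. ennreal (dist (the (x s)) (the (xs k (l k s))))) \<longlonglongrightarrow> 0 \<and>
           limitin (Alexandroff_compactification (top_of_set S))
             (\<lambda>k. xs k (l k \<xi>)) None sequentially \<and>
           (\<lambda>k. log_deriv_norm \<xi> (l k)) \<longlonglongrightarrow> 0
       else
         (\<forall>t\<ge>0. ennreal t < lifetime x \<longrightarrow>
           (\<forall>\<^sub>F k in sequentially. ennreal (l k t) < lifetime (xs k)) \<and>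
           (\<lambda>k. SUP s\<in>{0..t}. ennreal (dist (the (x s)) (the (xs k (l k s))))) \<longlonglongrightarrow> 0 \<and>
           (\<lambda>k. log_deriv_norm t (l k)) \<longlonglongrightarrow> 0)"
    proof (cases "lifetime x < \<infinity> \<and> relcompact_in (ran x) S")
      case True
      define \<xi> where "\<xi> = enn2real (lifetime x)"
      obtain n0 where n0: "\<And>n. n0 \<le> n \<Longrightarrow> \<sigma> n = \<xi>"
        using relcompact_lifetime True unfolding \<xi>_def by metis
      \<comment> \<open>With \<open>\<xi> + 1 \<le> real n\<close> the end of the partition, which
        is below \<open>\<xi> + 1\<close>, comes before time \<open>n\<close>. The path is therefore
        outside \<open>K (\<nu> k)\<close> or dead at that time.\<close>
      have "\<forall>\<^sub>F n in sequentially. n0 \<le> n \<and> \<xi> + 1 \<le> real n"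
      proof (intro eventually_conj eventually_ge_at_top)
        obtain n1 where "\<xi> + 1 \<le> real n1" using real_arch_simple by blast
        then show "\<forall>\<^sub>F n in sequentially. \<xi> + 1 \<le> real n"
          unfolding eventually_sequentially by (meson le_trans of_nat_mono order_trans)
      qed
      from eventually_compose_filterlim[OF this \<nu>(1)]
      have ev\<nu>: "\<forall>\<^sub>F k in sequentially. n0 \<le> \<nu> k \<and> \<xi> + 1 \<le> real (\<nu> k)" .
      have exit: "\<forall>\<^sub>F k in sequentially. ennreal (l k \<xi>) \<le> lifetime (xs k) \<and> xs k (l k \<xi>) \<notin> Some ` K (\<nu> k)"
        using evQ ev\<nu>
      proof eventually_elim
        case (elim k)
        then have "l k \<xi> = p (\<nu> k) k (N (\<nu> k))" "l k \<xi> < \<xi> + 1"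
          using n0[of "\<nu> k"] by (auto simp: Q_def)
        moreover have "good (\<nu> k) k" using elim by (simp add: Q_def)
        ultimately show ?case using elim(2) by (auto simp: exit_partition_def)
      qed
      have "limitin (Alexandroff_compactification (top_of_set S)) (\<lambda>k. xs k (l k \<xi>)) None sequentially"
        unfolding limitin_def
      proof (intro conjI allI impI)
        show "None \<in> topspace (Alexandroff_compactification (top_of_set S))" by simp
        fix U assume "openin (Alexandroff_compactification (top_of_set S)) U \<and> None \<in> U"
        then obtain C where C: "compact C" "C \<subseteq> S" "U = insert None (Some ` (S - C))"
          unfolding openin_Alexandroff_compactification by (auto simp: compactin_subtopology)
        then obtain m where m: "C \<subseteq> K m" using K_exhaust by blast
        \<comment> \<open>Once the level passes \<open>m\<close>, avoiding
          \<open>K (\<nu> k)\<close> implies avoiding \<open>C\<close>; this is convergence to the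
          cemetery point.\<close>
        have "\<forall>\<^sub>F k in sequentially. m \<le> \<nu> k"
          using \<nu>(1) by (simp add: filterlim_at_top)
        then show "\<forall>\<^sub>F k in sequentially. xs k (l k \<xi>) \<in> U"
          using exit
        proof eventually_elim
          case (elim k)
          show ?case
          proof (cases "xs k (l k \<xi>)")
            case None
            then show ?thesis using C by simp
          next
            case (Some z)
            have "ran (xs k) \<subseteq> S" using xs_D by (simp add: D_exp_def)
            then have "z \<in> S" using Some by (auto intro: ranI)
            moreover have "z \<notin> C" using elim m K_mono[of m "\<nu> k"] Some by auto
            ultimately show ?thesis using Some C by simp
          qed
        qed
      qed
      moreover have "\<forall>\<^sub>F n in sequentially. \<forall>s\<in>{0..<\<xi>}. s < \<sigma> n"
        using eventually_ge_at_top[of n0] by eventually_elim (simp add: n0)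
      then have "(\<lambda>k. SUP s\<in>{0..<\<xi>}. ennreal (dist (the (x s)) (the (xs k (l k s))))) \<longlonglongrightarrow> 0"
        by (intro dist0) auto
      moreover have "\<forall>\<^sub>F k in sequentially. ennreal (l k \<xi>) \<le> lifetime (xs k)"
        using exit by (auto elim: eventually_mono)
      ultimately show ?thesis
        unfolding if_P[OF True] Let_def \<xi>_def[symmetric] using norm0 by blast
    next
      case False
      have "\<forall>\<^sub>F k in sequentially. ennreal (l k t) < lifetime (xs k)"
        "(\<lambda>k. SUP s\<in>{0..t}. ennreal (dist (the (x s)) (the (xs k (l k s))))) \<longlonglongrightarrow> 0"
        if t: "0 \<le> t" "ennreal t < lifetime x" for t
      proof -
        obtain n0 where "t < \<sigma> n0" using less_lifetime_x t by blast
        then have ev: "\<forall>\<^sub>F n in sequentially. t < \<sigma> n" by (rule ev_less_\<sigma>)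
        have "\<forall>\<^sub>F k in sequentially. t < \<sigma> (\<nu> k)" by (rule eventually_compose_filterlim[OF ev \<nu>(1)])
        then show "\<forall>\<^sub>F k in sequentially. ennreal (l k t) < lifetime (xs k)"
          using evQ
        proof eventually_elim
          case (elim k)
          have "l k t < p (\<nu> k) k (N (\<nu> k))"
            using time_changes_mono[OF l t(1) elim(1), of k] elim(2) by (simp add: Q_def)
          then have "ennreal (l k t) < ennreal (p (\<nu> k) k (N (\<nu> k)))"
            using time_changes_nonneg[OF l t(1), of k] by (simp add: ennreal_lessI)
          also have "\<dots> \<le> lifetime (xs k)" using elim(2) by (simp add: Q_def exit_partition_def)
          finally show ?case .
        qed
        have "\<forall>\<^sub>F n in sequentially. \<forall>s\<in>{0..t}. s < \<sigma> n" using ev by eventually_elim auto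
        then show "(\<lambda>k. SUP s\<in>{0..t}. ennreal (dist (the (x s)) (the (xs k (l k s))))) \<longlonglongrightarrow> 0"
          by (intro dist0) auto
      qed
      then show ?thesis unfolding if_not_P[OF False] using norm0 by blast
    qed
  qed
qed

end

section \<open>Extraction of convergent partitions\<close>

lemma common_convergent_subseq:
  fixes u :: "nat \<Rightarrow> nat \<Rightarrow> 'a::metric_space"
  assumes "compact C" "\<And>i k. i < N \<Longrightarrow> u i k \<in> C"
  shows "\<exists>r. strict_mono r \<and> (\<forall>i<N. \<exists>l. (\<lambda>k. u i (r k)) \<longlonglongrightarrow> l)"
  using assms(2)
proof (induction N)
  case 0
  show ?case using strict_mono_id by (intro exI[of _ id]) (simp add: id_def)
next
  case (Suc N)
  then obtain r where r: "strict_mono r" "\<forall>i<N. \<exists>l. (\<lambda>k. u i (r k)) \<longlonglongrightarrow> l" by auto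
  have "\<forall>k. (\<lambda>k. u N (r k)) k \<in> C" using Suc.prems by simp
  then obtain l r' where r': "strict_mono r'" "((\<lambda>k. u N (r k)) \<circ> r') \<longlonglongrightarrow> l"
    by (rule seq_compactE[OF compact_imp_seq_compact[OF assms(1)]])
  have "\<exists>l. (\<lambda>k. u i ((r \<circ> r') k)) \<longlonglongrightarrow> l" if "i < Suc N" for i
  proof (cases "i = N")
    case True
    then show ?thesis using r'(2) by (auto simp: o_def)
  next
    case False
    then have "i < N" using that by simp
    with r(2) obtain l where "(\<lambda>k. u i (r k)) \<longlonglongrightarrow> l" by blast
    from LIMSEQ_subseq_LIMSEQ[OF this r'(1)] show ?thesis by (auto simp: o_def)
  qed
  then show ?case using strict_mono_o[OF r(1) r'(1)] by blast
qed

lemma constant_subseq: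
  fixes f :: "nat \<Rightarrow> nat"
  assumes "\<And>k. f k \<le> B"
  shows "\<exists>r c. strict_mono (r :: nat \<Rightarrow> nat) \<and> (\<forall>k. f (r k) = c)"
proof -
  have "finite (range f)" using assms by (auto intro: finite_subset[of "range f" "{..B}"])
  then obtain k0 where inf: "infinite {k. f k = f k0}"
    using pigeonhole_infinite[of UNIV f] by auto
  then show ?thesis
    using strict_mono_enumerate[OF inf] enumerate_in_set[OF inf] by blast
qed

text \<open>Every clause depends only on the tail of \<open>r\<close>. This matters because a
  diagonal sequence is a subsequence of each extraction only from some index on.\<close>

definition partition_conv ::
    "(nat \<Rightarrow> real \<Rightarrow> 'a::metric_space option) \<Rightarrow> (nat \<Rightarrow> nat) \<Rightarrow> (nat \<Rightarrow> nat \<Rightarrow> real) \<Rightarrow> nat \<Rightarrow>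
     (nat \<Rightarrow> real) \<Rightarrow> (nat \<Rightarrow> 'a) \<Rightarrow> (nat \<Rightarrow> nat) \<Rightarrow> bool"
  where "partition_conv xs M q N \<tau> a r \<longleftrightarrow>
    (\<forall>\<^sub>F k in sequentially. M (r k) = N) \<and> (\<forall>i\<le>N. (\<lambda>k. q (r k) i) \<longlonglongrightarrow> \<tau> i) \<and>
    (\<forall>i<N. (\<lambda>k. the (xs (r k) (q (r k) i))) \<longlonglongrightarrow> a i)"

lemma partition_conv_subseq:
  assumes "partition_conv xs M q N \<tau> a r" "strict_mono s"
  shows "partition_conv xs M q N \<tau> a (r \<circ> s)"
proof -
  have s: "filterlim s at_top sequentially" using assms(2) by (rule filterlim_subseq)
  show ?thesis
    using assms(1) unfolding partition_conv_def o_def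
    by (auto intro: eventually_compose_filterlim[OF _ s] filterlim_compose[OF _ s])
qed

lemma partition_conv_shift:
  assumes "partition_conv xs M q N \<tau> a (r \<circ> (+) m)"
  shows "partition_conv xs M q N \<tau> a r"
proof -
  from assms have 1: "\<forall>\<^sub>F k in sequentially. M (r (k + m)) = N"
    and 2: "\<And>i. i \<le> N \<Longrightarrow> (\<lambda>k. q (r (k + m)) i) \<longlonglongrightarrow> \<tau> i"
    and 3: "\<And>i. i < N \<Longrightarrow> (\<lambda>k. the (xs (r (k + m)) (q (r (k + m)) i))) \<longlonglongrightarrow> a i"
    unfolding partition_conv_def by (auto simp: o_def add.commute)
  show ?thesis
    unfolding partition_conv_def
  proof (intro conjI allI impI)
    show "\<forall>\<^sub>F k in sequentially. M (r k) = N"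
      using 1 by (rule eventually_sequentially_seg[THEN iffD1])
    show "(\<lambda>k. q (r k) i) \<longlonglongrightarrow> \<tau> i" if "i \<le> N" for i using 2[OF that] by (rule LIMSEQ_offset)
    show "(\<lambda>k. the (xs (r k) (q (r k) i))) \<longlonglongrightarrow> a i" if "i < N" for i
      using 3[OF that] by (rule LIMSEQ_offset)
  qed
qed

text \<open>The minimal gap bounds the number of steps, so it is constant along a subsequence.
  Points lie in \<open>[0, t + 1]\<close> and values in \<open>K\<close>, so finitely many further
  extractions make them converge.\<close>

lemma ex_partition_conv:
  assumes "compact K" "0 < \<delta>"
    and part: "\<And>k. exit_partition t K \<epsilon> \<delta> (xs k) (M k) (q k)"
  shows "\<exists>r N \<tau> a. strict_mono r \<and> partition_conv xs M q N \<tau> a r"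
proof -
  have "M k \<le> nat \<lceil>(t + 1) / \<delta>\<rceil>" for k
  proof -
    have "real (M k) \<le> (t + 1) / \<delta>"
      using exit_partition_length[OF part assms(2), of k] assms(2) by (simp add: field_simps)
    then show ?thesis by linarith
  qed
  from constant_subseq[of M, OF this] obtain r1 :: "nat \<Rightarrow> nat" and N where "strict_mono r1" "\<forall>k. M (r1 k) = N"
    by blast
  then have r1: "strict_mono r1" "\<And>k. M (r1 k) = N" by auto
  note part1 = part[of "r1 _", unfolded r1(2)]
  \<comment> \<open>The index \<open>N\<close> is included for the points but not for the values: at
    the last point the path need not be in \<open>K\<close>.\<close>
  have "q (r1 k) i \<in> {0..t + 1}" if "i < Suc N" for i k
    using exit_partition_le[OF part1 assms(2), of 0 i k] exit_partition_le[OF part1 assms(2), of i N k] part1[of k] that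
    by (auto simp: exit_partition_def)
  from common_convergent_subseq[of "{0..t + 1}" "Suc N" "\<lambda>i k. q (r1 k) i", OF compact_Icc this]
  obtain r2 where r2: "strict_mono r2" "\<forall>i<Suc N. \<exists>l. (\<lambda>k. q (r1 (r2 k)) i) \<longlonglongrightarrow> l"
    by auto
  have "the (xs (r1 (r2 k)) (q (r1 (r2 k)) i)) \<in> K" if "i < N" for i k
    using part1[of "r2 k"] that by (force simp: exit_partition_def)
  from common_convergent_subseq[of K N "\<lambda>i k. the (xs (r1 (r2 k)) (q (r1 (r2 k)) i))", OF assms(1) this]
  obtain r3 where r3: "strict_mono r3"
    "\<forall>i<N. \<exists>l. (\<lambda>k. the (xs (r1 (r2 (r3 k))) (q (r1 (r2 (r3 k))) i))) \<longlonglongrightarrow> l"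
    by auto
  from r2(2) obtain \<tau> where \<tau>: "\<And>i. i < Suc N \<Longrightarrow> (\<lambda>k. q (r1 (r2 k)) i) \<longlonglongrightarrow> \<tau> i" by metis
  from r3(2) obtain a where a: "\<And>i. i < N \<Longrightarrow> (\<lambda>k. the (xs (r1 (r2 (r3 k))) (q (r1 (r2 (r3 k))) i))) \<longlonglongrightarrow> a i"
    by metis
  have "partition_conv xs M q N \<tau> a (r1 \<circ> r2 \<circ> r3)"
    unfolding partition_conv_def using a r1(2) LIMSEQ_subseq_LIMSEQ[OF \<tau> r3(1)]
    by (auto simp: o_def less_Suc_eq_le)
  moreover have "strict_mono (r1 \<circ> r2 \<circ> r3)"
    using r1(1) r2(1) r3(1) by (intro strict_mono_o)
  ultimately show ?thesis by blast
qed

theorem ex_local_Skorokhod_conv_subseq: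
  fixes S :: "'a::metric_space set" and xs :: "nat \<Rightarrow> real \<Rightarrow> 'a option"
  assumes S: "locally_compact_space (top_of_set S)" "second_countable (top_of_set S)"
    and D: "D \<subseteq> D_loc S"
    and mod: "\<And>t K. 0 \<le> t \<Longrightarrow> compact K \<Longrightarrow> K \<subseteq> S \<Longrightarrow>
      ((\<lambda>\<delta>. SUP x\<in>D. modulus t K x \<delta>) \<longlongrightarrow> 0) (at_right 0)"
    and xs: "\<And>k. xs k \<in> D"
  shows "\<exists>r x. strict_mono r \<and> x \<in> D_loc S \<and> local_Skorokhod_conv S (xs \<circ> r) x"
proof -
  obtain K :: "nat \<Rightarrow> 'a set" and \<epsilon> :: "nat \<Rightarrow> real"
    where K: "\<And>n. compact (K n)" "\<And>n. K n \<subseteq> S" and \<epsilon>: "\<And>n. 0 < \<epsilon> n" "\<epsilon> \<longlonglongrightarrow> 0"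
      and nbhd: "\<And>n x y. x \<in> K n \<Longrightarrow> y \<in> S \<Longrightarrow> dist x y \<le> \<epsilon> n \<Longrightarrow> y \<in> K (Suc n)"
      and exh: "\<And>C. compact C \<Longrightarrow> C \<subseteq> S \<Longrightarrow> \<exists>n. C \<subseteq> K n"
    using exhaustion[OF S] by metis
  \<comment> \<open>At level \<open>n\<close> the modulus is taken with horizon \<open>n\<close> and
    compact set \<open>K n\<close>; \<delta> is kept below 1 because partitions are cut one time
    unit beyond the horizon.\<close>
  have "\<exists>\<delta>. 0 < \<delta> \<and> \<delta> < 1 \<and> (SUP x\<in>D. modulus (real n) (K n) x \<delta>) < ennreal (\<epsilon> n)" for n
  proof -
    have "\<forall>\<^sub>F \<delta> in at_right 0. (SUP x\<in>D. modulus (real n) (K n) x \<delta>) < ennreal (\<epsilon> n)"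
      using \<epsilon>(1) by (intro order_tendstoD(2)[OF mod] K) auto
    moreover have "\<forall>\<^sub>F \<delta> in at_right (0::real). \<delta> \<in> {0<..<1}" by (rule eventually_at_right_real) simp
    ultimately have "\<forall>\<^sub>F \<delta> in at_right 0. 0 < \<delta> \<and> \<delta> < 1 \<and> (SUP x\<in>D. modulus (real n) (K n) x \<delta>) < ennreal (\<epsilon> n)"
      by eventually_elim auto
    then show ?thesis using eventually_happens[of _ "at_right (0::real)"] by auto
  qed
  then obtain \<delta> where \<delta>: "\<And>n. 0 < \<delta> n" "\<And>n. \<delta> n < 1"
    "\<And>n. (SUP x\<in>D. modulus (real n) (K n) x (\<delta> n)) < ennreal (\<epsilon> n)" by metis
  have "\<exists>N p. exit_partition (real n) (K n) (\<epsilon> n) (\<delta> n) (xs k) N p" for n k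
  proof (rule ex_exit_partition[OF _ \<delta>(1,2)])
    show "modulus (real n) (K n) (xs k) (\<delta> n) < ennreal (\<epsilon> n)"
      by (rule le_less_trans[OF SUP_upper \<delta>(3)]) (rule xs)
  qed simp
  then obtain M q where Mq: "\<And>n k. exit_partition (real n) (K n) (\<epsilon> n) (\<delta> n) (xs k) (M n k) (q n k)" by metis
  define P where "P n r \<longleftrightarrow> (\<exists>N \<tau> a. partition_conv xs (M n) (q n) N \<tau> a r)" for n r
  interpret subseqs P
  proof
    fix n and s :: "nat \<Rightarrow> nat" assume "strict_mono s"
    \<comment> \<open>The extraction is applied to data reindexed by \<open>s\<close>, which gives a
      further subsequence of \<open>s\<close> as the diagonal argument requires.\<close>
    obtain r N \<tau> a where "strict_mono r" "partition_conv (xs \<circ> s) (M n \<circ> s) (q n \<circ> s) N \<tau> a r"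
      using ex_partition_conv[OF K(1)[of n] \<delta>(1)[of n], of "real n" "\<epsilon> n" "xs \<circ> s" "M n \<circ> s" "q n \<circ> s"] Mq
      by (force simp only: o_apply)
    then show "\<exists>r'. strict_mono r' \<and> P n (s \<circ> r')"
      unfolding P_def partition_conv_def o_def by blast
  qed
  have "\<exists>N \<tau> a. partition_conv xs (M n) (q n) N \<tau> a diagseq" for n
  proof -
    \<comment> \<open>From index \<open>Suc n\<close> on, the diagonal sequence is a subsequence of
      the extraction made for level \<open>n\<close>.\<close>
    have "P n (diagseq \<circ> (+) (Suc n))"
      by (rule diagseq_holds) (auto simp: P_def intro: partition_conv_subseq)
    then obtain N \<tau> a where "partition_conv xs (M n) (q n) N \<tau> a (diagseq \<circ> (+) (Suc n))"
      unfolding P_def by blast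
    from partition_conv_shift[OF this] show ?thesis by blast
  qed
  then obtain N \<tau> a where conv: "\<And>n. partition_conv xs (M n) (q n) (N n) (\<tau> n) (a n) diagseq"
    by metis
  interpret partition_limit S K \<epsilon> \<delta> "xs \<circ> diagseq" N "\<lambda>n k. q n (diagseq k)" \<tau> a
  proof
    show "(xs \<circ> diagseq) k \<in> D_exp S" for k using xs D by (auto simp: D_loc_def)
    show "\<forall>\<^sub>F k in sequentially. exit_partition (real n) (K n) (\<epsilon> n) (\<delta> n) ((xs \<circ> diagseq) k) (N n) (q n (diagseq k))" for n
    proof -
      have "\<forall>\<^sub>F k in sequentially. M n (diagseq k) = N n" using conv by (simp add: partition_conv_def)
      then show ?thesis
      proof eventually_elim
        case (elim k)
        show ?case using Mq[of n "diagseq k"] elim by simp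
      qed
    qed
  qed (use K \<epsilon> \<delta> nbhd exh conv in \<open>auto simp: partition_conv_def\<close>)
  show ?thesis using subseq_diagseq x_D_loc local_Skorokhod_conv_x by blast
qed

section \<open>The sequential criterion and the two implications\<close>

theorem theorem2p13:
  fixes S :: "'a::metric_space set"
    and T :: "(real \<Rightarrow> 'a option) topology"
    and D :: "(real \<Rightarrow> 'a option) set"
  assumes "locally_compact_space (top_of_set S)"
    and "second_countable (top_of_set S)"
    and "is_local_Skorokhod_topology S T"
    and "D \<subseteq> D_loc S"
  shows "compactin T (T closure_of D) \<longleftrightarrow>
    (\<forall>t\<ge>0. \<forall>K. compact K \<and> K \<subseteq> S \<longrightarrow>
      ((\<lambda>\<delta>. SUP x\<in>D. modulus t K x \<delta>) \<longlongrightarrow> 0) (at_right 0))"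
proof -
  have top: "topspace T = D_loc S"
    and conv: "\<And>xs x. (\<And>k. xs k \<in> D_loc S) \<Longrightarrow> x \<in> D_loc S \<Longrightarrow>
       limitin T xs x sequentially \<longleftrightarrow> local_Skorokhod_conv S xs x"
    using assms(3) by (auto simp: is_local_Skorokhod_topology_def)
  obtain M d where "Metric_space M d" and T: "T = Metric_space.mtopology M d"
    using assms(3) by (auto simp: is_local_Skorokhod_topology_def Polish_topology_def completely_metrizable_space_def)
  then interpret Metric_space M d by simp
  have M: "M = D_loc S" using top T by simp
  \<comment> \<open>In a metric space the closure is compact exactly if every infinite subset of
    \<open>D\<close> has an accumulation point, equivalently if every sequence in \<open>D\<close>
    has a subsequence converging in the space.\<close>
  have "compactin T (T closure_of D) \<longleftrightarrow>
    (\<forall>E. E \<subseteq> D \<and> infinite E \<longrightarrow> M \<inter> mtopology derived_set_of E \<noteq> {})"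
  proof -
    have "M \<inter> mtopology derived_set_of E = mtopology derived_set_of E" for E
      using derived_set_of_subset_topspace[of mtopology E] by auto
    then show ?thesis
      unfolding T compact_closure_of_eq_Bolzano_Weierstrass using assms(4) M by auto
  qed
  also have "\<dots> \<longleftrightarrow> (\<forall>xs::nat \<Rightarrow> _. range xs \<subseteq> D \<longrightarrow>
      (\<exists>x r. x \<in> M \<and> strict_mono r \<and> limitin mtopology (xs \<circ> r) x sequentially))"
    using assms(4) M by (subst Bolzano_Weierstrass_property) auto
  also have "\<dots> \<longleftrightarrow> (\<forall>xs::nat \<Rightarrow> _. (\<forall>k. xs k \<in> D) \<longrightarrow>
      (\<exists>r x. strict_mono r \<and> x \<in> D_loc S \<and> local_Skorokhod_conv S (xs \<circ> r) x))" (is "_ \<longleftrightarrow> ?seq")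
  proof -
    have "limitin mtopology (xs \<circ> r) x sequentially \<longleftrightarrow> local_Skorokhod_conv S (xs \<circ> r) x"
      if "range xs \<subseteq> D" "x \<in> D_loc S" for xs x and r :: "nat \<Rightarrow> nat"
      using that assms(4) unfolding T[symmetric] by (intro conv) auto
    then have "(\<exists>x r. x \<in> M \<and> strict_mono r \<and> limitin mtopology (xs \<circ> r) x sequentially) \<longleftrightarrow>
        (\<exists>r x. strict_mono r \<and> x \<in> D_loc S \<and> local_Skorokhod_conv S (xs \<circ> r) x)"
      if "range xs \<subseteq> D" for xs :: "nat \<Rightarrow> _"
      using that M by blast
    then show ?thesis by (simp add: image_subset_iff)
  qed
  finally have compact_iff: "compactin T (T closure_of D) \<longleftrightarrow> ?seq" .
  show ?thesis
    unfolding compact_iff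
  proof
    assume seq: ?seq
    show "\<forall>t\<ge>0. \<forall>K. compact K \<and> K \<subseteq> S \<longrightarrow>
      ((\<lambda>\<delta>. SUP x\<in>D. modulus t K x \<delta>) \<longlongrightarrow> 0) (at_right 0)"
    proof (intro allI impI, elim conjE)
      fix t :: real and K assume t: "0 \<le> t" and K: "compact K" "K \<subseteq> S"
      let ?f = "\<lambda>\<delta>. SUP x\<in>D. modulus t K x \<delta>"
      have small: "\<forall>\<^sub>F \<delta> in at_right 0. ?f \<delta> \<le> ennreal \<epsilon>" if \<epsilon>: "0 < \<epsilon>" for \<epsilon>
      proof (rule ccontr)
        assume "\<not> ?thesis"
        then have "\<exists>\<delta>>0. \<delta> < b \<and> \<not> ?f \<delta> \<le> ennreal \<epsilon>" if "0 < b" for b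
          using that unfolding eventually_at_right_field by blast
        \<comment> \<open>Failure of the bound gives arbitrarily small gaps with bad paths. Gap and
          path are chosen simultaneously, so a convergent subsequence of the paths contradicts the
          convergence theorem for varying gaps.\<close>
        then have "\<exists>\<delta> x. 0 < \<delta> \<and> \<delta> < inverse (real (Suc n)) \<and> x \<in> D \<and> \<not> modulus t K x \<delta> \<le> ennreal \<epsilon>" for n
          by (metis SUP_least inverse_positive_iff_positive of_nat_0_less_iff zero_less_Suc)
        then obtain \<delta> xs where d: "\<And>n::nat. 0 < \<delta> n \<and> \<delta> n < inverse (real (Suc n)) \<and> xs n \<in> D \<and>
            \<not> modulus t K (xs n) (\<delta> n) \<le> ennreal \<epsilon>"
          by metis
        then have "\<forall>k. xs k \<in> D" by simp
        with seq obtain r x where r: "strict_mono r" "x \<in> D_loc S" "local_Skorokhod_conv S (xs \<circ> r) x"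
          by blast
        have "\<delta> \<longlonglongrightarrow> 0"
          using d by (intro tendsto_sandwich[OF _ _ tendsto_const LIMSEQ_inverse_real_of_nat])
            (auto intro!: always_eventually less_imp_le)
        then have lim: "(\<delta> \<circ> r) \<longlonglongrightarrow> 0" using r(1) by (rule LIMSEQ_subseq_LIMSEQ)
        have "\<forall>\<^sub>F k in sequentially. modulus t K ((xs \<circ> r) k) ((\<delta> \<circ> r) k) \<le> ennreal \<epsilon>"
          by (rule local_Skorokhod_conv_modulus[OF r(3,2) _ K t lim \<epsilon>]) (use d assms(4) in auto)
        then show False using d by (simp add: eventually_sequentially)
      qed
      show "(?f \<longlongrightarrow> 0) (at_right 0)"
      proof (rule order_tendstoI)
        fix c :: ennreal assume "0 < c"
        \<comment> \<open>The neighbourhood bound \<open>c\<close> is an extended real and may be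
          infinite; passing to some \<open>e < c\<close> provides a real threshold.\<close>
        then obtain e where e: "0 < e" "e < c" using dense by blast
        then have "e < top" using less_le_trans top_greatest by blast
        then obtain \<epsilon> where "0 < \<epsilon>" "ennreal \<epsilon> < c" using e by (cases e) auto
        then show "\<forall>\<^sub>F \<delta> in at_right 0. ?f \<delta> < c"
          using small[of \<epsilon>] by (auto elim: eventually_mono)
      qed simp
    qed
  next
    assume mod: "\<forall>t\<ge>0. \<forall>K. compact K \<and> K \<subseteq> S \<longrightarrow>
      ((\<lambda>\<delta>. SUP x\<in>D. modulus t K x \<delta>) \<longlongrightarrow> 0) (at_right 0)"
    show ?seq
    proof (intro allI impI)
      fix xs :: "nat \<Rightarrow> real \<Rightarrow> 'a option" assume "\<forall>k. xs k \<in> D"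
      then show "\<exists>r x. strict_mono r \<and> x \<in> D_loc S \<and> local_Skorokhod_conv S (xs \<circ> r) x"
        using mod by (intro ex_local_Skorokhod_conv_subseq[OF assms(1,2,4)]) auto
    qed
  qed
qed

end
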